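(* Let $(\Omega,\mathscr A,\mathbb P)$ be a probability space with a complete filtration $\mathscr F=(\mathscr F_t)_{t\ge 0}$ and let $W$ be a (real, standard) Brownian motion with respect to $\mathscr F$. Let $E$ be an infinite dimensional real Hilbert space. Then there exists a strongly progressively measurable process $\phi:[0,1]\times\Omega\to E$ which is weakly in $L^p(\Omega;L^2(0,1))$ for all $p\in[0,1)$ and which satisfies, for all $x\in E$, $$\int_0^1\langle\phi(t),x\rangle\,dW(t)=0\quad\text{almost surely},$$ but $\|\phi\|_{L^2(0,1;E)}=\infty$ almost surely. In particular, $\phi$ is not stochastically integrable.
   Context: $L^0(\Omega;X)$ denotes the space of (equivalence classes of) strongly measurable maps $\Omega\to X$ with the topology of convergence in probability. A strongly measurable process $\phi:[0,1]\times\Omega\to E$ is weakly in $L^p(\Omega;L^2(0,1))$ if for every $x\in E$ the process $\langle\phi,x\rangle$ belongs to $L^p(\Omega;L^2(0,1))$, i.e. $\mathbb E\big(\int_0^1|\langle\phi(t),x\rangle|^2dt\big)^{p/2}<\infty$ if $p>0$, and $\int_0^1|\langle\phi(t),x\rangle|^2dt<\infty$ a.s. if $p=0$. An adapted step process is a finite linear combination of processes $\mathbf 1_{(a,b]}\xi$ with $0\le a<b\le 1$ and $\xi:\Omega\to E$ strongly $\mathscr F_a$-measurable; one sets $\int_0^t\mathbf 1_{(a,b]}\xi\,dW=(W(b\wedge t)-W(a\wedge t))\xi$ and extends by linearity. A strongly measurable adapted process $\phi:[0,1]\times\Omega\to E$ that is weakly in $L^0(\Omega;L^2(0,1))$ is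 stochastically integrable if there are adapted step processes $(\phi_n)_{n\ge1}$ such that (i) for all $x\in E$, $\langle\phi_n,x\rangle\to\langle\phi,x\rangle$ in $L^0(\Omega;L^2(0,1))$, and (ii) $\int_0^\cdot\phi_n\,dW$ converges in $L^0(\Omega;C_b([0,1];E))$. (For Hilbert spaces $E$ this is equivalent to $\phi\in L^2(0,1;E)$ a.s.) *)

theory Defs
  imports "HOL-Probability.Probability"
begin

section \<open>Strong measurability\<close>

text \<open>
  Pointwise limits of simple functions. No separability is assumed on the target, so this is in
  general stronger than Borel measurability. Only the measurable structure of \<open>N\<close> matters.
\<close>

definition strongly_measurable :: "'a measure \<Rightarrow> ('a \<Rightarrow> 'b::topological_space) \<Rightarrow> bool" where
  "strongly_measurable N f \<longleftrightarrow>
     (\<exists>s. (\<forall>i::nat. simple_function N (s i)) \<and> (\<forall>x\<in>space N. (\<lambda>i. s i x) \<longlonglongrightarrow> f x))"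

section \<open>Filtrations and Brownian motion\<close>

text \<open>
  The time set is \<open>[0,\<infinity>)\<close>: values of \<open>F\<close> and \<open>W\<close> at negative times are irrelevant.
  Completeness means that all null events belong to \<open>F 0\<close>. The measure \<open>M\<close> itself need not be
  complete; if it is, then all subsets of null events belong to \<open>F 0\<close> as well.
\<close>

definition complete_filtration :: "'w measure \<Rightarrow> (real \<Rightarrow> 'w measure) \<Rightarrow> bool" where
  "complete_filtration M F \<longleftrightarrow>
     (\<forall>t\<ge>0. subalgebra M (F t)) \<and>
     (\<forall>s t. 0 \<le> s \<longrightarrow> s \<le> t \<longrightarrow> sets (F s) \<subseteq> sets (F t)) \<and>
     null_sets M \<subseteq> sets (F 0)"

definition brownian_motion ::
    "'w measure \<Rightarrow> (real \<Rightarrow> 'w measure) \<Rightarrow> (real \<Rightarrow> 'w \<Rightarrow> real) \<Rightarrow> bool" where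
  "brownian_motion M F W \<longleftrightarrow>
     (\<forall>t\<ge>0. W t \<in> borel_measurable (F t)) \<and>
     (AE \<omega> in M. W 0 \<omega> = 0) \<and>
     (\<forall>\<omega>\<in>space M. continuous_on {0..} (\<lambda>t. W t \<omega>)) \<and>
     (\<forall>s t. 0 \<le> s \<longrightarrow> s < t \<longrightarrow>
        distributed M lborel (\<lambda>\<omega>. W t \<omega> - W s \<omega>) (normal_density 0 (sqrt (t - s))) \<and>
        prob_space.indep_set M (sets (F s))
          {(\<lambda>\<omega>. W t \<omega> - W s \<omega>) -` A \<inter> space M | A. A \<in> sets borel})"

section \<open>Processes on the unit interval\<close>

text \<open>
  A process \<open>[0,1] \<times> \<Omega> \<rightarrow> E\<close> is a function \<open>\<phi> :: real \<Rightarrow> 'w \<Rightarrow> 'e\<close>; its values at times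
  outside \<open>[0,1]\<close> are never used.
\<close>

definition strongly_measurable_process :: "'w measure \<Rightarrow> (real \<Rightarrow> 'w \<Rightarrow> 'e::topological_space) \<Rightarrow> bool"
  where
  "strongly_measurable_process M \<phi> \<longleftrightarrow>
     strongly_measurable (restrict_space borel {0..1} \<Otimes>\<^sub>M M) (\<lambda>(t, \<omega>). \<phi> t \<omega>)"

definition strongly_adapted :: "(real \<Rightarrow> 'w measure) \<Rightarrow> (real \<Rightarrow> 'w \<Rightarrow> 'e::topological_space) \<Rightarrow> bool"
  where
  "strongly_adapted F \<phi> \<longleftrightarrow> (\<forall>t\<in>{0..1}. strongly_measurable (F t) (\<phi> t))"

definition strongly_progressively_measurable ::
    "(real \<Rightarrow> 'w measure) \<Rightarrow> (real \<Rightarrow> 'w \<Rightarrow> 'e::topological_space) \<Rightarrow> bool" where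
  "strongly_progressively_measurable F \<phi> \<longleftrightarrow>
     (\<forall>t\<in>{0..1}. strongly_measurable (restrict_space borel {0..t} \<Otimes>\<^sub>M F t) (\<lambda>(s, \<omega>). \<phi> s \<omega>))"

text \<open>
  Since \<open>enn2real \<infinity> = 0\<close>, almost sure finiteness of the inner integral has to be required
  separately when \<open>p > 0\<close>; when \<open>p = 0\<close> it is the only condition.
\<close>

definition weakly_in_Lp :: "'w measure \<Rightarrow> real \<Rightarrow> (real \<Rightarrow> 'w \<Rightarrow> 'e::real_inner) \<Rightarrow> bool" where
  "weakly_in_Lp M p \<phi> \<longleftrightarrow>
     (\<forall>x. (AE \<omega> in M. (\<integral>\<^sup>+t\<in>{0..1}. ennreal (\<bar>\<phi> t \<omega> \<bullet> x\<bar>\<^sup>2) \<partial>lborel) < \<infinity>) \<and>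
          (0 < p \<longrightarrow>
             (\<integral>\<^sup>+\<omega>. ennreal (enn2real (\<integral>\<^sup>+t\<in>{0..1}. ennreal (\<bar>\<phi> t \<omega> \<bullet> x\<bar>\<^sup>2) \<partial>lborel) powr (p / 2)) \<partial>M)
               < \<infinity>))"

section \<open>The stochastic integral\<close>

text \<open>
  An adapted step process is given by a list of triples \<open>(a, b, \<xi>)\<close>, standing for the sum of
  the processes \<open>1\<^bsub>(a,b]\<^esub> \<xi>\<close>; scalar coefficients are absorbed into \<open>\<xi>\<close>. The integral
  depends only on the process and not on the chosen list.
\<close>

type_synonym ('w, 'e) step = "(real \<times> real \<times> ('w \<Rightarrow> 'e)) list"

definition adapted_step :: "(real \<Rightarrow> 'w measure) \<Rightarrow> ('w, 'e::real_normed_vector) step \<Rightarrow> bool" where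
  "adapted_step F L \<longleftrightarrow>
     (\<forall>(a, b, \<xi>)\<in>set L. 0 \<le> a \<and> a < b \<and> b \<le> 1 \<and> strongly_measurable (F a) \<xi>)"

definition step_process :: "('w, 'e::real_normed_vector) step \<Rightarrow> real \<Rightarrow> 'w \<Rightarrow> 'e" where
  "step_process L t \<omega> = (\<Sum>(a, b, \<xi>)\<leftarrow>L. indicat_real {a<..b} t *\<^sub>R \<xi> \<omega>)"

definition step_integral ::
    "(real \<Rightarrow> 'w \<Rightarrow> real) \<Rightarrow> ('w, 'e::real_normed_vector) step \<Rightarrow> real \<Rightarrow> 'w \<Rightarrow> 'e" where
  "step_integral W L t \<omega> = (\<Sum>(a, b, \<xi>)\<leftarrow>L. (W (min b t) \<omega> - W (min a t) \<omega>) *\<^sub>R \<xi> \<omega>)"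

definition null_in_probability :: "'w measure \<Rightarrow> (nat \<Rightarrow> 'w \<Rightarrow> ennreal) \<Rightarrow> bool" where
  "null_in_probability M D \<longleftrightarrow>
     (\<forall>\<epsilon>>0. (\<lambda>n. measure M {\<omega>\<in>space M. ennreal \<epsilon> < D n \<omega>}) \<longlonglongrightarrow> 0)"

text \<open>
  Membership in \<open>L\<^sup>0(\<Omega>; C\<^sub>b([0,1]; E))\<close>: a process with continuous paths is strongly measurable as
  a \<open>C\<^sub>b([0,1]; E)\<close>-valued map if and only if all its marginals are strongly measurable.
\<close>

definition continuous_process :: "'w measure \<Rightarrow> (real \<Rightarrow> 'w \<Rightarrow> 'e::topological_space) \<Rightarrow> bool" where
  "continuous_process M X \<longleftrightarrow>
     (\<forall>\<omega>\<in>space M. continuous_on {0..1} (\<lambda>t. X t \<omega>)) \<and>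
     (\<forall>t\<in>{0..1}. strongly_measurable M (X t))"

text \<open>
  \<open>X\<close> is (a representative of) the integral process \<open>t \<mapsto> \<integral>\<^sub>0\<^sup>t \<phi> dW\<close>. Convergence in
  \<open>L\<^sup>0(\<Omega>; L\<^sup>2(0,1))\<close> is expressed with the squared \<open>L\<^sup>2\<close>-distance.
\<close>

definition has_stochastic_integral ::
    "'w measure \<Rightarrow> (real \<Rightarrow> 'w measure) \<Rightarrow> (real \<Rightarrow> 'w \<Rightarrow> real) \<Rightarrow>
     (real \<Rightarrow> 'w \<Rightarrow> 'e::real_inner) \<Rightarrow> (real \<Rightarrow> 'w \<Rightarrow> 'e) \<Rightarrow> bool" where
  "has_stochastic_integral M F W \<phi> X \<longleftrightarrow>
     strongly_measurable_process M \<phi> \<and> strongly_adapted F \<phi> \<and> weakly_in_Lp M 0 \<phi> \<and>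
     continuous_process M X \<and>
     (\<exists>L. (\<forall>n. adapted_step F (L n)) \<and>
        (\<forall>x. null_in_probability M
           (\<lambda>n \<omega>. \<integral>\<^sup>+t\<in>{0..1}. ennreal (\<bar>step_process (L n) t \<omega> \<bullet> x - \<phi> t \<omega> \<bullet> x\<bar>\<^sup>2) \<partial>lborel)) \<and>
        null_in_probability M
           (\<lambda>n \<omega>. SUP t\<in>{0..1}. ennreal (norm (step_integral W (L n) t \<omega> - X t \<omega>))))"

definition stochastically_integrable ::
    "'w measure \<Rightarrow> (real \<Rightarrow> 'w measure) \<Rightarrow> (real \<Rightarrow> 'w \<Rightarrow> real) \<Rightarrow>
     (real \<Rightarrow> 'w \<Rightarrow> 'e::real_inner) \<Rightarrow> bool" where
  "stochastically_integrable M F W \<phi> \<longleftrightarrow> (\<exists>X. has_stochastic_integral M F W \<phi> X)"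

text \<open>
  The integral process is determined up to indistinguishability; the choice operator picks an
  arbitrary representative. The value is meaningful only for stochastically integrable \<open>\<phi>\<close>.
\<close>

definition stochastic_integral ::
    "'w measure \<Rightarrow> (real \<Rightarrow> 'w measure) \<Rightarrow> (real \<Rightarrow> 'w \<Rightarrow> real) \<Rightarrow>
     (real \<Rightarrow> 'w \<Rightarrow> 'e::real_inner) \<Rightarrow> real \<Rightarrow> 'w \<Rightarrow> 'e" where
  "stochastic_integral M F W \<phi> = (SOME X. has_stochastic_integral M F W \<phi> X)"

end

theory Submission
  imports Defs "HOL-Real_Asymp.Real_Asymp"
begin

text \<open>
  Along the times \<open>grid j = 1 - 2\<^sup>-\<^sup>j\<^sup>-\<^sup>1\<close> consider the \<open>E\<close>-valued martingale \<open>walk\<close> with increments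
  \<open>noise j *\<^sub>R (damping j *\<^sub>R walk j + e (direction j))\<close>, where the \<open>noise j\<close> are independent standard
  Gaussians obtained by rescaling the increments of \<open>W\<close>. The factor \<open>1 + damping j * noise j\<close> is a
  discrete geometric Brownian motion: its moments of order \<open>p < 1\<close> are about
  \<open>1 - p (1 - p) (damping j)\<^sup>2 / 2\<close>, so with \<open>(damping j)\<^sup>2 = (j + 1)\<^sup>-\<^sup>1\<^sup>/\<^sup>2\<close> they pull every coordinate
  \<open>walk j \<bullet> x\<close> to zero. The vector \<open>e (direction j)\<close> is chosen, by means of the value of \<open>W\<close> at time
  \<open>grid j\<close>, from infinitely many fresh members of an orthonormal sequence, each with probability at
  most \<open>2\<^sup>-\<^sup>j\<close>; a fixed \<open>x\<close> hardly notices it. Hence the integrand is weakly in \<open>L\<^sup>p\<close> with weak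
  integral zero, although every time interval contributes at least one to its squared norm. Since
  the walk moves by a standard Gaussian in a fresh direction at every step, it is not the trace of
  a continuous \<open>E\<close>-valued process, so the integrand is not stochastically integrable.
  The weak integrals exist and are unique by the maximal inequality
  \<open>P (sup \<bar>\<integral>\<phi> dW\<bar> > \<epsilon>) \<le> \<delta> / \<epsilon>\<^sup>2 + P (\<integral>\<phi>\<^sup>2 dt > \<delta>)\<close> for step processes.
\<close>

section \<open>Strong measurability\<close>

text \<open>The bound p < 1 cannot be crossed: for p >= 1 each weak integral would be a uniformly
  integrable martingale, and a zero terminal value would force it to vanish throughout. So only
  moments of order below one may contract. A constant damping s would fail for p close to 1, since
  the mean of |1 + s Z| exceeds 1 for a standard Gaussian Z. Letting the damping tend to zero puts
  every p < 1 into the regime of the second-order expansion, and the rate is chosen so that the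
  product of the factors 1 - c (j + 1)^(-1/2) decays like exp(-2 c sqrt j), faster than any power of
  j, whatever c > 0 belongs to p. A deterministic fresh direction would contribute |x_j|^p at step
  j, which need not be summable for square summable coordinates. Spreading the choice over
  infinitely many vectors replaces this by a second moment of order 2^(-j), all of whose positive
  powers are summable. The only randomness at hand is the past of \<open>W\<close>, which is
  independent of the next noise; the interval up to time 1/2 is reserved for producing it.\<close>

lemma strongly_measurable_const: "strongly_measurable N (\<lambda>_. c)"
  unfolding strongly_measurable_def by (intro exI[of _ "\<lambda>_ _. c"]) simp

lemma strongly_measurable_compose:
  assumes "T \<in> measurable N N'" "strongly_measurable N' f"
  shows "strongly_measurable N (\<lambda>x. f (T x))"
proof -
  obtain s where s: "\<And>i::nat. simple_function N' (s i)" "\<And>x. x \<in> space N' \<Longrightarrow> (\<lambda>i. s i x) \<longlonglongrightarrow> f x"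
    using assms(2) unfolding strongly_measurable_def by blast
  show ?thesis
    unfolding strongly_measurable_def using assms(1)
    by (intro exI[of _ "\<lambda>i x. s i (T x)"]) (auto intro: simple_function_comp s measurable_space)
qed

lemma strongly_measurable_continuous_image:
  assumes "\<And>y. isCont g y" "strongly_measurable N f"
  shows "strongly_measurable N (\<lambda>x. g (f x))"
proof -
  obtain s where s: "\<And>i::nat. simple_function N (s i)" "\<And>x. x \<in> space N \<Longrightarrow> (\<lambda>i. s i x) \<longlonglongrightarrow> f x"
    using assms(2) unfolding strongly_measurable_def by blast
  show ?thesis
    unfolding strongly_measurable_def
    by (intro exI[of _ "\<lambda>i x. g (s i x)"])
      (auto intro: simple_function_compose1 s isCont_tendsto_compose[OF assms(1)])
qed

lemma strongly_measurable_Pair: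
  assumes "strongly_measurable N f" "strongly_measurable N g"
  shows "strongly_measurable N (\<lambda>x. (f x, g x))"
proof -
  obtain s where s: "\<And>i::nat. simple_function N (s i)" "\<And>x. x \<in> space N \<Longrightarrow> (\<lambda>i. s i x) \<longlonglongrightarrow> f x"
    using assms(1) unfolding strongly_measurable_def by blast
  obtain s' where s': "\<And>i::nat. simple_function N (s' i)" "\<And>x. x \<in> space N \<Longrightarrow> (\<lambda>i. s' i x) \<longlonglongrightarrow> g x"
    using assms(2) unfolding strongly_measurable_def by blast
  show ?thesis
    unfolding strongly_measurable_def
    by (intro exI[of _ "\<lambda>i x. (s i x, s' i x)"]) (auto intro: s s' tendsto_Pair)
qed

lemma strongly_measurable_add:
  fixes f g :: "'a \<Rightarrow> 'b::real_normed_vector"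
  assumes "strongly_measurable N f" "strongly_measurable N g"
  shows "strongly_measurable N (\<lambda>x. f x + g x)"
  using strongly_measurable_continuous_image[of "\<lambda>p. fst p + snd p", OF _ strongly_measurable_Pair[OF assms]]
  by (auto intro!: continuous_intros)

lemma strongly_measurable_diff:
  fixes f g :: "'a \<Rightarrow> 'b::real_normed_vector"
  assumes "strongly_measurable N f" "strongly_measurable N g"
  shows "strongly_measurable N (\<lambda>x. f x - g x)"
  using strongly_measurable_continuous_image[of "\<lambda>p. fst p - snd p", OF _ strongly_measurable_Pair[OF assms]]
  by (auto intro!: continuous_intros)

lemma strongly_measurable_real:
  fixes f :: "'a \<Rightarrow> real"
  shows "strongly_measurable N f \<longleftrightarrow> f \<in> borel_measurable N"
proof
  assume "strongly_measurable N f"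
  then obtain s where s: "\<And>i::nat. simple_function N (s i)" "\<And>x. x \<in> space N \<Longrightarrow> (\<lambda>i. s i x) \<longlonglongrightarrow> f x"
    unfolding strongly_measurable_def by blast
  show "f \<in> borel_measurable N"
    by (rule borel_measurable_LIMSEQ_metric[of s]) (auto intro: s borel_measurable_simple_function)
next
  assume "f \<in> borel_measurable N"
  from borel_measurable_implies_sequence_metric[OF this, of 0] show "strongly_measurable N f"
    unfolding strongly_measurable_def by blast
qed

lemma strongly_measurable_scaleR:
  fixes f :: "'a \<Rightarrow> 'b::real_normed_vector"
  assumes "a \<in> borel_measurable N" "strongly_measurable N f"
  shows "strongly_measurable N (\<lambda>x. a x *\<^sub>R f x)"
  using strongly_measurable_continuous_image[of "\<lambda>p. fst p *\<^sub>R snd p",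
      OF _ strongly_measurable_Pair[OF strongly_measurable_real[THEN iffD2, OF assms(1)] assms(2)]]
  by (auto intro!: continuous_intros)

lemma strongly_measurable_imp_norm:
  fixes f :: "'a \<Rightarrow> 'b::real_normed_vector"
  assumes "strongly_measurable N f"
  shows "(\<lambda>x. norm (f x)) \<in> borel_measurable N"
  using strongly_measurable_continuous_image[of norm, OF _ assms]
  by (auto intro!: continuous_intros simp: strongly_measurable_real)

lemma strongly_measurable_inner:
  fixes f :: "'a \<Rightarrow> 'b::real_inner"
  assumes "strongly_measurable N f"
  shows "(\<lambda>x. f x \<bullet> y) \<in> borel_measurable N"
  using strongly_measurable_continuous_image[of "\<lambda>z. z \<bullet> y", OF _ assms]
  by (auto intro!: continuous_intros simp: strongly_measurable_real)

text \<open>A countable sum of simple functions need not be simple, so the i-th approximation uses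
  only the pieces with index below i. A point of \<open>A j\<close> sees the approximations of its
  own piece from i = j + 1 on, and disjointness removes all others.\<close>

lemma strongly_measurable_piecewise:
  fixes f :: "'a \<Rightarrow> 'b::real_normed_vector" and A :: "nat \<Rightarrow> 'a set"
  assumes A: "\<And>j. A j \<in> sets N" "disjoint_family A" "space N \<subseteq> (\<Union>j. A j)"
    and f: "\<And>j. strongly_measurable N (g j)" "\<And>j x. x \<in> A j \<Longrightarrow> x \<in> space N \<Longrightarrow> f x = g j x"
  shows "strongly_measurable N f"
proof -
  have "\<exists>s. (\<forall>i::nat. simple_function N (s i)) \<and> (\<forall>x\<in>space N. (\<lambda>i. s i x) \<longlonglongrightarrow> g j x)" for j
    using f(1) unfolding strongly_measurable_def by blast
  then obtain s where s: "\<And>j i::nat. simple_function N (s j i)"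
      "\<And>j x. x \<in> space N \<Longrightarrow> (\<lambda>i. s j i x) \<longlonglongrightarrow> g j x"
    by metis
  define S where "S i x = (\<Sum>j<i. (indicator (A j) x :: real) *\<^sub>R s j i x)" for i x
  have "simple_function N (S i)" for i
    unfolding S_def by (intro simple_function_sum simple_function_scaleR simple_function_indicator A s)
  moreover have "(\<lambda>i. S i x) \<longlonglongrightarrow> f x" if x: "x \<in> space N" for x
  proof -
    obtain j where j: "x \<in> A j" using A(3) x by blast
    have "S i x = s j i x" if "i > j" for i
    proof -
      have "S i x = (\<Sum>k<i. if k = j then s j i x else 0)"
        unfolding S_def using A(2) j by (intro sum.cong) (auto simp: disjoint_family_on_def indicator_def)
      then show ?thesis using that by simp
    qed
    then have "\<forall>\<^sub>F i in sequentially. S i x = s j i x"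
      by (auto intro: eventually_mono[OF eventually_gt_at_top[of j]])
    then show ?thesis
      using s(2)[OF x, of j] f(2)[OF j x] by (simp add: tendsto_cong)
  qed
  ultimately show ?thesis unfolding strongly_measurable_def by blast
qed

text \<open>This covers the random basis vectors: a map with countably many values is strongly
  measurable whatever the size of the target.\<close>

lemma strongly_measurable_countable_valued:
  fixes e :: "nat \<Rightarrow> 'b::real_normed_vector"
  assumes "k \<in> measurable N (count_space UNIV)"
  shows "strongly_measurable N (\<lambda>x. e (k x))"
proof (rule strongly_measurable_piecewise[where A="\<lambda>j. k -` {j} \<inter> space N" and g="\<lambda>j _. e j"])
  show "k -` {j} \<inter> space N \<in> sets N" for j using assms by (rule measurable_sets) simp
qed (auto simp: disjoint_family_on_def strongly_measurable_const)

text \<open>Gram-Schmidt, one vector at a time: finitely many vectors never span the space, and a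
  vector outside their span keeps a nonzero remainder once its projection is subtracted.\<close>

lemma exists_orthonormal_sequence:
  assumes "\<nexists>B :: ('e :: real_inner) set. finite B \<and> span B = UNIV"
  shows "\<exists>e :: nat \<Rightarrow> 'e. \<forall>i j. e i \<bullet> e j = (if i = j then 1 else 0)"
proof -
  have "\<exists>e :: nat \<Rightarrow> 'e. \<forall>n. norm (e n) = 1 \<and> (\<forall>k<n. e n \<bullet> e k = 0)"
  proof (rule dependent_wellorder_choice)
    fix r :: 'e and f g :: "nat \<Rightarrow> 'e" and n
    assume "\<And>y. y < n \<Longrightarrow> f y = g y"
    then show "(norm r = 1 \<and> (\<forall>k<n. r \<bullet> f k = 0)) = (norm r = 1 \<and> (\<forall>k<n. r \<bullet> g k = 0))" by auto
  next
    fix n and f :: "nat \<Rightarrow> 'e"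
    assume IH: "\<And>y. y < n \<Longrightarrow> norm (f y) = 1 \<and> (\<forall>k<y. f y \<bullet> f k = 0)"
    have orth: "f i \<bullet> f j = (if i = j then 1 else 0)" if "i < n" "j < n" for i j
      using that IH[of i] IH[of j] by (cases i j rule: linorder_cases) (auto simp: inner_commute norm_eq_1)
    obtain v where v: "v \<notin> span (f ` {..<n})"
      using assms by (metis UNIV_eq_I finite_imageI finite_lessThan)
    define w where "w = v - (\<Sum>k<n. (v \<bullet> f k) *\<^sub>R f k)"
    have "(\<Sum>k<n. (v \<bullet> f k) *\<^sub>R f k) \<in> span (f ` {..<n})"
      by (intro span_sum span_scale span_base) auto
    then have "w \<noteq> 0" using v unfolding w_def by auto
    moreover have "w \<bullet> f k = 0" if "k < n" for k
    proof -
      have "(\<Sum>i<n. (v \<bullet> f i) *\<^sub>R f i) \<bullet> f k = (\<Sum>i<n. if i = k then v \<bullet> f k else 0)"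
        unfolding inner_sum_left using that by (intro sum.cong) (auto simp: orth)
      then show ?thesis using that by (simp add: w_def inner_diff_left)
    qed
    ultimately show "\<exists>r. norm r = 1 \<and> (\<forall>k<n. r \<bullet> f k = 0)"
      by (intro exI[of _ "w /\<^sub>R norm w"]) auto
  qed
  then obtain e :: "nat \<Rightarrow> 'e" where e: "\<And>n. norm (e n) = 1" "\<And>n k. k < n \<Longrightarrow> e n \<bullet> e k = 0" by blast
  have "e i \<bullet> e j = (if i = j then 1 else 0)" for i j
    using e(1)[of i] e(2)[of i j] e(2)[of j i]
    by (cases i j rule: linorder_cases) (auto simp: inner_commute norm_eq_1)
  then show ?thesis by blast
qed

section \<open>Fractional moments of a Gaussian multiplier\<close>

text \<open>The Taylor expansion of (1 + u)^p at 0 has the second-order coefficient -p(1-p)/2,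
  negative for 0 < p < 1. Near 0 a smaller constant \<open>k\<close> leaves room for the remainder;
  away from 0 the quartic term dominates everything else.\<close>

lemma abs_powr_le_quartic:
  fixes p :: real
  assumes p: "0 < p" "p < 1"
  shows "\<exists>k>0. \<exists>C\<ge>0. \<forall>u::real. \<bar>1 + u\<bar> powr p \<le> 1 + p * u - k * u\<^sup>2 + C * u ^ 4"
proof -
  \<comment> \<open>Half of the absolute Taylor coefficient: strictly smaller, so that the limit
    computed below gives a strict inequality near 0.\<close>
  define k where "k = p * (1 - p) / 4"
  have k: "k > 0" "k < - ((p - 1) * p / 2)" 
  proof -
    have pp: "p * (1 - p) > 0" using p by simp
    then show "k > 0" unfolding k_def by simp
    moreover have "- ((p - 1) * p / 2) = 2 * k" unfolding k_def by (simp add: field_simps)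
    ultimately show "k < - ((p - 1) * p / 2)" by simp
  qed
  have lim1: "((\<lambda>u. (1 + p * u - (1 + u) powr p) / u\<^sup>2) \<longlongrightarrow> - ((p - 1) * p / 2)) (at_right 0)"
    using p by real_asymp
  have lim2: "((\<lambda>u. (1 + p * u - (1 + u) powr p) / u\<^sup>2) \<longlongrightarrow> - ((p - 1) * p / 2)) (at_left 0)"
    using p by real_asymp
  have "((\<lambda>u. (1 + p * u - (1 + u) powr p) / u\<^sup>2) \<longlongrightarrow> - ((p - 1) * p / 2)) (at 0)"
    using lim2 lim1 by (rule filterlim_split_at)
  then have "\<forall>\<^sub>F u in at 0. (1 + p * u - (1 + u) powr p) / u\<^sup>2 > k"
    using k(2) by (rule order_tendstoD)
  then obtain d where d: "d > 0" "\<And>u. u \<noteq> 0 \<Longrightarrow> dist u 0 < d \<Longrightarrow> (1 + p * u - (1 + u) powr p) / u\<^sup>2 > k"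
    unfolding eventually_at by auto
  define r where "r = min d 1"
  have r: "r > 0" "r \<le> 1" "r \<le> d" using d unfolding r_def by auto
  \<comment> \<open>For |u| >= r put v = |u| / r >= 1. Then C u^4 = (2 + k) v^4, where two copies of
    v^4 pay for |u| and for p u, and k v^4 pays for k u^2; r <= 1 gives |u| <= v.\<close>
  define C where "C = (2 + k) / r ^ 4"
  have C: "C \<ge> 0" "C * r ^ 4 = 2 + k" using r k unfolding C_def by auto
  have "\<bar>1 + u\<bar> powr p \<le> 1 + p * u - k * u\<^sup>2 + C * u ^ 4" for u :: real
  proof (cases "\<bar>u\<bar> < r")
    case True
    have pos: "1 + u > 0" using True r by auto
    have "(1 + u) powr p \<le> 1 + p * u - k * u\<^sup>2"
    proof (cases "u = 0")
      case False
      have "(1 + p * u - (1 + u) powr p) / u\<^sup>2 > k" using False True r by (intro d) auto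
      then show ?thesis using False by (simp add: field_simps)
    qed simp
    moreover have "C * u ^ 4 \<ge> 0" using C by simp
    ultimately show ?thesis using pos by simp
  next
    case False
    define v where "v = \<bar>u\<bar> / r"
    have v: "v \<ge> 1" "\<bar>u\<bar> = v * r" using False r unfolding v_def by (auto simp: field_simps)
    have uv: "\<bar>u\<bar> \<le> v" using v r by (simp add: mult_left_le)
    have "\<bar>1 + u\<bar> powr p \<le> (1 + \<bar>u\<bar>) powr p" using p by (intro powr_mono2) auto
    also have "\<dots> \<le> (1 + \<bar>u\<bar>) powr 1" using p by (intro powr_mono) auto
    finally have 1: "\<bar>1 + u\<bar> powr p \<le> 1 + \<bar>u\<bar>" by simp
    have v2: "v \<le> v ^ 4" "v\<^sup>2 \<le> v ^ 4" using v power_increasing[of 1 4 v] power_increasing[of 2 4 v] by auto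
    have "\<bar>p * u\<bar> \<le> 1 * \<bar>u\<bar>" unfolding abs_mult using p by (intro mult_right_mono) auto
    then have 2: "p * u \<ge> - (v ^ 4)" using uv v2 by linarith
    have "u\<^sup>2 \<le> v\<^sup>2" using uv power_mono[OF uv, of 2] by simp
    then have 3: "k * u\<^sup>2 \<le> k * v ^ 4" using k v2 by (intro mult_left_mono) auto
    have "u ^ 4 = v ^ 4 * r ^ 4" unfolding power_mult_distrib[symmetric] v(2)[symmetric] by simp
    then have "C * u ^ 4 = v ^ 4 * (C * r ^ 4)" by simp
    then have "C * u ^ 4 = 2 * v ^ 4 + k * v ^ 4" unfolding C(2) by (simp add: algebra_simps)
    then show ?thesis using 1 2 3 uv v2 by linarith
  qed
  then show ?thesis using k C by blast
qed

lemma std_normal_moments: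
  "has_bochner_integral lborel (\<lambda>z. std_normal_density z * z ^ 0) 1"
  "has_bochner_integral lborel (\<lambda>z. std_normal_density z * z ^ 1) 0"
  "has_bochner_integral lborel (\<lambda>z. std_normal_density z * z ^ 2) 1"
  "has_bochner_integral lborel (\<lambda>z. std_normal_density z * z ^ 4) 3"
  using std_normal_moment_even[of 0] std_normal_moment_odd[of 0] std_normal_moment_even[of 1]
    std_normal_moment_even[of 2] by (simp_all add: fact_numeral)

text \<open>Integrating the quartic bound at u = s z kills the linear term by symmetry and leaves 1
  - k s^2 + 3 C s^4; for small s half of the quadratic gain absorbs the fourth-order loss.\<close>

lemma gaussian_abs_powr_contraction:
  fixes p :: real
  assumes p: "0 < p" "p < 1"
  shows "\<exists>\<kappa>>0. \<exists>s0>0. \<forall>s. 0 \<le> s \<longrightarrow> s \<le> s0 \<longrightarrow>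
     (\<integral>\<^sup>+z. ennreal (std_normal_density z) * ennreal (\<bar>1 + s * z\<bar> powr p) \<partial>lborel) \<le> ennreal (1 - \<kappa> * s\<^sup>2)"
proof -
  obtain k C where k: "k > 0" "C \<ge> 0"
    and le: "\<And>u::real. \<bar>1 + u\<bar> powr p \<le> 1 + p * u - k * u\<^sup>2 + C * u ^ 4"
    using abs_powr_le_quartic[OF p] by blast
  \<comment> \<open>Chosen so that 3 C s^2 <= k / 2 for s <= s0; the summand 1 keeps the denominator
    positive when C = 0.\<close>
  define s0 where "s0 = sqrt (k / (6 * (C + 1)))"
  have "s0 > 0" using k unfolding s0_def by auto
  moreover have "(\<integral>\<^sup>+z. ennreal (std_normal_density z) * ennreal (\<bar>1 + s * z\<bar> powr p) \<partial>lborel) \<le> ennreal (1 - k / 2 * s\<^sup>2)"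
    if s: "0 \<le> s" "s \<le> s0" for s
  proof -
    let ?q = "\<lambda>z. std_normal_density z * (1 + p * (s * z) - k * (s * z)\<^sup>2 + C * (s * z) ^ 4)"
    have "has_bochner_integral lborel
        (\<lambda>z. std_normal_density z * z ^ 0 + (p * s) * (std_normal_density z * z ^ 1)
           - (k * s\<^sup>2) * (std_normal_density z * z ^ 2) + (C * s ^ 4) * (std_normal_density z * z ^ 4))
        (1 + (p * s) * 0 - (k * s\<^sup>2) * 1 + (C * s ^ 4) * 3)"
      by (intro has_bochner_integral_add has_bochner_integral_diff has_bochner_integral_mult_right std_normal_moments)
    also have "(\<lambda>z. std_normal_density z * z ^ 0 + (p * s) * (std_normal_density z * z ^ 1)
           - (k * s\<^sup>2) * (std_normal_density z * z ^ 2) + (C * s ^ 4) * (std_normal_density z * z ^ 4)) = ?q"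
      by (simp add: fun_eq_iff algebra_simps power_mult_distrib)
    finally have q: "has_bochner_integral lborel ?q (1 - k * s\<^sup>2 + 3 * C * s ^ 4)" by (simp add: algebra_simps)
    \<comment> \<open>The polynomial dominates a nonnegative power, so its Bochner integral is also
      its nonnegative integral.\<close>
    have nonneg: "?q z \<ge> 0" for z
      using le[of "s * z"] by (intro mult_nonneg_nonneg) (auto intro: order_trans[OF powr_ge_zero])
    have "(\<integral>\<^sup>+z. ennreal (std_normal_density z) * ennreal (\<bar>1 + s * z\<bar> powr p) \<partial>lborel) \<le> (\<integral>\<^sup>+z. ennreal (?q z) \<partial>lborel)"
      by (intro nn_integral_mono) (auto simp: ennreal_mult'[symmetric] intro!: ennreal_leI mult_left_mono le)
    also have "\<dots> = ennreal (1 - k * s\<^sup>2 + 3 * C * s ^ 4)"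
      using q nonneg by (simp add: nn_integral_eq_integral has_bochner_integral_iff)
    also have "\<dots> \<le> ennreal (1 - k / 2 * s\<^sup>2)"
    proof (rule ennreal_leI)
      have "s\<^sup>2 \<le> s0\<^sup>2" using s by (intro power_mono) auto
      then have "3 * C * s\<^sup>2 \<le> 3 * C * (k / (6 * (C + 1)))" using k unfolding s0_def by (intro mult_left_mono) auto
      also have "\<dots> \<le> k / 2" using k by (simp add: field_simps)
      finally have "3 * C * s\<^sup>2 * s\<^sup>2 \<le> k / 2 * s\<^sup>2" by (intro mult_right_mono) auto
      then show "1 - k * s\<^sup>2 + 3 * C * s ^ 4 \<le> 1 - k / 2 * s\<^sup>2"
        by (simp add: power4_eq_xxxx power2_eq_square algebra_simps)
    qed
    finally show ?thesis .
  qed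
  ultimately show ?thesis using k by (intro exI[of _ "k / 2"] conjI exI[of _ s0]) auto
qed

section \<open>Brownian increments and sums adapted to a partition\<close>

lemma finite_chain_le:
  fixes s :: "nat \<Rightarrow> real"
  assumes "\<And>i. i < N \<Longrightarrow> s i < s (Suc i)" "i \<le> j" "j \<le> N"
  shows "s i \<le> s j"
  using assms(3,2)
proof (induction j)
  case (Suc j)
  then show ?case using assms(1)[of j] by (cases "i = Suc j") auto
qed simp

locale brownian = prob_space M
  for M :: "'w measure" and F :: "real \<Rightarrow> 'w measure" and W :: "real \<Rightarrow> 'w \<Rightarrow> real" +
  assumes filtration: "complete_filtration M F"
    and brownian: "brownian_motion M F W"
begin

lemma subalgebra_F: "0 \<le> t \<Longrightarrow> subalgebra M (F t)"
  using filtration unfolding complete_filtration_def by blast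

lemma space_F: "0 \<le> t \<Longrightarrow> space (F t) = space M"
  using subalgebra_F unfolding subalgebra_def by blast

lemma F_mono: "0 \<le> s \<Longrightarrow> s \<le> t \<Longrightarrow> sets (F s) \<subseteq> sets (F t)"
  using filtration unfolding complete_filtration_def by blast

lemma measurable_F_mono:
  assumes "0 \<le> s" "s \<le> t" "f \<in> measurable (F s) N"
  shows "f \<in> measurable (F t) N"
proof (rule measurable_from_subalg[OF _ assms(3)])
  show "subalgebra (F t) (F s)"
    using F_mono[OF assms(1,2)] assms(1,2) by (simp add: subalgebra_def space_F)
qed

lemma measurable_F_imp:
  assumes "0 \<le> s" "f \<in> measurable (F s) N"
  shows "f \<in> measurable M N"
  by (rule measurable_from_subalg[OF subalgebra_F[OF assms(1)] assms(2)])

text \<open>Passing to a larger sigma-algebra is composition with the identity, which is how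
  \<open>strongly_measurable_compose\<close> transports strong measurability along the
  filtration.\<close>

lemma id_measurable_F_mono: "0 \<le> s \<Longrightarrow> s \<le> t \<Longrightarrow> (\<lambda>\<omega>. \<omega>) \<in> measurable (F t) (F s)"
  by (rule measurable_F_mono[OF _ _ measurable_ident_sets[OF refl]])

lemma id_measurable_F: "0 \<le> s \<Longrightarrow> (\<lambda>\<omega>. \<omega>) \<in> measurable M (F s)"
  by (rule measurable_F_imp[OF _ measurable_ident_sets[OF refl]])

lemma W_adapted: "0 \<le> s \<Longrightarrow> s \<le> t \<Longrightarrow> W s \<in> borel_measurable (F t)"
  using brownian measurable_F_mono[of s t "W s" borel] unfolding brownian_motion_def by auto

lemma W_measurable: "0 \<le> s \<Longrightarrow> W s \<in> borel_measurable M"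
  using W_adapted[of s s] measurable_F_imp by auto

lemma W_continuous: "\<omega> \<in> space M \<Longrightarrow> continuous_on {0..} (\<lambda>t. W t \<omega>)"
  using brownian unfolding brownian_motion_def by blast

lemma increment_distributed:
  "0 \<le> s \<Longrightarrow> s < t \<Longrightarrow> distributed M lborel (\<lambda>\<omega>. W t \<omega> - W s \<omega>) (normal_density 0 (sqrt (t - s)))"
  using brownian unfolding brownian_motion_def by blast

text \<open>The preimages of Borel sets under the increment already form a sigma-algebra, and the
  one generated by \<open>f\<close> lies inside \<open>F s\<close>; so the independence built into a
  Brownian motion gives the one that \<open>indep_var\<close> asks for.\<close>

lemma indep_increment:
  assumes st: "0 \<le> s" "s < t" and f: "f \<in> borel_measurable (F s)"
  shows "indep_var borel f borel (\<lambda>\<omega>. W t \<omega> - W s \<omega>)"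
proof -
  let ?D = "\<lambda>\<omega>. W t \<omega> - W s \<omega>"
  have D[measurable]: "?D \<in> borel_measurable M" using st by (intro borel_measurable_diff W_measurable) auto
  have f': "f \<in> borel_measurable M" using measurable_F_imp[OF st(1) f] .
  have ind: "indep_set (sets (F s)) {?D -` A \<inter> space M | A. A \<in> sets borel}"
    using brownian st unfolding brownian_motion_def by blast
  have sf: "sigma_sets (space M) {f -` A \<inter> space M |A. A \<in> sets borel} \<subseteq> sets (F s)"
    unfolding space_F[OF st(1), symmetric] using measurable_sets[OF f] by (intro sets.sigma_sets_subset) auto
  have borel_eq: "sigma_sets (space borel) (sets borel) = sets (borel :: real measure)"
    by (rule sets.sigma_sets_eq)
  have "?D \<in> space M \<rightarrow> space borel" by auto
  from sigma_sets_vimage_commute[OF this, of "sets borel", unfolded borel_eq]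
  have sD: "sigma_sets (space M) {?D -` A \<inter> space M | A. A \<in> sets borel} = {?D -` A \<inter> space M | A. A \<in> sets borel}"
    by (rule sym)
  have "indep_set (sigma_sets (space M) {f -` A \<inter> space M |A. A \<in> sets borel}) {?D -` A \<inter> space M | A. A \<in> sets borel}"
    unfolding indep_set_def
    by (rule indep_sets_mono_sets[OF ind[unfolded indep_set_def]]) (use sf in \<open>auto split: bool.split\<close>)
  then show ?thesis
    unfolding indep_var_eq sD using f' D by (intro conjI)
qed

lemma increment_moments:
  assumes st: "0 \<le> s" "s < t"
  shows "integrable M (\<lambda>\<omega>. W t \<omega> - W s \<omega>)" "expectation (\<lambda>\<omega>. W t \<omega> - W s \<omega>) = 0"
    and "integrable M (\<lambda>\<omega>. (W t \<omega> - W s \<omega>)\<^sup>2)" "expectation (\<lambda>\<omega>. (W t \<omega> - W s \<omega>)\<^sup>2) = t - s"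
proof -
  note D = increment_distributed[OF st]
  have pos: "0 < sqrt (t - s)" using st by simp
  show "integrable M (\<lambda>\<omega>. W t \<omega> - W s \<omega>)"
    using integrable_normal_moment_nz_1[OF pos, of 0] by (subst distributed_integrable[OF D, symmetric]) auto
  show E: "expectation (\<lambda>\<omega>. W t \<omega> - W s \<omega>) = 0"
    by (rule normal_distributed_expectation[OF pos D])
  show "integrable M (\<lambda>\<omega>. (W t \<omega> - W s \<omega>)\<^sup>2)"
    using integrable_normal_moment[OF pos, of 0 2]
    by (subst distributed_integrable[OF D, of "\<lambda>x. x\<^sup>2", symmetric]) auto
  show "expectation (\<lambda>\<omega>. (W t \<omega> - W s \<omega>)\<^sup>2) = t - s"
    using normal_distributed_variance[OF pos D] st unfolding E by simp
qed

section \<open>Ito sums along a partition: isometry and maximal inequality\<close>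

abbreviation ito_sum :: "(nat \<Rightarrow> 'w \<Rightarrow> real) \<Rightarrow> (nat \<Rightarrow> real) \<Rightarrow> nat \<Rightarrow> 'w \<Rightarrow> real" where
  "ito_sum \<eta> s n \<omega> \<equiv> \<Sum>i<n. \<eta> i \<omega> * (W (s (Suc i)) \<omega> - W (s i) \<omega>)"

abbreviation quadratic_sum :: "(nat \<Rightarrow> 'w \<Rightarrow> real) \<Rightarrow> (nat \<Rightarrow> real) \<Rightarrow> nat \<Rightarrow> 'w \<Rightarrow> real" where
  "quadratic_sum \<eta> s n \<omega> \<equiv> \<Sum>i<n. (\<eta> i \<omega>)\<^sup>2 * (s (Suc i) - s i)"

text \<open>Discrete Ito isometry by induction on \<open>n\<close>. The cross term is the past sum
  times the coefficient, multiplied by the increment: a product of independent factors, the second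
  of mean zero. Boundedness of the coefficients makes the first factor integrable.\<close>

lemma isometry:
  fixes \<eta> :: "nat \<Rightarrow> 'w \<Rightarrow> real" and s :: "nat \<Rightarrow> real"
  assumes s: "0 \<le> s 0" "\<And>i. i < N \<Longrightarrow> s i < s (Suc i)"
    and \<eta>: "\<And>i. i < N \<Longrightarrow> \<eta> i \<in> borel_measurable (F (s i))"
    and bdd: "\<And>i \<omega>. i < N \<Longrightarrow> \<omega> \<in> space M \<Longrightarrow> \<bar>\<eta> i \<omega>\<bar> \<le> B i"
  shows "n \<le> N \<Longrightarrow> 0 \<le> s n"
    and "n \<le> N \<Longrightarrow> (\<lambda>\<omega>. ito_sum \<eta> s n \<omega>) \<in> borel_measurable (F (s n))"
    and "n \<le> N \<Longrightarrow> integrable M (\<lambda>\<omega>. (ito_sum \<eta> s n \<omega>)\<^sup>2)"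
    and "n \<le> N \<Longrightarrow> integrable M (\<lambda>\<omega>. quadratic_sum \<eta> s n \<omega>)"
    and "n \<le> N \<Longrightarrow> expectation (\<lambda>\<omega>. (ito_sum \<eta> s n \<omega>)\<^sup>2) =
           expectation (\<lambda>\<omega>. quadratic_sum \<eta> s n \<omega>)"
proof -
  show pos: "0 \<le> s n" if "n \<le> N" for n
    using finite_chain_le[where s=s and N=N and i=0 and j=n, OF s(2)] s(1) that by simp
  let ?S = "\<lambda>n \<omega>. ito_sum \<eta> s n \<omega>"
  let ?Q = "\<lambda>n \<omega>. quadratic_sum \<eta> s n \<omega>"
  show S_meas: "?S n \<in> borel_measurable (F (s n))" if "n \<le> N" for n
    using that
  proof (induction n)
    case (Suc n)
    then have n: "n < N" by simp
    have sn: "0 \<le> s n" "s n < s (Suc n)" using n pos[of n] s(2) by auto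
    have [measurable]: "?S n \<in> borel_measurable (F (s (Suc n)))"
      by (rule measurable_F_mono[OF sn(1) less_imp_le[OF sn(2)]]) (use Suc n in simp)
    have [measurable]: "\<eta> n \<in> borel_measurable (F (s (Suc n)))"
      by (rule measurable_F_mono[OF sn(1) less_imp_le[OF sn(2)] \<eta>[OF n]])
    have [measurable]: "W (s n) \<in> borel_measurable (F (s (Suc n)))" "W (s (Suc n)) \<in> borel_measurable (F (s (Suc n)))"
      using sn by (simp_all add: W_adapted)
    show ?case unfolding sum.lessThan_Suc by measurable
  qed simp
  have "integrable M (\<lambda>\<omega>. (?S n \<omega>)\<^sup>2) \<and> integrable M (?Q n) \<and> expectation (\<lambda>\<omega>. (?S n \<omega>)\<^sup>2) = expectation (?Q n)"
    if "n \<le> N" for n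
    using that
  proof (induction n)
    case (Suc n)
    then have n: "n < N" by simp
    let ?D = "\<lambda>\<omega>. W (s (Suc n)) \<omega> - W (s n) \<omega>"
    have sn: "0 \<le> s n" "s n < s (Suc n)" using n pos[of n] s(2) by auto
    note mom = increment_moments[OF sn]
    have IH: "integrable M (\<lambda>\<omega>. (?S n \<omega>)\<^sup>2)" "integrable M (?Q n)" "expectation (\<lambda>\<omega>. (?S n \<omega>)\<^sup>2) = expectation (?Q n)"
      using Suc n by auto
    have SF: "?S n \<in> borel_measurable (F (s n))" using n by (intro S_meas) auto
    have S: "?S n \<in> borel_measurable M" using measurable_F_imp[OF sn(1) SF] .
    have eM: "\<eta> n \<in> borel_measurable M" using measurable_F_imp[OF sn(1) \<eta>[OF n]] .
    have intS: "integrable M (?S n)" using S IH(1) by (rule square_integrable_imp_integrable)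
    have intSe: "integrable M (\<lambda>\<omega>. ?S n \<omega> * \<eta> n \<omega>)"
    proof (rule Bochner_Integration.integrable_bound[OF integrable_mult_left[OF integrable_abs[OF intS], of "B n"]])
      show "(\<lambda>\<omega>. ?S n \<omega> * \<eta> n \<omega>) \<in> borel_measurable M" by (rule borel_measurable_times[OF S eM])
      show "AE \<omega> in M. norm (?S n \<omega> * \<eta> n \<omega>) \<le> norm (\<bar>?S n \<omega>\<bar> * B n)"
        unfolding real_norm_def abs_mult abs_abs
        by (intro AE_I2 mult_left_mono order_trans[OF bdd[OF n] abs_ge_self]) auto
    qed
    have inte2: "integrable M (\<lambda>\<omega>. (\<eta> n \<omega>)\<^sup>2)"
    proof (rule Bochner_Integration.integrable_bound[OF integrable_const[of "(B n)\<^sup>2"]])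
      show "(\<lambda>\<omega>. (\<eta> n \<omega>)\<^sup>2) \<in> borel_measurable M" using eM by (rule borel_measurable_power)
      show "AE \<omega> in M. norm ((\<eta> n \<omega>)\<^sup>2) \<le> norm ((B n)\<^sup>2)"
        using bdd[OF n] by (intro AE_I2) (simp add: abs_le_square_iff[symmetric] order_trans[OF _ abs_ge_self])
    qed
    have ind1: "indep_var borel (\<lambda>\<omega>. ?S n \<omega> * \<eta> n \<omega>) borel ?D"
      by (rule indep_increment[OF sn borel_measurable_times[OF SF \<eta>[OF n]]])
    have "indep_var borel ((\<lambda>x. x) \<circ> (\<lambda>\<omega>. (\<eta> n \<omega>)\<^sup>2)) borel ((\<lambda>x. x\<^sup>2) \<circ> ?D)"
      by (rule indep_var_compose[OF indep_increment[OF sn borel_measurable_power[OF \<eta>[OF n]]]]) measurable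
    then have ind2: "indep_var borel (\<lambda>\<omega>. (\<eta> n \<omega>)\<^sup>2) borel (\<lambda>\<omega>. (?D \<omega>)\<^sup>2)" by (simp add: comp_def)
    note i1 = indep_var_integrable[OF ind1 intSe mom(1)]
    note e1 = indep_var_lebesgue_integral[OF ind1 intSe mom(1)]
    note i2 = indep_var_integrable[OF ind2 inte2 mom(3)]
    note e2 = indep_var_lebesgue_integral[OF ind2 inte2 mom(3)]
    have eq: "(?S (Suc n) \<omega>)\<^sup>2 = (?S n \<omega>)\<^sup>2 + 2 * (?S n \<omega> * \<eta> n \<omega> * ?D \<omega>) + (\<eta> n \<omega>)\<^sup>2 * (?D \<omega>)\<^sup>2" for \<omega>
      unfolding sum.lessThan_Suc by (simp add: power2_eq_square algebra_simps)
    show ?case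
      unfolding eq unfolding sum.lessThan_Suc using IH i1 i2 inte2 mom(2,4) by (simp add: e1 e2)
  qed simp
  then show "n \<le> N \<Longrightarrow> integrable M (\<lambda>\<omega>. (?S n \<omega>)\<^sup>2)" "n \<le> N \<Longrightarrow> integrable M (?Q n)"
    "n \<le> N \<Longrightarrow> expectation (\<lambda>\<omega>. (?S n \<omega>)\<^sup>2) = expectation (?Q n)" by blast+
qed

text \<open>
  The coefficients are switched off as soon as the accumulated quadratic variation would exceed
  \<open>\<delta>\<close> or the partial sums have left \<open>[-\<epsilon>, \<epsilon>]\<close>; the truncated sum has second moment at most \<open>\<delta>\<close>,
  and it still remembers that the original one left the interval.
\<close>

lemma discrete_maximal_inequality:
  fixes \<eta> :: "nat \<Rightarrow> 'w \<Rightarrow> real" and s :: "nat \<Rightarrow> real"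
  assumes s: "0 \<le> s 0" "\<And>i. i < N \<Longrightarrow> s i < s (Suc i)"
    and \<eta>: "\<And>i. i < N \<Longrightarrow> \<eta> i \<in> borel_measurable (F (s i))"
    and \<epsilon>: "0 < \<epsilon>" and \<delta>: "0 \<le> \<delta>"
  defines "S \<equiv> \<lambda>n \<omega>. ito_sum \<eta> s n \<omega>"
    and "Q \<equiv> \<lambda>n \<omega>. quadratic_sum \<eta> s n \<omega>"
  shows "prob {\<omega>\<in>space M. \<exists>n\<le>N. \<epsilon> < \<bar>S n \<omega>\<bar>} \<le> \<delta> / \<epsilon>\<^sup>2 + prob {\<omega>\<in>space M. \<delta> < Q N \<omega>}"
proof -
  have pos: "0 \<le> s n" if "n \<le> N" for n
    using finite_chain_le[where s=s and N=N and i=0 and j=n, OF s(2)] s(1) that by simp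
  have smono: "s i \<le> s j" if "i \<le> j" "j \<le> N" for i j
    by (rule finite_chain_le[where s=s and N=N, OF s(2) that])
  have \<eta>': "\<eta> i \<in> borel_measurable (F (s n))" if "i < N" "i \<le> n" "n \<le> N" for i n
    using measurable_F_mono[OF pos smono \<eta>, of i n] that by auto
  have S_meas: "S n \<in> borel_measurable (F (s k))" if "n \<le> k" "k \<le> N" for n k
    unfolding S_def using that pos[of k] pos smono
    by (intro borel_measurable_sum borel_measurable_times borel_measurable_diff W_adapted \<eta>') auto
  \<comment> \<open>\<open>Q (Suc k)\<close> contains the coefficient with index \<open>k\<close>
    but no increment of \<open>W\<close>, so it is known one step ahead; this allows switching off
    before the level is exceeded.\<close>
  have Q_meas: "Q (Suc k) \<in> borel_measurable (F (s k))" if "k < N" for k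
    unfolding Q_def using that
    by (intro borel_measurable_sum borel_measurable_times borel_measurable_power \<eta>') auto
  define P where "P i \<omega> \<longleftrightarrow> Q (Suc i) \<omega> \<le> \<delta> \<and> (\<forall>k\<le>i. \<bar>S k \<omega>\<bar> \<le> \<epsilon>)" for i \<omega>
  define \<zeta> where "\<zeta> i \<omega> = (if P i \<omega> then \<eta> i \<omega> else 0)" for i \<omega>
  define D where "D i = s (Suc i) - s i" for i
  have Dpos: "i < N \<Longrightarrow> 0 < D i" for i unfolding D_def using s(2) by simp
  have \<zeta>_meas: "\<zeta> i \<in> borel_measurable (F (s i))" if i: "i < N" for i
  proof -
    have [measurable]: "Q (Suc i) \<in> borel_measurable (F (s i))" "\<eta> i \<in> borel_measurable (F (s i))"
      using Q_meas \<eta> i by auto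
    have Sk: "k \<le> i \<Longrightarrow> S k \<in> borel_measurable (F (s i))" for k using S_meas i by simp
    have "Measurable.pred (F (s i)) (P i)"
      unfolding P_def using Sk by (intro pred_intros_logic pred_intros_finite) auto
    then show ?thesis unfolding \<zeta>_def by measurable
  qed
  have Qmono: "Q i \<omega> \<le> Q j \<omega>" if "i \<le> j" "j \<le> N" for i j \<omega>
    unfolding Q_def using that Dpos unfolding D_def
    by (intro sum_mono2) (auto intro!: mult_nonneg_nonneg simp: less_imp_le)
  have \<zeta>Q: "(\<Sum>i<n. (\<zeta> i \<omega>)\<^sup>2 * D i) \<le> \<delta>" if "n \<le> N" for n \<omega>
    using that
  proof (induction n)
    case (Suc n)
    show ?case
    proof (cases "P n \<omega>")
      case True
      have "(\<Sum>i<Suc n. (\<zeta> i \<omega>)\<^sup>2 * D i) \<le> Q (Suc n) \<omega>"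
        unfolding Q_def \<zeta>_def D_def[symmetric] using Dpos Suc.prems
        by (intro sum_mono mult_right_mono) (auto simp: less_imp_le)
      then show ?thesis using True unfolding P_def by linarith
    next
      case False
      then show ?thesis using Suc by (simp add: \<zeta>_def)
    qed
  qed (simp add: \<delta>)
  \<comment> \<open>The cap on the whole sum caps each summand, which supplies the bounded
    coefficients required by \<open>isometry\<close>.\<close>
  have \<zeta>_bdd: "\<bar>\<zeta> i \<omega>\<bar> \<le> sqrt (\<delta> / D i)" if "i < N" for i \<omega>
  proof -
    have "(\<zeta> i \<omega>)\<^sup>2 * D i \<le> (\<Sum>i<Suc i. (\<zeta> i \<omega>)\<^sup>2 * D i)"
      using Dpos that by (intro member_le_sum) (auto simp: less_imp_le)
    also have "\<dots> \<le> \<delta>" using that by (intro \<zeta>Q) auto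
    finally have "(\<zeta> i \<omega>)\<^sup>2 \<le> \<delta> / D i" using Dpos[OF that] by (simp add: field_simps)
    then show ?thesis by (metis real_sqrt_abs real_sqrt_le_iff)
  qed
  define Z where "Z \<omega> = (ito_sum \<zeta> s N \<omega>)" for \<omega>
  have Z: "Z \<in> borel_measurable M" "integrable M (\<lambda>\<omega>. (Z \<omega>)\<^sup>2)"
     "expectation (\<lambda>\<omega>. (Z \<omega>)\<^sup>2) = expectation (\<lambda>\<omega>. \<Sum>i<N. (\<zeta> i \<omega>)\<^sup>2 * D i)"
     "integrable M (\<lambda>\<omega>. \<Sum>i<N. (\<zeta> i \<omega>)\<^sup>2 * D i)"
    using measurable_F_imp[OF pos[OF order_refl] isometry(2)[OF s \<zeta>_meas \<zeta>_bdd order_refl]]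
      isometry(3-5)[OF s \<zeta>_meas \<zeta>_bdd order_refl]
    unfolding Z_def[abs_def] D_def by blast+
  have "expectation (\<lambda>\<omega>. (Z \<omega>)\<^sup>2) \<le> expectation (\<lambda>_. \<delta>)"
    unfolding Z(3) using Z(4) \<zeta>Q by (intro integral_mono) auto
  then have EZ: "expectation (\<lambda>\<omega>. (Z \<omega>)\<^sup>2) \<le> \<delta>" by (simp add: prob_space)
  have sub: "{\<omega>\<in>space M. \<exists>n\<le>N. \<epsilon> < \<bar>S n \<omega>\<bar>} \<subseteq> {\<omega>\<in>space M. \<epsilon> \<le> \<bar>Z \<omega>\<bar>} \<union> {\<omega>\<in>space M. \<delta> < Q N \<omega>}"
  proof (clarsimp simp: not_less)
    fix \<omega> n assume \<omega>: "\<omega> \<in> space M" and n: "n \<le> N" "\<epsilon> < \<bar>S n \<omega>\<bar>" and Q: "Q N \<omega> \<le> \<delta>"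
    \<comment> \<open>If the full quadratic sum stays within the level, the coefficients are
      switched off exactly from the first exit index \<open>m\<close> on; the truncated sum is
      frozen at \<open>S m\<close>, which lies outside the interval.\<close>
    define m where "m = (LEAST n. \<epsilon> < \<bar>S n \<omega>\<bar>)"
    have m: "\<epsilon> < \<bar>S m \<omega>\<bar>" unfolding m_def by (rule LeastI[of _ n]) (rule n(2))
    have "m \<le> n" unfolding m_def by (rule Least_le) (rule n(2))
    then have mN: "m \<le> N" using n(1) by simp
    have small: "\<bar>S k \<omega>\<bar> \<le> \<epsilon>" if "k < m" for k
      using not_less_Least[OF that[unfolded m_def]] by simp
    have "P i \<omega> \<longleftrightarrow> i < m" if i: "i < N" for i
    proof
      assume "P i \<omega>"
      then have "\<forall>k\<le>i. \<bar>S k \<omega>\<bar> \<le> \<epsilon>" unfolding P_def by blast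
      then show "i < m" using m by (meson not_le)
    next
      assume "i < m"
      moreover have "Q (Suc i) \<omega> \<le> \<delta>" using Qmono[of "Suc i" N \<omega>] i Q by simp
      ultimately show "P i \<omega>" using small unfolding P_def by simp
    qed
    then have "Z \<omega> = (\<Sum>i<N. if i < m then \<eta> i \<omega> * (W (s (Suc i)) \<omega> - W (s i) \<omega>) else 0)"
      unfolding Z_def \<zeta>_def by (intro sum.cong) auto
    also have "\<dots> = S m \<omega>"
      unfolding S_def using mN by (intro sum.mono_neutral_cong_right) auto
    finally show "\<epsilon> \<le> \<bar>Z \<omega>\<bar>" using m by simp
  qed
  have QM: "{\<omega>\<in>space M. \<delta> < Q N \<omega>} \<in> events"
  proof -
    have "Q N \<in> borel_measurable M"
      unfolding Q_def using measurable_F_imp[OF pos \<eta>] by (intro borel_measurable_sum) auto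
    then show ?thesis by measurable
  qed
  have "prob {\<omega>\<in>space M. \<exists>n\<le>N. \<epsilon> < \<bar>S n \<omega>\<bar>} \<le>
      prob ({\<omega>\<in>space M. \<epsilon> \<le> \<bar>Z \<omega>\<bar>} \<union> {\<omega>\<in>space M. \<delta> < Q N \<omega>})"
    using Z(1) QM by (intro finite_measure_mono sub sets.Un) auto
  also have "\<dots> \<le> prob {\<omega>\<in>space M. \<epsilon> \<le> \<bar>Z \<omega>\<bar>} + prob {\<omega>\<in>space M. \<delta> < Q N \<omega>}"
    using Z(1) QM by (intro measure_Un_le) auto
  also have "prob {\<omega>\<in>space M. \<epsilon> \<le> \<bar>Z \<omega>\<bar>} \<le> \<delta> / \<epsilon>\<^sup>2"
    using second_moment_method[OF Z(1,2) \<epsilon>] divide_right_mono[OF EZ, of "\<epsilon>\<^sup>2"] by simp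
  finally show ?thesis by simp
qed

end

section \<open>Adapted step processes\<close>

definition energy :: "(real \<Rightarrow> 'w \<Rightarrow> real) \<Rightarrow> 'w \<Rightarrow> ennreal" where
  "energy f \<omega> = (\<integral>\<^sup>+t\<in>{0..1}. ennreal (\<bar>f t \<omega>\<bar>\<^sup>2) \<partial>lborel)"

text \<open>Lebesgue measure on the unit interval is sigma-finite, so integrating out
  \<open>t\<close> preserves joint measurability; the product is swapped because the integrated
  variable has to come second.\<close>

lemma energy_measurable:
  assumes "strongly_measurable_process M f"
  shows "energy f \<in> borel_measurable M"
proof -
  let ?R = "restrict_space lborel {0..1::real}"
  interpret R: sigma_finite_measure ?R
    by (rule sigma_finite_measure_restrict_space) (auto intro: lborel.sigma_finite_measure_axioms)
  have sets_R: "sets ?R = sets (restrict_space borel {0..1})" by (intro sets_restrict_space_cong) simp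
  have "(\<lambda>(t, \<omega>). f t \<omega>) \<in> borel_measurable (restrict_space borel {0..1} \<Otimes>\<^sub>M M)"
    using assms unfolding strongly_measurable_process_def strongly_measurable_real .
  also have "borel_measurable (restrict_space borel {0..1::real} \<Otimes>\<^sub>M M) = borel_measurable (?R \<Otimes>\<^sub>M M)"
    by (intro measurable_cong_sets sets_pair_measure_cong sets_R[symmetric] refl)
  finally have [measurable]: "(\<lambda>(t, \<omega>). f t \<omega>) \<in> borel_measurable (?R \<Otimes>\<^sub>M M)" .
  have "(\<lambda>(\<omega>, t). (\<lambda>(t, \<omega>). f t \<omega>) (t, \<omega>)) \<in> borel_measurable (M \<Otimes>\<^sub>M ?R)" by measurable
  then have "(\<lambda>(\<omega>, t). ennreal (\<bar>f t \<omega>\<bar>\<^sup>2)) \<in> borel_measurable (M \<Otimes>\<^sub>M ?R)" by (simp add: split_def)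
  then have "(\<lambda>\<omega>. \<integral>\<^sup>+t. ennreal (\<bar>f t \<omega>\<bar>\<^sup>2) \<partial>?R) \<in> borel_measurable M"
    by (rule R.borel_measurable_nn_integral)
  then show ?thesis
    unfolding energy_def[abs_def] by (subst (asm) nn_integral_restrict_space) auto
qed

section \<open>Linear operations on lists representing step processes\<close>

lemma step_process_Nil: "step_process [] t \<omega> = 0"
  and step_process_Cons: "step_process ((a, b, \<xi>) # L) t \<omega> = indicat_real {a<..b} t *\<^sub>R \<xi> \<omega> + step_process L t \<omega>"
  and step_process_append: "step_process (L @ L') t \<omega> = step_process L t \<omega> + step_process L' t \<omega>"
  by (simp_all add: step_process_def)

lemma step_integral_Nil: "step_integral W [] t \<omega> = 0"
  and step_integral_Cons: "step_integral W ((a, b, \<xi>) # L) t \<omega> =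
     (W (min b t) \<omega> - W (min a t) \<omega>) *\<^sub>R \<xi> \<omega> + step_integral W L t \<omega>"
  and step_integral_append: "step_integral W (L @ L') t \<omega> = step_integral W L t \<omega> + step_integral W L' t \<omega>"
  by (simp_all add: step_integral_def)

lemma adapted_step_Nil: "adapted_step F []"
  and adapted_step_Cons: "adapted_step F ((a, b, \<xi>) # L) \<longleftrightarrow>
     0 \<le> a \<and> a < b \<and> b \<le> 1 \<and> strongly_measurable (F a) \<xi> \<and> adapted_step F L"
  and adapted_step_append: "adapted_step F (L @ L') \<longleftrightarrow> adapted_step F L \<and> adapted_step F L'"
  by (simp_all add: adapted_step_def ball_Un)

text \<open>Together with \<open>@\<close> this represents the difference of two step processes, to
  which the maximal inequality is applied in the uniqueness proof.\<close>

definition neg_step :: "('w, 'e::real_normed_vector) step \<Rightarrow> ('w, 'e) step" where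
  "neg_step L = map (\<lambda>(a, b, \<xi>). (a, b, \<lambda>\<omega>. - \<xi> \<omega>)) L"

lemma step_process_neg: "step_process (neg_step L) t \<omega> = - step_process L t \<omega>"
  by (induction L) (auto simp: neg_step_def step_process_Nil step_process_Cons)

lemma step_integral_neg: "step_integral W (neg_step L) t \<omega> = - step_integral W L t \<omega>"
  by (induction L) (auto simp: neg_step_def step_integral_Nil step_integral_Cons)

lemma adapted_step_neg:
  fixes L :: "('w, 'e::real_normed_vector) step"
  shows "adapted_step F L \<Longrightarrow> adapted_step F (neg_step L)"
proof (induction L)
  case (Cons l L)
  obtain a b \<xi> where l: "l = (a, b, \<xi>)" by (cases l)
  show ?case
    using Cons strongly_measurable_continuous_image[of "uminus :: 'e \<Rightarrow> 'e" "F a" \<xi>]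
    by (auto simp: l neg_step_def adapted_step_Cons)
qed (simp add: neg_step_def adapted_step_Nil)

definition inner_step :: "'e::real_inner \<Rightarrow> ('w, 'e) step \<Rightarrow> ('w, real) step" where
  "inner_step x L = map (\<lambda>(a, b, \<xi>). (a, b, \<lambda>\<omega>. \<xi> \<omega> \<bullet> x)) L"

lemma step_process_inner_step: "step_process (inner_step x L) t \<omega> = step_process L t \<omega> \<bullet> x"
  by (induction L) (auto simp: inner_step_def step_process_Nil step_process_Cons inner_add_left)

lemma step_integral_inner_step: "step_integral W (inner_step x L) t \<omega> = step_integral W L t \<omega> \<bullet> x"
  by (induction L) (auto simp: inner_step_def step_integral_Nil step_integral_Cons inner_add_left)

lemma adapted_step_inner_step: "adapted_step F L \<Longrightarrow> adapted_step F (inner_step x L)"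
proof (induction L)
  case (Cons l L)
  obtain a b \<xi> where l: "l = (a, b, \<xi>)" by (cases l)
  show ?case
    using Cons strongly_measurable_inner[of "F a" \<xi> x]
    by (auto simp: l inner_step_def adapted_step_Cons strongly_measurable_real)
qed (simp add: inner_step_def adapted_step_Nil)

section \<open>Finite partitions and path suprema\<close>

lemma exists_finite_partition:
  fixes P :: "real set"
  assumes "finite P" "P \<subseteq> {0..1}" "0 \<in> P" "1 \<in> P"
  shows "\<exists>N s. s 0 = 0 \<and> s N = 1 \<and> (\<forall>i<N. s i < s (Suc i)) \<and> P = s ` {..N::nat}"
proof -
  define xs where "xs = sorted_list_of_set P"
  have xs: "set xs = P" "sorted_wrt (<) xs" unfolding xs_def using assms(1) by auto
  define N where "N = length xs - 1"
  have "xs \<noteq> []" using xs(1) assms(3) by auto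
  then have N: "length xs = Suc N" unfolding N_def by (cases xs) auto
  have lt: "i < j \<Longrightarrow> j \<le> N \<Longrightarrow> xs ! i < xs ! j" for i j
    using xs(2) N by (simp add: sorted_wrt_iff_nth_less)
  have P: "P = (\<lambda>i. xs ! i) ` {..N}"
    unfolding xs(1)[symmetric] set_conv_nth N by (auto simp: less_Suc_eq_le)
  obtain i where i: "i \<le> N" "xs ! i = 0" using assms(3) unfolding P by auto
  obtain j where j: "j \<le> N" "xs ! j = 1" using assms(4) unfolding P by auto
  have "xs ! 0 \<ge> 0" "xs ! N \<le> 1" using assms(2) unfolding P by auto
  then have "xs ! 0 = 0" "xs ! N = 1"
    using lt[of 0 i] lt[of j N] i j by (cases "i = 0"; cases "j = N"; force)+
  then show ?thesis using lt P by (intro exI[of _ N] exI[of _ "\<lambda>i. xs ! i"]) auto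
qed

lemma continuous_exceeds_at_rational:
  fixes f :: "real \<Rightarrow> real"
  assumes f: "continuous_on {0..1} f" and t: "t \<in> {0..1}" "\<epsilon> < f t"
  shows "\<exists>q\<in>\<rat> \<inter> {0..1}. \<epsilon> < f q"
proof -
  obtain d where d: "d > 0" "\<And>u. u \<in> {0..1} \<Longrightarrow> dist u t < d \<Longrightarrow> dist (f u) (f t) < f t - \<epsilon>"
    using f t unfolding continuous_on_iff by (metis diff_gt_0_iff_gt)
  \<comment> \<open>The window is cut at 0 and 1 so that the rational stays in the unit interval
    even if \<open>t\<close> is an endpoint.\<close>
  have "max 0 (t - d) < min 1 (t + d)" using t(1) d(1) by auto
  then obtain q where q: "q \<in> \<rat>" "max 0 (t - d) < q" "q < min 1 (t + d)"
    using Rats_dense_in_real by blast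
  then have q01: "q \<in> {0..1}" by (simp add: less_imp_le)
  have "dist (f q) (f t) < f t - \<epsilon>" by (intro d(2)) (use q in \<open>auto simp: dist_real_def\<close>)
  then have "\<epsilon> < f q" unfolding dist_real_def by linarith
  then show ?thesis using q q01 by blast
qed

text \<open>Exceeding a level strictly is an open condition, so along continuous paths the
  uncountable union over times reduces to rational times.\<close>

lemma exceedance_measurable:
  fixes Z :: "real \<Rightarrow> 'w \<Rightarrow> real"
  assumes "\<And>t. t \<in> {0..1} \<Longrightarrow> Z t \<in> borel_measurable M"
    and "\<And>\<omega>. \<omega> \<in> space M \<Longrightarrow> continuous_on {0..1} (\<lambda>t. Z t \<omega>)"
  shows "{\<omega>\<in>space M. \<exists>t\<in>{0..1}. \<epsilon> < Z t \<omega>} \<in> sets M"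
proof -
  have "{\<omega>\<in>space M. \<exists>t\<in>{0..1}. \<epsilon> < Z t \<omega>} = (\<Union>q\<in>\<rat> \<inter> {0..1}. {\<omega>\<in>space M. \<epsilon> < Z q \<omega>})"
    using continuous_exceeds_at_rational[OF assms(2)] by auto
  moreover have "countable (\<rat> \<inter> {0..1::real})" using countable_rat by (rule countable_Int1)
  moreover have "{\<omega>\<in>space M. \<epsilon> < Z q \<omega>} \<in> sets M" if "q \<in> \<rat> \<inter> {0..1}" for q
  proof -
    have [measurable]: "Z q \<in> borel_measurable M" using assms(1)[of q] that by auto
    show ?thesis by measurable
  qed
  ultimately show ?thesis by (auto intro: sets.countable_UN')
qed

lemma less_SUP_ennreal_iff:
  fixes f :: "real \<Rightarrow> real"
  assumes "\<epsilon> \<ge> 0"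
  shows "ennreal \<epsilon> < (SUP t\<in>{0..1::real}. ennreal (f t)) \<longleftrightarrow> (\<exists>t\<in>{0..1}. \<epsilon> < f t)"
  using assms by (simp add: less_SUP_iff ennreal_less_iff)

context brownian
begin

section \<open>Step integrals as continuous measurable processes\<close>

lemma step_integral_continuous:
  fixes L :: "('w, 'e::real_normed_vector) step"
  assumes "adapted_step F L" "\<omega> \<in> space M"
  shows "continuous_on {0..} (\<lambda>t. step_integral W L t \<omega>)"
  using assms(1)
proof (induction L)
  case (Cons l L)
  obtain a b \<xi> where l: "l = (a, b, \<xi>)" by (cases l)
  have ab: "0 \<le> a" "a < b" and L: "adapted_step F L" using Cons.prems unfolding l adapted_step_Cons by auto
  have *: "continuous_on {0..} (\<lambda>t. W (min c t) \<omega>)" if "c \<ge> 0" for c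
    by (rule continuous_on_compose2[OF W_continuous[OF assms(2)]]) (use that in \<open>auto intro!: continuous_intros\<close>)
  show ?case
    unfolding l step_integral_Cons using ab * Cons.IH[OF L]
    by (intro continuous_on_add continuous_on_scaleR continuous_on_diff continuous_on_const) auto
qed (simp add: step_integral_Nil)

lemma step_integral_strongly_measurable:
  fixes L :: "('w, 'e::real_normed_vector) step"
  assumes "adapted_step F L" "t \<ge> 0"
  shows "strongly_measurable M (step_integral W L t)"
  using assms(1)
proof (induction L)
  case Nil
  then show ?case by (simp add: step_integral_def[abs_def] strongly_measurable_const)
next
  case (Cons l L)
  obtain a b \<xi> where l: "l = (a, b, \<xi>)" by (cases l)
  have ab: "0 \<le> a" "a < b" "strongly_measurable (F a) \<xi>" and L: "adapted_step F L"
    using Cons.prems unfolding l adapted_step_Cons by auto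
  have "strongly_measurable M \<xi>"
    using strongly_measurable_compose[OF id_measurable_F[OF ab(1)] ab(3)] .
  moreover have "(\<lambda>\<omega>. W (min b t) \<omega> - W (min a t) \<omega>) \<in> borel_measurable M"
    using ab assms(2) by (intro borel_measurable_diff W_measurable) auto
  ultimately have "strongly_measurable M (\<lambda>\<omega>. (W (min b t) \<omega> - W (min a t) \<omega>) *\<^sub>R \<xi> \<omega> + step_integral W L t \<omega>)"
    using Cons.IH[OF L] by (intro strongly_measurable_add strongly_measurable_scaleR)
  then show ?case unfolding l step_integral_Cons[abs_def] by simp
qed

lemma step_process_strongly_measurable:
  fixes L :: "('w, 'e::real_normed_vector) step"
  assumes "adapted_step F L"
  shows "strongly_measurable_process M (step_process L)"
  using assms
proof (induction L)
  case Nil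
  then show ?case by (simp add: strongly_measurable_process_def step_process_def[abs_def] strongly_measurable_const split_def)
next
  case (Cons l L)
  obtain a b \<xi> where l: "l = (a, b, \<xi>)" by (cases l)
  have ab: "0 \<le> a" "a < b" "strongly_measurable (F a) \<xi>" and L: "adapted_step F L"
    using Cons.prems unfolding l adapted_step_Cons by auto
  let ?R = "restrict_space borel {0..1::real} \<Otimes>\<^sub>M M"
  have "strongly_measurable M \<xi>"
    using strongly_measurable_compose[OF id_measurable_F[OF ab(1)] ab(3)] .
  then have 1: "strongly_measurable ?R (\<lambda>p. \<xi> (snd p))"
    by (rule strongly_measurable_compose[OF measurable_snd])
  have [measurable]: "(\<lambda>t. t) \<in> measurable (restrict_space borel {0..1::real}) borel"
    by (rule measurable_restrict_space1) simp
  have 2: "(\<lambda>p. indicat_real {a<..b} (fst p)) \<in> borel_measurable ?R" by measurable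
  have "strongly_measurable ?R (\<lambda>p. indicat_real {a<..b} (fst p) *\<^sub>R \<xi> (snd p) + step_process L (fst p) (snd p))"
    using Cons.IH[OF L] unfolding strongly_measurable_process_def split_def
    by (intro strongly_measurable_add strongly_measurable_scaleR 1 2)
  then show ?case unfolding strongly_measurable_process_def l split_def step_process_Cons .
qed


section \<open>Step integrals as sums over a common partition\<close>

definition cell_coeff :: "('w, real) step \<Rightarrow> (nat \<Rightarrow> real) \<Rightarrow> nat \<Rightarrow> 'w \<Rightarrow> real" where
  "cell_coeff L s i \<omega> = (\<Sum>(a, b, \<xi>)\<leftarrow>L. if a \<le> s i \<and> s (Suc i) \<le> b then \<xi> \<omega> else 0)"

lemma cell_coeff_Cons:
  "cell_coeff ((a, b, \<xi>) # L) s i \<omega> = (if a \<le> s i \<and> s (Suc i) \<le> b then \<xi> \<omega> else 0) + cell_coeff L s i \<omega>"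
  by (simp add: cell_coeff_def)

lemma cell_coeff_measurable:
  assumes "adapted_step F L" "0 \<le> s i"
  shows "cell_coeff L s i \<in> borel_measurable (F (s i))"
  using assms(1)
proof (induction L)
  case Nil
  then show ?case by (simp add: cell_coeff_def[abs_def])
next
  case (Cons l L)
  obtain a b \<xi> where l: "l = (a, b, \<xi>)" by (cases l)
  have ab: "0 \<le> a" "\<xi> \<in> borel_measurable (F a)" and L: "adapted_step F L"
    using Cons.prems unfolding l adapted_step_Cons strongly_measurable_real by auto
  have "(\<lambda>\<omega>. if a \<le> s i \<and> s (Suc i) \<le> b then \<xi> \<omega> else 0) \<in> borel_measurable (F (s i))"
    using measurable_F_mono[OF ab(1) _ ab(2), of "s i"] by (cases "a \<le> s i \<and> s (Suc i) \<le> b") auto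
  then show ?case
    unfolding l cell_coeff_Cons[abs_def] by (rule borel_measurable_add[OF _ Cons.IH[OF L]])
qed

text \<open>By \<open>sep\<close> no endpoint of an interval lies strictly inside the cell, so each
  interval either contains the cell or misses it; as cells and intervals are half-open on the same
  side, this is exact at the endpoints too.\<close>

lemma step_process_on_cell:
  assumes sep: "\<And>a b \<xi>. (a, b, \<xi>) \<in> set L \<Longrightarrow> (a \<le> s i \<or> s (Suc i) \<le> a) \<and> (b \<le> s i \<or> s (Suc i) \<le> b)"
    and t: "t \<in> {s i<..s (Suc i)}"
  shows "step_process L t \<omega> = cell_coeff L s i \<omega>"
  using sep
proof (induction L)
  case (Cons l L)
  obtain a b \<xi> where l: "l = (a, b, \<xi>)" by (cases l)
  have "(a \<le> s i \<or> s (Suc i) \<le> a) \<and> (b \<le> s i \<or> s (Suc i) \<le> b)" by (rule Cons.prems[of a b \<xi>]) (simp add: l)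
  then have "indicat_real {a<..b} t *\<^sub>R \<xi> \<omega> = (if a \<le> s i \<and> s (Suc i) \<le> b then \<xi> \<omega> else 0)"
    using t by (auto simp: indicator_def)
  moreover have "step_process L t \<omega> = cell_coeff L s i \<omega>"
    by (rule Cons.IH) (meson Cons.prems list.set_intros(2))
  ultimately show ?case unfolding l step_process_Cons cell_coeff_Cons by simp
qed (simp add: step_process_Nil cell_coeff_def)

text \<open>For a single interval the increment of \<open>W\<close> over its part before
  \<open>s n\<close> telescopes over the cells inside it; linearity along the list does the
  rest.\<close>

lemma step_integral_on_partition:
  assumes L: "adapted_step F L"
    and s: "s 0 = 0" "\<And>i. i < N \<Longrightarrow> s i < s (Suc i)"
    and sep: "\<And>a b \<xi> i. (a, b, \<xi>) \<in> set L \<Longrightarrow> i < N \<Longrightarrow>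
       (a \<le> s i \<or> s (Suc i) \<le> a) \<and> (b \<le> s i \<or> s (Suc i) \<le> b)"
    and n: "n \<le> N"
  shows "step_integral W L (s n) \<omega> = (ito_sum (cell_coeff L s) s n \<omega>)"
  using L sep
proof (induction L)
  case (Cons l L)
  obtain a b \<xi> where l: "l = (a, b, \<xi>)" by (cases l)
  have ab: "0 \<le> a" "a < b" and L: "adapted_step F L" using Cons.prems unfolding l adapted_step_Cons by auto
  have sep: "(a \<le> s i \<or> s (Suc i) \<le> a) \<and> (b \<le> s i \<or> s (Suc i) \<le> b)" if "i < N" for i
    using Cons.prems(2)[of a b \<xi> i] that by (simp add: l)
  have "W (min b (s n)) \<omega> - W (min a (s n)) \<omega> =
     (\<Sum>i<n. if a \<le> s i \<and> s (Suc i) \<le> b then W (s (Suc i)) \<omega> - W (s i) \<omega> else 0)"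
    using n
  proof (induction n)
    case 0
    then show ?case using ab s(1) by simp
  next
    case (Suc n)
    then have "n < N" by simp
    then show ?case using Suc sep[of n] s(2)[of n] ab by (auto simp: min_def)
  qed
  then have "(W (min b (s n)) \<omega> - W (min a (s n)) \<omega>) *\<^sub>R \<xi> \<omega> =
      (\<Sum>i<n. (if a \<le> s i \<and> s (Suc i) \<le> b then \<xi> \<omega> else 0) * (W (s (Suc i)) \<omega> - W (s i) \<omega>))"
    by (simp add: sum_distrib_right) (intro sum.cong, auto)
  moreover have "step_integral W L (s n) \<omega> = (ito_sum (cell_coeff L s) s n \<omega>)"
    by (rule Cons.IH[OF L]) (meson Cons.prems(2) list.set_intros(2))
  ultimately show ?case
    unfolding l step_integral_Cons cell_coeff_Cons by (simp add: distrib_right sum.distrib)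
qed (simp add: step_integral_Nil cell_coeff_def)

text \<open>The partition contains the observed times as well as all endpoints, so every observed
  value of the integral is a partial sum in \<open>discrete_maximal_inequality\<close>, while the
  quadratic sum is at most the energy.\<close>

lemma maximal_inequality_finite:
  assumes L: "adapted_step F L" and T: "finite T" "T \<subseteq> {0..1}" and \<epsilon>: "0 < \<epsilon>" and \<delta>: "0 \<le> \<delta>"
  shows "prob {\<omega>\<in>space M. \<exists>t\<in>T. \<epsilon> < \<bar>step_integral W L t \<omega>\<bar>} \<le>
     \<delta> / \<epsilon>\<^sup>2 + prob {\<omega>\<in>space M. ennreal \<delta> < energy (step_process L) \<omega>}"
proof -
  define P where "P = {0, 1} \<union> T \<union> (\<Union>(a, b, \<xi>)\<in>set L. {a, b})"
  have "finite P" "P \<subseteq> {0..1}" "0 \<in> P" "1 \<in> P"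
    using T L unfolding P_def adapted_step_def by (auto, (fastforce+)?)
  then obtain N s where s: "s 0 = 0" "s N = 1" "\<And>i. i < N \<Longrightarrow> s i < s (Suc i)" and Ps: "P = s ` {..N}"
    using exists_finite_partition[of P] by blast
  have smono: "s i \<le> s j" if "i \<le> j" "j \<le> N" for i j
    by (rule finite_chain_le[where s=s and N=N, OF s(3) that])
  have pos: "i \<le> N \<Longrightarrow> 0 \<le> s i" for i using smono[of 0 i] s(1) by simp
  have cut: "c \<le> s i \<or> s (Suc i) \<le> c" if c: "c \<in> P" "i < N" for c i
  proof -
    obtain j where j: "c = s j" "j \<le> N" using c(1) unfolding Ps by blast
    then show ?thesis using smono[of j i] smono[of "Suc i" j] c(2) by (cases "j \<le> i") auto
  qed
  have sep: "(a \<le> s i \<or> s (Suc i) \<le> a) \<and> (b \<le> s i \<or> s (Suc i) \<le> b)" if "(a, b, \<xi>) \<in> set L" "i < N" for a b \<xi> i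
  proof -
    have "a \<in> P" "b \<in> P" using that(1) unfolding P_def by force+
    then show ?thesis using cut that(2) by blast
  qed
  let ?\<eta> = "cell_coeff L s"
  let ?S = "\<lambda>n \<omega>. ito_sum ?\<eta> s n \<omega>"
  let ?Q = "\<lambda>n \<omega>. quadratic_sum ?\<eta> s n \<omega>"
  have S: "step_integral W L (s n) \<omega> = ?S n \<omega>" if "n \<le> N" for n \<omega>
    by (rule step_integral_on_partition[OF L s(1,3) _ that]) (use sep in blast)+
  have "{\<omega>\<in>space M. \<exists>t\<in>T. \<epsilon> < \<bar>step_integral W L t \<omega>\<bar>} \<subseteq> {\<omega>\<in>space M. \<exists>n\<le>N. \<epsilon> < \<bar>?S n \<omega>\<bar>}"
  proof safe
    fix \<omega> t assume "t \<in> T" and *: "\<epsilon> < \<bar>step_integral W L t \<omega>\<bar>"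
    then have "t \<in> P" unfolding P_def by simp
    then obtain n where "n \<le> N" "t = s n" unfolding Ps by blast
    then show "\<exists>n\<le>N. \<epsilon> < \<bar>?S n \<omega>\<bar>" using * S by auto
  qed
  moreover have eta_M: "i < N \<Longrightarrow> ?\<eta> i \<in> borel_measurable M" for i
    using measurable_F_imp[OF pos cell_coeff_measurable[where L=L and s=s and i=i, OF L pos]] by simp
  have SM: "?S n \<in> borel_measurable M" if "n \<le> N" for n
    using that pos by (intro borel_measurable_sum borel_measurable_times borel_measurable_diff W_measurable eta_M) auto
  then have "{\<omega>\<in>space M. \<exists>n\<le>N. \<epsilon> < \<bar>?S n \<omega>\<bar>} = (\<Union>n\<in>{..N}. {\<omega>\<in>space M. \<epsilon> < \<bar>?S n \<omega>\<bar>})" by auto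
  moreover have "(\<Union>n\<in>{..N}. {\<omega>\<in>space M. \<epsilon> < \<bar>?S n \<omega>\<bar>}) \<in> events"
    using SM by (intro sets.finite_UN) (auto intro!: borel_measurable_less borel_measurable_abs)
  ultimately have "prob {\<omega>\<in>space M. \<exists>t\<in>T. \<epsilon> < \<bar>step_integral W L t \<omega>\<bar>} \<le> prob {\<omega>\<in>space M. \<exists>n\<le>N. \<epsilon> < \<bar>?S n \<omega>\<bar>}"
    by (intro finite_measure_mono) auto
  also have "\<dots> \<le> \<delta> / \<epsilon>\<^sup>2 + prob {\<omega>\<in>space M. \<delta> < ?Q N \<omega>}"
    by (rule discrete_maximal_inequality[where s=s and N=N and \<eta>="?\<eta>", OF _ _ _ \<epsilon> \<delta>]) (auto simp: s(1,3) intro!: cell_coeff_measurable L pos)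
  also have "prob {\<omega>\<in>space M. \<delta> < ?Q N \<omega>} \<le> prob {\<omega>\<in>space M. ennreal \<delta> < energy (step_process L) \<omega>}"
  proof (rule finite_measure_mono)
    show "{\<omega>\<in>space M. ennreal \<delta> < energy (step_process L) \<omega>} \<in> events"
      using energy_measurable[OF step_process_strongly_measurable[OF L]] by measurable
    \<comment> \<open>Each cell contributes the integral of a constant; the half-open cells are
      disjoint, so at most one indicator is nonzero at a given time.\<close>
    have Q: "ennreal (?Q N \<omega>) \<le> energy (step_process L) \<omega>" for \<omega>
    proof -
      have "ennreal (?Q N \<omega>) = (\<Sum>i<N. ennreal ((?\<eta> i \<omega>)\<^sup>2) * ennreal (s (Suc i) - s i))"
        using s(3) by (subst sum_ennreal[symmetric]) (auto simp: ennreal_mult less_imp_le intro!: sum.cong)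
      also have "\<dots> = (\<Sum>i<N. \<integral>\<^sup>+t. ennreal ((?\<eta> i \<omega>)\<^sup>2) * indicator {s i<..s (Suc i)} t \<partial>lborel)"
        using s(3) by (intro sum.cong) (auto simp: nn_integral_cmult less_imp_le)
      also have "\<dots> = (\<integral>\<^sup>+t. (\<Sum>i<N. ennreal ((?\<eta> i \<omega>)\<^sup>2) * indicator {s i<..s (Suc i)} t) \<partial>lborel)"
        by (subst nn_integral_sum) auto
      also have "\<dots> \<le> energy (step_process L) \<omega>"
        unfolding energy_def
      proof (rule nn_integral_mono)
        fix t
        show "(\<Sum>i<N. ennreal ((?\<eta> i \<omega>)\<^sup>2) * indicator {s i<..s (Suc i)} t)
          \<le> ennreal (\<bar>step_process L t \<omega>\<bar>\<^sup>2) * indicator {0..1} t"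
        proof (cases "\<exists>j<N. t \<in> {s j<..s (Suc j)}")
          case True
          then obtain j where j: "j < N" "t \<in> {s j<..s (Suc j)}" by blast
          have uniq: "t \<notin> {s i<..s (Suc i)}" if i: "i < N" "i \<noteq> j" for i
          proof (cases "i < j")
            case True
            then show ?thesis using smono[of "Suc i" j] j by simp
          next
            case False
            then show ?thesis using smono[of "Suc j" i] i j by simp
          qed
          have "(\<Sum>i<N. ennreal ((?\<eta> i \<omega>)\<^sup>2) * indicator {s i<..s (Suc i)} t) =
             (\<Sum>i<N. if i = j then ennreal ((?\<eta> j \<omega>)\<^sup>2) else 0)"
          proof (rule sum.cong[OF refl])
            fix i assume "i \<in> {..<N}"
            then show "ennreal ((?\<eta> i \<omega>)\<^sup>2) * indicator {s i<..s (Suc i)} t = (if i = j then ennreal ((?\<eta> j \<omega>)\<^sup>2) else 0)"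
              using uniq[of i] j(2) by (cases "i = j") (auto simp del: greaterThanAtMost_iff)
          qed
          also have "\<dots> = ennreal ((?\<eta> j \<omega>)\<^sup>2)" using j(1) by simp
          also have "cell_coeff L s j \<omega> = step_process L t \<omega>"
            by (rule step_process_on_cell[OF _ j(2), symmetric]) (use sep j(1) in blast)
          finally have "(\<Sum>i<N. ennreal ((?\<eta> i \<omega>)\<^sup>2) * indicator {s i<..s (Suc i)} t) =
            ennreal (\<bar>step_process L t \<omega>\<bar>\<^sup>2)" by simp
          moreover have "t \<in> {0..1}" using j pos[of j] smono[of "Suc j" N] s(2) by auto
          ultimately show ?thesis by simp
        next
          case False
          then have "(\<Sum>i<N. ennreal ((?\<eta> i \<omega>)\<^sup>2) * indicator {s i<..s (Suc i)} t) = 0"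
            by (intro sum.neutral) auto
          then show ?thesis by simp
        qed
      qed
      finally show ?thesis .
    qed
    show "{\<omega>\<in>space M. \<delta> < ?Q N \<omega>} \<subseteq> {\<omega>\<in>space M. ennreal \<delta> < energy (step_process L) \<omega>}"
    proof safe
      fix \<omega> assume "\<delta> < ?Q N \<omega>"
      then have "ennreal \<delta> < ennreal (?Q N \<omega>)" using \<delta> by (simp add: ennreal_less_iff)
      then show "ennreal \<delta> < energy (step_process L) \<omega>" using Q[of \<omega>] by (rule less_le_trans)
    qed
  qed
  finally show ?thesis by simp
qed

lemma step_exceedance_measurable:
  assumes "adapted_step F (L :: ('w, real) step)"
  shows "{\<omega>\<in>space M. \<exists>t\<in>{0..1}. \<epsilon> < \<bar>step_integral W L t \<omega>\<bar>} \<in> events"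
proof (rule exceedance_measurable)
  show "(\<lambda>\<omega>. \<bar>step_integral W L t \<omega>\<bar>) \<in> borel_measurable M" if "t \<in> {0..1}" for t
    using step_integral_strongly_measurable[OF assms, of t] that
    by (intro borel_measurable_abs) (auto simp: strongly_measurable_real)
  show "continuous_on {0..1} (\<lambda>t. \<bar>step_integral W L t \<omega>\<bar>)" if "\<omega> \<in> space M" for \<omega>
    by (intro continuous_on_rabs continuous_on_subset[OF step_integral_continuous[OF assms that]]) auto
qed

text \<open>The bound for a finite set of times does not depend on that set. Exhausting the
  rationals of the unit interval by finite sets, and then path continuity, extends it to all
  times.\<close>

lemma maximal_inequality:
  assumes L: "adapted_step F L" and \<epsilon>: "0 < \<epsilon>" and \<delta>: "0 \<le> \<delta>"
  shows "prob {\<omega>\<in>space M. \<exists>t\<in>{0..1}. \<epsilon> < \<bar>step_integral W L t \<omega>\<bar>} \<le>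
     \<delta> / \<epsilon>\<^sup>2 + prob {\<omega>\<in>space M. ennreal \<delta> < energy (step_process L) \<omega>}"
proof -
  let ?q = "from_nat_into (\<rat> \<inter> {0..1::real})"
  have "countable (\<rat> \<inter> {0..1::real})" using countable_rat by (rule countable_Int1)
  moreover have "(0::real) \<in> \<rat> \<inter> {0..1::real}" by simp
  ultimately have range: "range ?q = \<rat> \<inter> {0..1}" by (intro range_from_nat_into) auto
  define A where "A n = {\<omega>\<in>space M. \<exists>t\<in>?q ` {..n}. \<epsilon> < \<bar>step_integral W L t \<omega>\<bar>}" for n
  have q01: "?q k \<in> {0..1}" for k using range by blast
  have meas: "{\<omega>\<in>space M. \<epsilon> < \<bar>step_integral W L (?q k) \<omega>\<bar>} \<in> events" for k
    using step_integral_strongly_measurable[OF L, of "?q k"] q01[of k]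
    unfolding strongly_measurable_real by (intro borel_measurable_less borel_measurable_abs) auto
  have "A n = (\<Union>k\<le>n. {\<omega>\<in>space M. \<epsilon> < \<bar>step_integral W L (?q k) \<omega>\<bar>})" for n
    unfolding A_def by auto
  then have A: "range A \<subseteq> events" using meas by auto
  have inc: "incseq A" unfolding incseq_def A_def by (auto intro: order_trans)
  have "(\<Union>n. A n) = {\<omega>\<in>space M. \<exists>t\<in>{0..1}. \<epsilon> < \<bar>step_integral W L t \<omega>\<bar>}"
  proof safe
    fix \<omega> n assume "\<omega> \<in> A n"
    then show "\<omega> \<in> space M" "\<exists>t\<in>{0..1}. \<epsilon> < \<bar>step_integral W L t \<omega>\<bar>" using q01 unfolding A_def by auto
  next
    fix \<omega> t assume \<omega>: "\<omega> \<in> space M" and t: "t \<in> {0..1::real}" "\<epsilon> < \<bar>step_integral W L t \<omega>\<bar>"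
    have "continuous_on {0..1} (\<lambda>t. \<bar>step_integral W L t \<omega>\<bar>)"
      by (intro continuous_on_rabs continuous_on_subset[OF step_integral_continuous[OF L \<omega>]]) auto
    from continuous_exceeds_at_rational[OF this t] obtain u where "u \<in> range ?q" "\<epsilon> < \<bar>step_integral W L u \<omega>\<bar>"
      unfolding range by blast
    then show "\<omega> \<in> (\<Union>n. A n)" using \<omega> unfolding A_def by auto
  qed
  then have "(\<lambda>n. prob (A n)) \<longlonglongrightarrow> prob {\<omega>\<in>space M. \<exists>t\<in>{0..1}. \<epsilon> < \<bar>step_integral W L t \<omega>\<bar>}"
    using finite_Lim_measure_incseq[OF A inc] by simp
  moreover have "prob (A n) \<le> \<delta> / \<epsilon>\<^sup>2 + prob {\<omega>\<in>space M. ennreal \<delta> < energy (step_process L) \<omega>}" for n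
    unfolding A_def using q01 by (intro maximal_inequality_finite[OF L _ _ \<epsilon> \<delta>]) auto
  ultimately show ?thesis using LIMSEQ_le_const2 by blast
qed


subsection \<open>Uniqueness of the stochastic integral\<close>

lemma strongly_measurable_process_diff:
  fixes f g :: "real \<Rightarrow> 'w \<Rightarrow> 'e::real_normed_vector"
  assumes "strongly_measurable_process M f" "strongly_measurable_process M g"
  shows "strongly_measurable_process M (\<lambda>t \<omega>. f t \<omega> - g t \<omega>)"
  using assms unfolding strongly_measurable_process_def split_def by (rule strongly_measurable_diff)

lemma strongly_measurable_process_inner:
  fixes f :: "real \<Rightarrow> 'w \<Rightarrow> 'e::real_inner"
  assumes "strongly_measurable_process M f"
  shows "strongly_measurable_process M (\<lambda>t \<omega>. f t \<omega> \<bullet> x)"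
  using assms unfolding strongly_measurable_process_def split_def strongly_measurable_real
  by (rule strongly_measurable_inner)

text \<open>Monotonicity of the measure asks for measurability of the larger events only, so the
  smaller ones, typically defined by suprema, may be arbitrary.\<close>

lemma prob_tendsto_0_mono:
  assumes "\<And>n. A n \<subseteq> B n" "\<And>n. B n \<in> events" "(\<lambda>n. prob (B n)) \<longlonglongrightarrow> 0"
  shows "(\<lambda>n. prob (A n)) \<longlonglongrightarrow> 0"
proof (rule tendsto_sandwich[OF _ _ tendsto_const assms(3)])
  show "\<forall>\<^sub>F n in sequentially. 0 \<le> prob (A n)" by simp
  show "\<forall>\<^sub>F n in sequentially. prob (A n) \<le> prob (B n)"
    using finite_measure_mono[OF assms(1,2)] by simp
qed

text \<open>In the scalar case the test vector 1 suffices, and the supremum becomes an existential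
  statement about times.\<close>

lemma has_stochastic_integral_realE:
  fixes \<phi> X :: "real \<Rightarrow> 'w \<Rightarrow> real"
  assumes "has_stochastic_integral M F W \<phi> X"
  obtains L where "\<And>n. adapted_step F (L n)"
    "null_in_probability M (\<lambda>n. energy (\<lambda>t \<omega>. step_process (L n) t \<omega> - \<phi> t \<omega>))"
    "\<And>\<epsilon>. \<epsilon> > 0 \<Longrightarrow> (\<lambda>n. prob {\<omega>\<in>space M. \<exists>t\<in>{0..1}. \<epsilon> < \<bar>step_integral W (L n) t \<omega> - X t \<omega>\<bar>}) \<longlonglongrightarrow> 0"
proof -
  obtain L where L: "\<forall>n. adapted_step F (L n)"
    and e: "\<And>x. null_in_probability M
           (\<lambda>n \<omega>. \<integral>\<^sup>+t\<in>{0..1}. ennreal (\<bar>step_process (L n) t \<omega> \<bullet> x - \<phi> t \<omega> \<bullet> x\<bar>\<^sup>2) \<partial>lborel)"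
    and sup: "null_in_probability M
           (\<lambda>n \<omega>. SUP t\<in>{0..1}. ennreal (norm (step_integral W (L n) t \<omega> - X t \<omega>)))"
    using assms unfolding has_stochastic_integral_def by blast
  show ?thesis
  proof (rule that[of L])
    show "null_in_probability M (\<lambda>n. energy (\<lambda>t \<omega>. step_process (L n) t \<omega> - \<phi> t \<omega>))"
      using e[of 1] by (simp add: energy_def[abs_def])
    show "(\<lambda>n. prob {\<omega>\<in>space M. \<exists>t\<in>{0..1}. \<epsilon> < \<bar>step_integral W (L n) t \<omega> - X t \<omega>\<bar>}) \<longlonglongrightarrow> 0" if "\<epsilon> > 0" for \<epsilon>
      using sup that less_SUP_ennreal_iff[of \<epsilon> "\<lambda>t. \<bar>step_integral W (L _) t _ - X t _\<bar>"]
      unfolding null_in_probability_def by (simp add: less_SUP_ennreal_iff)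
  qed (use L in blast)
qed

lemma integral_exceedance_measurable:
  fixes X :: "real \<Rightarrow> 'w \<Rightarrow> 'e::real_normed_vector"
  assumes L: "adapted_step F L" and X: "continuous_process M X"
  shows "{\<omega>\<in>space M. \<exists>t\<in>{0..1}. \<epsilon> < norm (step_integral W L t \<omega> - X t \<omega>)} \<in> events"
proof (rule exceedance_measurable)
  show "(\<lambda>\<omega>. norm (step_integral W L t \<omega> - X t \<omega>)) \<in> borel_measurable M" if "t \<in> {0..1}" for t
    using X that unfolding continuous_process_def
    by (intro strongly_measurable_imp_norm strongly_measurable_diff step_integral_strongly_measurable L) auto
  show "continuous_on {0..1} (\<lambda>t. norm (step_integral W L t \<omega> - X t \<omega>))" if "\<omega> \<in> space M" for \<omega>
    using X that unfolding continuous_process_def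
    by (intro continuous_on_norm continuous_on_diff continuous_on_subset[OF step_integral_continuous[OF L that]]) auto
qed

lemma energy_diff_le:
  assumes "strongly_measurable_process M f" "strongly_measurable_process M g" "\<omega> \<in> space M"
  shows "energy (\<lambda>t \<omega>. f t \<omega> - g t \<omega>) \<omega> \<le> 2 * energy f \<omega> + 2 * energy g \<omega>"
proof -
  have sec: "(\<lambda>t. ennreal (\<bar>h t \<omega>\<bar>\<^sup>2) * indicator {0..1} t) \<in> borel_measurable borel"
    if "strongly_measurable_process M h" for h
  proof -
    have "(\<lambda>t. h t \<omega>) \<in> borel_measurable (restrict_space borel {0..1})"
      using measurable_compose[OF measurable_Pair2'[OF assms(3), of "restrict_space borel {0..1::real}"]
          that[unfolded strongly_measurable_process_def strongly_measurable_real]]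
      by simp
    then show ?thesis by (subst borel_measurable_restrict_space_iff_ennreal[symmetric]) auto
  qed
  have "energy (\<lambda>t \<omega>. f t \<omega> - g t \<omega>) \<omega> \<le> (\<integral>\<^sup>+t. 2 * (ennreal (\<bar>f t \<omega>\<bar>\<^sup>2) * indicator {0..1} t) +
      2 * (ennreal (\<bar>g t \<omega>\<bar>\<^sup>2) * indicator {0..1} t) \<partial>lborel)"
    unfolding energy_def
  proof (rule nn_integral_mono)
    fix t
    have "(f t \<omega> - g t \<omega>)\<^sup>2 \<le> 2 * (f t \<omega>)\<^sup>2 + 2 * (g t \<omega>)\<^sup>2"
      using zero_le_power2[of "f t \<omega> + g t \<omega>"] by (simp add: power2_sum power2_diff)
    then have "ennreal (\<bar>f t \<omega> - g t \<omega>\<bar>\<^sup>2) \<le> ennreal (2 * \<bar>f t \<omega>\<bar>\<^sup>2 + 2 * \<bar>g t \<omega>\<bar>\<^sup>2)" by (intro ennreal_leI) simp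
    also have "\<dots> = 2 * ennreal (\<bar>f t \<omega>\<bar>\<^sup>2) + 2 * ennreal (\<bar>g t \<omega>\<bar>\<^sup>2)"
      by (simp add: ennreal_plus ennreal_mult)
    finally show "ennreal (\<bar>f t \<omega> - g t \<omega>\<bar>\<^sup>2) * indicator {0..1} t \<le>
      2 * (ennreal (\<bar>f t \<omega>\<bar>\<^sup>2) * indicator {0..1} t) + 2 * (ennreal (\<bar>g t \<omega>\<bar>\<^sup>2) * indicator {0..1} t)"
      by (auto simp: indicator_def)
  qed
  also have "\<dots> = 2 * energy f \<omega> + 2 * energy g \<omega>"
    unfolding energy_def using sec[OF assms(1)] sec[OF assms(2)]
    by (subst nn_integral_add) (auto simp: nn_integral_cmult)
  finally show ?thesis .
qed

text \<open>The differences of the two approximating sequences are step processes whose energy tends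
  to zero in probability, since both sequences approximate the same integrand. The maximal
  inequality makes their integrals uniformly small, and these link \<open>X\<close> to
  \<open>X'\<close>; the three errors involved explain the factor 3.\<close>

lemma stochastic_integral_unique:
  fixes \<phi> X X' :: "real \<Rightarrow> 'w \<Rightarrow> real"
  assumes X: "has_stochastic_integral M F W \<phi> X" and X': "has_stochastic_integral M F W \<phi> X'"
    and t: "t \<in> {0..1}"
  shows "AE \<omega> in M. X t \<omega> = X' t \<omega>"
proof -
  obtain L where L: "\<And>n. adapted_step F (L n)"
    and e: "null_in_probability M (\<lambda>n. energy (\<lambda>t \<omega>. step_process (L n) t \<omega> - \<phi> t \<omega>))"
    and p: "\<And>\<epsilon>. \<epsilon> > 0 \<Longrightarrow> (\<lambda>n. prob {\<omega>\<in>space M. \<exists>t\<in>{0..1}. \<epsilon> < \<bar>step_integral W (L n) t \<omega> - X t \<omega>\<bar>}) \<longlonglongrightarrow> 0"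
    using has_stochastic_integral_realE[OF X] by blast
  obtain L' where L': "\<And>n. adapted_step F (L' n)"
    and e': "null_in_probability M (\<lambda>n. energy (\<lambda>t \<omega>. step_process (L' n) t \<omega> - \<phi> t \<omega>))"
    and p': "\<And>\<epsilon>. \<epsilon> > 0 \<Longrightarrow> (\<lambda>n. prob {\<omega>\<in>space M. \<exists>t\<in>{0..1}. \<epsilon> < \<bar>step_integral W (L' n) t \<omega> - X' t \<omega>\<bar>}) \<longlonglongrightarrow> 0"
    using has_stochastic_integral_realE[OF X'] by blast
  have cp: "continuous_process M X" "continuous_process M X'" and \<phi>: "strongly_measurable_process M \<phi>"
    using X X' unfolding has_stochastic_integral_def by auto
  have [measurable]: "X t \<in> borel_measurable M" "X' t \<in> borel_measurable M"
    using cp t unfolding continuous_process_def strongly_measurable_real by auto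
  define D where "D n = L n @ neg_step (L' n)" for n
  have D: "adapted_step F (D n)" for n
    unfolding D_def adapted_step_append using L L' adapted_step_neg by blast
  let ?e = "\<lambda>n. energy (\<lambda>t \<omega>. step_process (L n) t \<omega> - \<phi> t \<omega>)"
  let ?e' = "\<lambda>n. energy (\<lambda>t \<omega>. step_process (L' n) t \<omega> - \<phi> t \<omega>)"
  let ?A = "\<lambda>\<epsilon> n. {\<omega>\<in>space M. \<exists>t\<in>{0..1}. \<epsilon> < \<bar>step_integral W (L n) t \<omega> - X t \<omega>\<bar>}"
  let ?A' = "\<lambda>\<epsilon> n. {\<omega>\<in>space M. \<exists>t\<in>{0..1}. \<epsilon> < \<bar>step_integral W (L' n) t \<omega> - X' t \<omega>\<bar>}"
  let ?B = "\<lambda>\<epsilon> n. {\<omega>\<in>space M. \<exists>t\<in>{0..1}. \<epsilon> < \<bar>step_integral W (D n) t \<omega>\<bar>}"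
  \<comment> \<open>The energy of the difference is at most twice the sum of both errors, so two
    errors of at most \<delta>/4 keep it within \<delta>.\<close>
  let ?E = "\<lambda>\<delta> n. {\<omega>\<in>space M. ennreal (\<delta> / 4) < ?e n \<omega>}"
  let ?E' = "\<lambda>\<delta> n. {\<omega>\<in>space M. ennreal (\<delta> / 4) < ?e' n \<omega>}"
  have A: "?A \<epsilon> n \<in> events" "?A' \<epsilon> n \<in> events" for \<epsilon> n
    using integral_exceedance_measurable[OF L cp(1), of \<epsilon> n] integral_exceedance_measurable[OF L' cp(2), of \<epsilon> n] by auto
  have B: "?B \<epsilon> n \<in> events" for \<epsilon> n by (rule step_exceedance_measurable[OF D])
  have sp: "strongly_measurable_process M (\<lambda>t \<omega>. step_process (L n) t \<omega> - \<phi> t \<omega>)"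
    "strongly_measurable_process M (\<lambda>t \<omega>. step_process (L' n) t \<omega> - \<phi> t \<omega>)" for n
    by (intro strongly_measurable_process_diff step_process_strongly_measurable L L' \<phi>)+
  note [measurable] = energy_measurable[OF sp(1)] energy_measurable[OF sp(2)]
  have E: "?E \<delta> n \<in> events" "?E' \<delta> n \<in> events" for \<delta> n by measurable
  have Dle: "energy (step_process (D n)) \<omega> \<le> 2 * ?e n \<omega> + 2 * ?e' n \<omega>" if "\<omega> \<in> space M" for n \<omega>
    using energy_diff_le[OF sp that, of n n] by (simp add: energy_def D_def step_process_append step_process_neg)
  have energy_D: "prob {\<omega>\<in>space M. ennreal \<delta> < energy (step_process (D n)) \<omega>} \<le> prob (?E \<delta> n) + prob (?E' \<delta> n)"
    if \<delta>: "\<delta> > 0" for \<delta> n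
  proof -
    have "{\<omega>\<in>space M. ennreal \<delta> < energy (step_process (D n)) \<omega>} \<subseteq> ?E \<delta> n \<union> ?E' \<delta> n"
    proof (rule ccontr)
      assume "\<not> ?thesis"
      then obtain \<omega> where \<omega>: "\<omega> \<in> space M" "ennreal \<delta> < energy (step_process (D n)) \<omega>"
        "\<not> ennreal (\<delta> / 4) < ?e n \<omega>" "\<not> ennreal (\<delta> / 4) < ?e' n \<omega>" by blast
      have "2 * ?e n \<omega> + 2 * ?e' n \<omega> \<le> 2 * ennreal (\<delta> / 4) + 2 * ennreal (\<delta> / 4)"
        using \<omega>(3,4) by (intro add_mono mult_left_mono) (auto simp: not_less)
      also have "2 * ennreal (\<delta> / 4) = ennreal (\<delta> / 2)"
        using ennreal_mult'[of 2 "\<delta> / 4"] by simp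
      also have "ennreal (\<delta> / 2) + ennreal (\<delta> / 2) = ennreal \<delta>"
        using \<delta> by (simp add: ennreal_plus[symmetric] del: ennreal_plus)
      finally show False using \<omega>(2) Dle[OF \<omega>(1), of n] by simp
    qed
    then have "prob {\<omega>\<in>space M. ennreal \<delta> < energy (step_process (D n)) \<omega>} \<le> prob (?E \<delta> n \<union> ?E' \<delta> n)"
      using E by (intro finite_measure_mono) auto
    also have "\<dots> \<le> prob (?E \<delta> n) + prob (?E' \<delta> n)" using E by (intro measure_Un_le)
    finally show ?thesis .
  qed
  have null: "prob {\<omega>\<in>space M. 3 * \<epsilon> < \<bar>X t \<omega> - X' t \<omega>\<bar>} = 0" if \<epsilon>: "\<epsilon> > 0" for \<epsilon>
  proof -
    let ?C = "{\<omega>\<in>space M. 3 * \<epsilon> < \<bar>X t \<omega> - X' t \<omega>\<bar>}"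
    have le: "prob ?C \<le> prob (?A \<epsilon> n) + prob (?A' \<epsilon> n) + (\<delta> / \<epsilon>\<^sup>2 + (prob (?E \<delta> n) + prob (?E' \<delta> n)))"
      if \<delta>: "\<delta> > 0" for \<delta> n
    proof -
      have "?C \<subseteq> ?A \<epsilon> n \<union> ?A' \<epsilon> n \<union> ?B \<epsilon> n"
      proof (rule subsetI, rule ccontr)
        fix \<omega> assume C: "\<omega> \<in> ?C" and nin: "\<omega> \<notin> ?A \<epsilon> n \<union> ?A' \<epsilon> n \<union> ?B \<epsilon> n"
        have \<omega>: "\<omega> \<in> space M" "3 * \<epsilon> < \<bar>X t \<omega> - X' t \<omega>\<bar>" using C by auto
        have "\<bar>step_integral W (L n) t \<omega> - X t \<omega>\<bar> \<le> \<epsilon>" "\<bar>step_integral W (L' n) t \<omega> - X' t \<omega>\<bar> \<le> \<epsilon>"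
          "\<bar>step_integral W (D n) t \<omega>\<bar> \<le> \<epsilon>" using nin \<omega>(1) t by (auto simp: not_less)
        moreover have "step_integral W (D n) t \<omega> = step_integral W (L n) t \<omega> - step_integral W (L' n) t \<omega>"
          by (simp add: D_def step_integral_append step_integral_neg)
        ultimately show False using \<omega>(2) by linarith
      qed
      then have "prob ?C \<le> prob (?A \<epsilon> n \<union> ?A' \<epsilon> n \<union> ?B \<epsilon> n)"
        using A B by (intro finite_measure_mono sets.Un) 
      also have "\<dots> \<le> prob (?A \<epsilon> n \<union> ?A' \<epsilon> n) + prob (?B \<epsilon> n)" using A B by (intro measure_Un_le sets.Un)
      also have "prob (?A \<epsilon> n \<union> ?A' \<epsilon> n) \<le> prob (?A \<epsilon> n) + prob (?A' \<epsilon> n)" using A by (intro measure_Un_le)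
      also have "prob (?B \<epsilon> n) \<le> \<delta> / \<epsilon>\<^sup>2 + prob {\<omega>\<in>space M. ennreal \<delta> < energy (step_process (D n)) \<omega>}"
        using \<delta> by (intro maximal_inequality[OF D \<epsilon>]) simp
      also note energy_D[OF \<delta>, of n]
      finally show ?thesis by simp
    qed
    \<comment> \<open>The left side does not depend on \<open>n\<close>: let \<open>n\<close> tend
      to infinity with \<delta> fixed, and only afterwards shrink \<delta>, with \<delta> = d
      \<epsilon>^2 for a given d > 0.\<close>
    have "prob ?C \<le> \<delta> / \<epsilon>\<^sup>2" if \<delta>: "\<delta> > 0" for \<delta>
    proof (rule LIMSEQ_le_const)
      have "\<delta> / 4 > 0" using \<delta> by simp
      then have "(\<lambda>n. prob (?E \<delta> n)) \<longlonglongrightarrow> 0" "(\<lambda>n. prob (?E' \<delta> n)) \<longlonglongrightarrow> 0"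
        using e e' unfolding null_in_probability_def by blast+
      then have "(\<lambda>n. prob (?A \<epsilon> n) + prob (?A' \<epsilon> n) + (\<delta> / \<epsilon>\<^sup>2 + (prob (?E \<delta> n) + prob (?E' \<delta> n))))
        \<longlonglongrightarrow> 0 + 0 + (\<delta> / \<epsilon>\<^sup>2 + (0 + 0))"
        using p[OF \<epsilon>] p'[OF \<epsilon>] by (intro tendsto_add tendsto_const)
      then show "(\<lambda>n. prob (?A \<epsilon> n) + prob (?A' \<epsilon> n) + (\<delta> / \<epsilon>\<^sup>2 + (prob (?E \<delta> n) + prob (?E' \<delta> n)))) \<longlonglongrightarrow> \<delta> / \<epsilon>\<^sup>2"
        by simp
    qed (use le[OF \<delta>] in blast)
    then have "prob ?C \<le> 0 + d" if "d > 0" for d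
      using that \<epsilon> by (metis (no_types, lifting) add_0 mult_pos_pos nonzero_eq_divide_eq zero_less_power less_irrefl)
    then have "prob ?C \<le> 0" by (rule field_le_epsilon)
    then show ?thesis using measure_nonneg[of M ?C] by linarith
  qed
  have "AE \<omega> in M. \<bar>X t \<omega> - X' t \<omega>\<bar> \<le> 3 * (1 / real (Suc k))" for k
  proof -
    have "{\<omega>\<in>space M. 3 * (1 / real (Suc k)) < \<bar>X t \<omega> - X' t \<omega>\<bar>} \<in> null_sets M"
      using null[of "1 / real (Suc k)"] by (intro null_setsI) (auto simp: emeasure_eq_measure)
    then show ?thesis by (rule AE_I') auto
  qed
  then have "AE \<omega> in M. \<forall>k. \<bar>X t \<omega> - X' t \<omega>\<bar> \<le> 3 * (1 / real (Suc k))" by (simp add: AE_all_countable)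
  then show ?thesis
  proof (rule AE_mp, intro AE_I2 impI)
    fix \<omega> assume *: "\<forall>k. \<bar>X t \<omega> - X' t \<omega>\<bar> \<le> 3 * (1 / real (Suc k))"
    have "(\<lambda>k. 3 * (1 / real (Suc k))) \<longlonglongrightarrow> 3 * 0"
      by (intro tendsto_mult_left) (rule LIMSEQ_Suc[OF lim_1_over_n])
    from LIMSEQ_le_const[OF this] * have "\<bar>X t \<omega> - X' t \<omega>\<bar> \<le> 3 * 0" by blast
    then show "X t \<omega> = X' t \<omega>" by simp
  qed
qed

text \<open>Testing the coordinate process with a real \<open>y\<close> is testing the vector
  process with \<open>y *\<^sub>R x\<close>, and by Cauchy-Schwarz the uniform distance grows at
  most by the factor \<open>norm x\<close>.\<close>

lemma has_stochastic_integral_inner: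
  fixes \<phi> X :: "real \<Rightarrow> 'w \<Rightarrow> 'e::real_inner"
  assumes "has_stochastic_integral M F W \<phi> X"
  shows "has_stochastic_integral M F W (\<lambda>t \<omega>. \<phi> t \<omega> \<bullet> x) (\<lambda>t \<omega>. X t \<omega> \<bullet> x)"
proof -
  have h: "strongly_measurable_process M \<phi>" "strongly_adapted F \<phi>" "weakly_in_Lp M 0 \<phi>" "continuous_process M X"
    using assms unfolding has_stochastic_integral_def by auto
  obtain L where L: "\<forall>n. adapted_step F (L n)"
    and e: "\<forall>x. null_in_probability M
           (\<lambda>n \<omega>. \<integral>\<^sup>+t\<in>{0..1}. ennreal (\<bar>step_process (L n) t \<omega> \<bullet> x - \<phi> t \<omega> \<bullet> x\<bar>\<^sup>2) \<partial>lborel)"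
    and sup: "null_in_probability M
           (\<lambda>n \<omega>. SUP t\<in>{0..1}. ennreal (norm (step_integral W (L n) t \<omega> - X t \<omega>)))"
    using assms unfolding has_stochastic_integral_def by blast
  let ?D = "\<lambda>n t \<omega>. norm (step_integral W (inner_step x (L n)) t \<omega> - X t \<omega> \<bullet> x)"
  have "strongly_adapted F (\<lambda>t \<omega>. \<phi> t \<omega> \<bullet> x)"
    using h(2) strongly_measurable_inner unfolding strongly_adapted_def strongly_measurable_real by blast
  moreover have "weakly_in_Lp M 0 (\<lambda>t \<omega>. \<phi> t \<omega> \<bullet> x)"
    unfolding weakly_in_Lp_def
  proof (intro allI conjI)
    fix y :: real
    have "AE \<omega> in M. (\<integral>\<^sup>+t\<in>{0..1}. ennreal (\<bar>\<phi> t \<omega> \<bullet> (y *\<^sub>R x)\<bar>\<^sup>2) \<partial>lborel) < \<infinity>"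
      using h(3) unfolding weakly_in_Lp_def by blast
    then show "AE \<omega> in M. (\<integral>\<^sup>+t\<in>{0..1}. ennreal (\<bar>(\<phi> t \<omega> \<bullet> x) \<bullet> y\<bar>\<^sup>2) \<partial>lborel) < \<infinity>"
      by (simp add: mult.commute)
  qed simp
  moreover have "continuous_process M (\<lambda>t \<omega>. X t \<omega> \<bullet> x)"
    using h(4) unfolding continuous_process_def strongly_measurable_real
    by (auto intro!: continuous_intros strongly_measurable_inner)
  moreover have "\<forall>n. adapted_step F (inner_step x (L n))" using L adapted_step_inner_step by blast
  moreover have "\<forall>y. null_in_probability M (\<lambda>n \<omega>. \<integral>\<^sup>+t\<in>{0..1}.
      ennreal (\<bar>step_process (inner_step x (L n)) t \<omega> \<bullet> y - (\<phi> t \<omega> \<bullet> x) \<bullet> y\<bar>\<^sup>2) \<partial>lborel)"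
  proof
    show "null_in_probability M (\<lambda>n \<omega>. \<integral>\<^sup>+t\<in>{0..1}.
      ennreal (\<bar>step_process (inner_step x (L n)) t \<omega> \<bullet> y - (\<phi> t \<omega> \<bullet> x) \<bullet> y\<bar>\<^sup>2) \<partial>lborel)" for y
      using e[rule_format, of "y *\<^sub>R x"] by (simp add: step_process_inner_step mult.commute)
  qed
  moreover have "null_in_probability M (\<lambda>n \<omega>. SUP t\<in>{0..1}.
      ennreal (?D n t \<omega>))"
    unfolding null_in_probability_def
  proof (intro allI impI)
    fix \<epsilon> :: real assume \<epsilon>: "\<epsilon> > 0"
    \<comment> \<open>One is added so that division is possible for x = 0.\<close>
    let ?c = "norm x + 1"
    have c: "?c > 0" by (simp add: add_nonneg_pos)
    have sub: "{\<omega>\<in>space M. ennreal \<epsilon> < (SUP t\<in>{0..1}. ennreal (?D n t \<omega>))}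
       \<subseteq> {\<omega>\<in>space M. \<exists>t\<in>{0..1}. \<epsilon> / ?c < norm (step_integral W (L n) t \<omega> - X t \<omega>)}" for n
    proof safe
      fix \<omega> assume "\<omega> \<in> space M" "ennreal \<epsilon> < (SUP t\<in>{0..1}. ennreal (?D n t \<omega>))"
      then obtain t where t: "t \<in> {0..1}" "\<epsilon> < \<bar>(step_integral W (L n) t \<omega> - X t \<omega>) \<bullet> x\<bar>"
        using \<epsilon> by (auto simp: less_SUP_ennreal_iff step_integral_inner_step inner_diff_left)
      note t(2)
      also have "\<dots> \<le> norm (step_integral W (L n) t \<omega> - X t \<omega>) * norm x" by (rule Cauchy_Schwarz_ineq2)
      also have "\<dots> \<le> norm (step_integral W (L n) t \<omega> - X t \<omega>) * ?c" by (intro mult_left_mono) auto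
      finally have "\<epsilon> / ?c < norm (step_integral W (L n) t \<omega> - X t \<omega>)" using c by (simp add: divide_less_eq)
      then show "\<exists>t\<in>{0..1}. \<epsilon> / ?c < norm (step_integral W (L n) t \<omega> - X t \<omega>)" using t(1) by blast
    qed
    have "(\<lambda>n. prob {\<omega>\<in>space M. \<exists>t\<in>{0..1}. \<epsilon> / ?c < norm (step_integral W (L n) t \<omega> - X t \<omega>)}) \<longlonglongrightarrow> 0"
    proof -
      have "\<epsilon> / ?c > 0" using \<epsilon> c by simp
      then have "(\<lambda>n. prob {\<omega>\<in>space M. ennreal (\<epsilon> / ?c) < (SUP t\<in>{0..1}. ennreal (norm (step_integral W (L n) t \<omega> - X t \<omega>)))}) \<longlonglongrightarrow> 0"
        using sup unfolding null_in_probability_def by blast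
      then show ?thesis using \<open>\<epsilon> / ?c > 0\<close> by (simp only: less_SUP_ennreal_iff less_imp_le)
    qed
    then show "(\<lambda>n. prob {\<omega>\<in>space M. ennreal \<epsilon> <
        (SUP t\<in>{0..1}. ennreal (?D n t \<omega>))}) \<longlonglongrightarrow> 0"
      by (rule prob_tendsto_0_mono[OF sub integral_exceedance_measurable[OF L[rule_format] h(4)]])
  qed
  ultimately show ?thesis
    unfolding has_stochastic_integral_def using strongly_measurable_process_inner[OF h(1), of x]
    by - ((rule conjI, assumption)+, rule exI[of _ "\<lambda>n. inner_step x (L n)"], (rule conjI, assumption)+, assumption)
qed

end

section \<open>The damped walk\<close>

lemma abs_add_powr_le:
  fixes a b p :: real
  assumes p: "0 < p" "p \<le> 1"
  shows "\<bar>a + b\<bar> powr p \<le> \<bar>a\<bar> powr p + \<bar>b\<bar> powr p"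
proof (cases "a = 0 \<and> b = 0")
  case False
  define s where "s = \<bar>a\<bar> + \<bar>b\<bar>"
  have s: "s > 0" using False unfolding s_def by linarith
  \<comment> \<open>After division by |a| + |b| both terms lie between 0 and 1, where a power of
    order at most one can only increase them; and they add up to 1.\<close>
  have le: "c / s \<le> (c / s) powr p" if "0 \<le> c" "c \<le> s" for c
  proof (cases "c = 0")
    case False
    then have "c / s > 0" "c / s \<le> 1" using that s by auto
    then have "(c / s) powr 1 \<le> (c / s) powr p" using p by (intro powr_mono') auto
    then show ?thesis using that s by simp
  qed simp
  have "1 = \<bar>a\<bar> / s + \<bar>b\<bar> / s" using s unfolding s_def by (simp add: add_divide_distrib[symmetric])
  also have "\<dots> \<le> (\<bar>a\<bar> / s) powr p + (\<bar>b\<bar> / s) powr p" by (intro add_mono le) (auto simp: s_def)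
  also have "\<dots> = (\<bar>a\<bar> powr p + \<bar>b\<bar> powr p) / s powr p" using s by (simp add: powr_divide add_divide_distrib)
  finally have "s powr p \<le> \<bar>a\<bar> powr p + \<bar>b\<bar> powr p" using s by (simp add: field_simps)
  moreover have "\<bar>a + b\<bar> powr p \<le> s powr p" using p unfolding s_def by (intro powr_mono2) auto
  ultimately show ?thesis by linarith
qed simp

lemma abs_powr_le_1_plus_square:
  fixes u p :: real
  assumes "0 < p" "p \<le> 1"
  shows "\<bar>u\<bar> powr p \<le> 1 + u\<^sup>2"
proof (cases "\<bar>u\<bar> \<le> 1")
  case True
  then have "\<bar>u\<bar> powr p \<le> 1 powr p" using assms by (intro powr_mono2) auto
  then show ?thesis by (simp add: add_increasing2)
next
  case False
  then have "\<bar>u\<bar> powr p \<le> \<bar>u\<bar> powr 2" using assms by (intro powr_mono) auto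
  then show ?thesis using False by simp
qed

text \<open>A substitute for Jensen's inequality: with \<open>s\<close> of the size of the root mean
  square of \<open>b\<close>, a second moment bound turns into a bound of order s^p for the moment
  of order p.\<close>

lemma abs_powr_le_scaled_square:
  fixes b s p :: real
  assumes p: "0 < p" "p \<le> 1" and s: "0 < s"
  shows "\<bar>b\<bar> powr p \<le> s powr p * (1 + b\<^sup>2 / s\<^sup>2)"
proof -
  have "\<bar>b\<bar> powr p = s powr p * \<bar>b / s\<bar> powr p"
    using s by (simp add: powr_mult[symmetric])
  also have "\<dots> \<le> s powr p * (1 + (b / s)\<^sup>2)"
    by (intro mult_left_mono abs_powr_le_1_plus_square p) auto
  finally show ?thesis by (simp add: power_divide)
qed

text \<open>The weight (j + 1)^2 grows by a factor of about 1 + 2/j per step, which the contraction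
  eventually outweighs. The weighted sequence then grows by summable amounts only, so it is bounded.
  The square is taken because its reciprocal is summable.\<close>

lemma contracting_recursion_bound:
  fixes u \<rho> :: "nat \<Rightarrow> real"
  assumes u: "\<And>j. 0 \<le> u j" and rec: "\<And>j. u (Suc j) \<le> \<rho> j * u j + C * r ^ j"
    and \<rho>: "\<forall>\<^sub>F j in sequentially. \<rho> j \<le> 1 - \<kappa> / sqrt (real j + 1)"
    and \<kappa>: "0 < \<kappa>" and C: "0 \<le> C" and r: "0 < r" "r < 1"
  shows "\<exists>B. \<forall>j. u j \<le> B / (real j + 1)\<^sup>2"
proof -
  have "\<forall>\<^sub>F j in sequentially. 3 / \<kappa> \<le> sqrt (real j + 1)"
    by real_asymp
  then have "\<forall>\<^sub>F j in sequentially. (1 - \<kappa> / sqrt (real j + 1)) * (real j + 2)\<^sup>2 \<le> (real j + 1)\<^sup>2"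
  proof (rule eventually_mono)
    \<comment> \<open>With n = j + 1 and m = sqrt n, the growth (n + 1)^2 - n^2 = 2 n + 1 is at most
      3 n, and 3 <= \<kappa> m makes the gain \<kappa> n^2 / m at least 3 n.\<close>
    fix j assume j: "3 / \<kappa> \<le> sqrt (real j + 1)"
    define n where "n = real j + 1"
    have n: "n \<ge> 1" unfolding n_def by simp
    define m where "m = sqrt n"
    have m: "m > 0" "n = m\<^sup>2" using n unfolding m_def by auto
    have "3 \<le> \<kappa> * m" using j \<kappa> unfolding m_def n_def by (simp add: divide_le_eq mult.commute)
    then have "3 * n \<le> \<kappa> * m * n" using n by (intro mult_right_mono) auto
    also have "\<dots> = \<kappa> / m * n\<^sup>2" 
    proof -
      have "\<kappa> / m * n\<^sup>2 = \<kappa> / m * (m * m * n)" unfolding m(2) by (simp only: power2_eq_square)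
      also have "\<dots> = \<kappa> * m * n" using m(1) by simp
      finally show ?thesis ..
    qed
    also have "\<dots> \<le> \<kappa> / m * (n + 1)\<^sup>2" using n m(1) \<kappa> by (intro mult_left_mono power_mono) auto
    finally have ge: "3 * n \<le> \<kappa> / m * (n + 1)\<^sup>2" .
    have "(1 - \<kappa> / m) * (n + 1)\<^sup>2 = (n + 1)\<^sup>2 - \<kappa> / m * (n + 1)\<^sup>2" by (simp add: left_diff_distrib)
    also have "\<dots> \<le> (n + 1)\<^sup>2 - 3 * n" using ge by linarith
    also have "\<dots> \<le> n\<^sup>2" using n by (simp add: power2_eq_square algebra_simps)
    finally have "(1 - \<kappa> / m) * (n + 1)\<^sup>2 \<le> n\<^sup>2" .
    moreover have "real j + 2 = n + 1" unfolding n_def by simp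
    ultimately show "(1 - \<kappa> / sqrt (real j + 1)) * (real j + 2)\<^sup>2 \<le> (real j + 1)\<^sup>2"
      unfolding m_def n_def by (simp only:)
  qed
  with \<rho> have "\<forall>\<^sub>F j in sequentially. \<rho> j \<le> 1 - \<kappa> / sqrt (real j + 1) \<and>
      (1 - \<kappa> / sqrt (real j + 1)) * (real j + 2)\<^sup>2 \<le> (real j + 1)\<^sup>2"
    by (rule eventually_conj)
  then obtain J where J: "\<And>j. j \<ge> J \<Longrightarrow> \<rho> j \<le> 1 - \<kappa> / sqrt (real j + 1)"
     "\<And>j. j \<ge> J \<Longrightarrow> (1 - \<kappa> / sqrt (real j + 1)) * (real j + 2)\<^sup>2 \<le> (real j + 1)\<^sup>2"
    unfolding eventually_sequentially by blast
  define z where "z j = (real j + 1)\<^sup>2 * u j" for j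
  define w where "w j = C * ((real j + 2)\<^sup>2 * r ^ j)" for j
  have z0: "z j \<ge> 0" and w0: "w j \<ge> 0" for j using u C r unfolding z_def w_def by auto
  have "summable (\<lambda>j. (real j + 2)\<^sup>2 * r ^ j)"
  proof (rule summable_comparison_test_ev)
    \<comment> \<open>Halfway between r and 1, so that the geometric gap absorbs the polynomial
      weight.\<close>
    define q where "q = (1 + r) / 2"
    have q: "r < q" "q < 1" "0 < q" using r unfolding q_def by auto
    show "summable (\<lambda>j. q ^ j)" using q by (intro summable_geometric) auto
    show "\<forall>\<^sub>F j in sequentially. norm ((real j + 2)\<^sup>2 * r ^ j) \<le> q ^ j"
    proof -
      have "\<forall>\<^sub>F j in sequentially. (real j + 2)\<^sup>2 * r ^ j \<le> q ^ j" using q r by real_asymp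
      then show ?thesis using r by (simp add: abs_mult)
    qed
  qed
  then have sw: "summable w" unfolding w_def by (rule summable_mult)
  have step: "z (Suc j) \<le> z j + w j" if "j \<ge> J" for j
  proof -
    have "z (Suc j) = (real j + 2)\<^sup>2 * u (Suc j)" unfolding z_def by (simp add: algebra_simps)
    also have "\<dots> \<le> (real j + 2)\<^sup>2 * (\<rho> j * u j + C * r ^ j)" by (intro mult_left_mono rec) auto
    also have "\<dots> \<le> (real j + 2)\<^sup>2 * ((1 - \<kappa> / sqrt (real j + 1)) * u j + C * r ^ j)"
      using u C J(1)[OF that] by (intro mult_left_mono add_mono mult_right_mono) auto
    also have "\<dots> = ((1 - \<kappa> / sqrt (real j + 1)) * (real j + 2)\<^sup>2) * u j + w j"
      unfolding w_def by (simp add: algebra_simps)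
    also have "\<dots> \<le> z j + w j" unfolding z_def using u J(2)[OF that] by (intro add_mono mult_right_mono) auto
    finally show ?thesis .
  qed
  have "z (J + n) \<le> z J + (\<Sum>i<n. w (J + i))" for n
  proof (induction n)
    case (Suc n)
    then show ?case using step[of "J + n"] by simp
  qed simp
  moreover have "(\<Sum>i<n. w (J + i)) \<le> suminf w" for n
  proof -
    have "(\<Sum>i<n. w (J + i)) = sum w ((\<lambda>i. J + i) ` {..<n})" by (simp add: sum.reindex)
    also have "\<dots> \<le> suminf w" using w0 sw by (intro sum_le_suminf) auto
    finally show ?thesis .
  qed
  ultimately have late: "z (J + n) \<le> z J + suminf w" for n by (meson add_left_mono order_trans)
  have sw0: "suminf w \<ge> 0" using w0 sw by (intro suminf_nonneg)
  define B where "B = (\<Sum>i\<le>J. z i) + suminf w"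
  have "z j \<le> B" for j
  proof (cases "j \<le> J")
    case True
    then have "z j \<le> (\<Sum>i\<le>J. z i)" using z0 by (intro member_le_sum) auto
    then show ?thesis unfolding B_def using sw0 by simp
  next
    case False
    then have "z j \<le> z J + suminf w" using late[of "j - J"] by simp
    also have "z J \<le> (\<Sum>i\<le>J. z i)" using z0 by (intro member_le_sum) auto
    finally show ?thesis unfolding B_def by simp
  qed
  then show ?thesis unfolding z_def by (intro exI[of _ B] allI) (simp add: field_simps)
qed

text \<open>Tonelli for the joint law, a product by independence. Stated for nonnegative integrals,
  it can be used before any moment is known to be finite.\<close>

lemma (in prob_space) nn_integral_indep_mult:
  assumes ind: "indep_var borel X borel Y"
    and [measurable]: "f \<in> borel_measurable borel" "h \<in> borel_measurable borel"
  shows "(\<integral>\<^sup>+\<omega>. f (X \<omega>) * h (Y \<omega>) \<partial>M) = (\<integral>\<^sup>+\<omega>. f (X \<omega>) \<partial>M) * (\<integral>\<^sup>+\<omega>. h (Y \<omega>) \<partial>M)"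
proof -
  have [measurable]: "X \<in> borel_measurable M" "Y \<in> borel_measurable M"
    and eq: "distr M borel X \<Otimes>\<^sub>M distr M borel Y = distr M (borel \<Otimes>\<^sub>M borel) (\<lambda>x. (X x, Y x))"
    using ind unfolding indep_var_distribution_eq by auto
  interpret Y: prob_space "distr M borel Y" by (rule prob_space_distr) measurable
  have "(\<integral>\<^sup>+\<omega>. f (X \<omega>) * h (Y \<omega>) \<partial>M) = (\<integral>\<^sup>+p. f (fst p) * h (snd p) \<partial>distr M (borel \<Otimes>\<^sub>M borel) (\<lambda>x. (X x, Y x)))"
    by (subst nn_integral_distr) auto
  also have "\<dots> = (\<integral>\<^sup>+x. \<integral>\<^sup>+y. f x * h y \<partial>distr M borel Y \<partial>distr M borel X)"
    unfolding eq[symmetric] by (subst Y.nn_integral_fst[symmetric]) auto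
  also have "\<dots> = (\<integral>\<^sup>+x. f x * (\<integral>\<^sup>+y. h y \<partial>distr M borel Y) \<partial>distr M borel X)"
    by (intro nn_integral_cong nn_integral_cmult) auto
  also have "\<dots> = (\<integral>\<^sup>+x. f x \<partial>distr M borel X) * (\<integral>\<^sup>+y. h y \<partial>distr M borel Y)"
    by (rule nn_integral_multc) auto
  finally show ?thesis by (simp add: nn_integral_distr)
qed

text \<open>Bessel's inequality: for the projection \<open>y\<close> of \<open>x\<close> onto the
  first n vectors, both \<open>x \<bullet> y\<close> and \<open>y \<bullet> y\<close> equal the
  partial sum, and x - y has nonnegative square norm.\<close>

lemma bessel_ennreal:
  fixes e :: "nat \<Rightarrow> 'e::real_inner"
  assumes "\<And>i j. e i \<bullet> e j = (if i = j then 1 else 0)"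
  shows "(\<Sum>k. ennreal ((e k \<bullet> x)\<^sup>2)) \<le> ennreal ((norm x)\<^sup>2)"
proof -
  have fin: "(\<Sum>k<n. (e k \<bullet> x)\<^sup>2) \<le> (norm x)\<^sup>2" for n
  proof -
    define y where "y = (\<Sum>k<n. (e k \<bullet> x) *\<^sub>R e k)"
    have xy: "x \<bullet> y = (\<Sum>k<n. (e k \<bullet> x)\<^sup>2)"
      unfolding y_def inner_sum_right by (simp add: power2_eq_square inner_commute)
    have "e i \<bullet> y = e i \<bullet> x" if "i < n" for i
    proof -
      have "e i \<bullet> y = (\<Sum>k<n. if k = i then e i \<bullet> x else 0)"
        unfolding y_def inner_sum_right by (intro sum.cong) (auto simp: assms)
      then show ?thesis using that by simp
    qed
    then have "y \<bullet> y = (\<Sum>k<n. (e k \<bullet> x)\<^sup>2)"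
      unfolding y_def[of] inner_sum_left by (simp add: power2_eq_square)
    moreover have "0 \<le> (x - y) \<bullet> (x - y)" by simp
    ultimately show ?thesis using xy by (simp add: inner_diff_left inner_diff_right inner_commute power2_norm_eq_inner)
  qed
  show ?thesis
  proof (rule suminf_le_const)
    show "(\<Sum>k<n. ennreal ((e k \<bullet> x)\<^sup>2)) \<le> ennreal ((norm x)\<^sup>2)" for n
      using fin[of n] by (subst sum_ennreal) (auto intro: ennreal_leI)
  qed simp
qed

section \<open>The construction: grid, noise, random directions and walk\<close>

locale weak_example = brownian M F W
  for M :: "'w measure" and F :: "real \<Rightarrow> 'w measure" and W :: "real \<Rightarrow> 'w \<Rightarrow> real" +
  fixes e :: "nat \<Rightarrow> 'e::real_inner"
  assumes orthonormal: "e i \<bullet> e j = (if i = j then 1 else 0)"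
begin

text \<open>The grid starts at 1/2, so that \<open>W (grid j) - W 0\<close> has variance at least
  1/2 for every \<open>j\<close>, and it accumulates at 1.\<close>

definition grid :: "nat \<Rightarrow> real" where "grid j = 1 - (1/2) ^ Suc j"

text \<open>Inverse square root of the cell length 2^(-j-2); it normalises both the increment of
  \<open>W\<close> and the square integral over a cell.\<close>

definition scale :: "nat \<Rightarrow> real" where "scale j = sqrt (2 ^ (j + 2))"

definition damping :: "nat \<Rightarrow> real" where "damping j = 1 / sqrt (sqrt (real j + 1))"

definition noise :: "nat \<Rightarrow> 'w \<Rightarrow> real" where
  "noise j \<omega> = scale j * (W (grid (Suc j)) \<omega> - W (grid j) \<omega>)"

text \<open>The component \<open>j\<close> of the encoded pair keeps the directions of different
  steps apart; the floor records the position of the increment up to 2^(-j). \<open>W 0\<close> is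
  subtracted because it vanishes only almost surely, and because a Brownian motion is specified
  through its increments.\<close>

definition direction :: "nat \<Rightarrow> 'w \<Rightarrow> nat" where
  "direction j \<omega> = prod_encode (j, int_encode \<lfloor>2 ^ j * (W (grid j) \<omega> - W 0 \<omega>)\<rfloor>)"

primrec walk :: "nat \<Rightarrow> 'w \<Rightarrow> 'e" where
  "walk 0 \<omega> = 0"
| "walk (Suc j) \<omega> = walk j \<omega> + noise j \<omega> *\<^sub>R (damping j *\<^sub>R walk j \<omega> + e (direction j \<omega>))"

definition integrand :: "nat \<Rightarrow> 'w \<Rightarrow> 'e" where
  "integrand j \<omega> = damping j *\<^sub>R walk j \<omega> + e (direction j \<omega>)"

lemma walk_Suc: "walk (Suc j) \<omega> = walk j \<omega> + noise j \<omega> *\<^sub>R integrand j \<omega>"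
  by (simp add: integrand_def)

lemma grid_bounds: "1 / 2 \<le> grid j" "0 \<le> grid j" "grid j < 1" "grid j < grid (Suc j)"
proof -
  have "(1/2) ^ j \<le> (1::real)" by (rule power_le_one) auto
  then show "1 / 2 \<le> grid j" by (simp add: grid_def)
  then show "0 \<le> grid j" by simp
  show "grid j < 1" "grid j < grid (Suc j)" by (simp_all add: grid_def)
qed

lemma grid_mono: "i \<le> j \<Longrightarrow> grid i \<le> grid j"
  by (rule lift_Suc_mono_le[of grid]) (auto intro: less_imp_le grid_bounds)

lemma grid_tendsto: "grid \<longlonglongrightarrow> 1"
proof -
  have "(\<lambda>j. (1/2) ^ Suc j) \<longlonglongrightarrow> (0::real)" by (intro LIMSEQ_Suc LIMSEQ_power_zero) simp
  from tendsto_diff[OF tendsto_const[of 1] this] show ?thesis unfolding grid_def[abs_def] by simp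
qed

lemma grid_diff: "grid (Suc j) - grid j = 1 / 2 ^ (j + 2)"
  by (simp add: grid_def power_divide)

lemma scale_square: "(scale j)\<^sup>2 * (grid (Suc j) - grid j) = 1"
  by (simp add: grid_diff scale_def)

lemma damping_bounds: "0 < damping j" "damping j \<le> 1"
  by (auto simp: damping_def)

lemma damping_square: "(damping j)\<^sup>2 = 1 / sqrt (real j + 1)"
  by (simp add: damping_def power_divide)

lemma damping_tendsto: "damping \<longlonglongrightarrow> 0"
  unfolding damping_def[abs_def] by real_asymp

lemma W_grid_adapted: "i \<le> j \<Longrightarrow> W (grid i) \<in> borel_measurable (F (grid j))"
  by (intro W_adapted grid_bounds grid_mono)

lemma noise_adapted: "i < j \<Longrightarrow> noise i \<in> borel_measurable (F (grid j))"
  unfolding noise_def[abs_def] by (intro borel_measurable_times borel_measurable_diff W_grid_adapted) auto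

lemma noise_measurable: "noise j \<in> borel_measurable M"
  using measurable_F_imp[OF grid_bounds(2) noise_adapted[of j "Suc j"]] by simp

lemma direction_adapted: "direction j \<in> measurable (F (grid j)) (count_space UNIV)"
proof -
  have [measurable]: "W (grid j) \<in> borel_measurable (F (grid j))" "W 0 \<in> borel_measurable (F (grid j))"
    using grid_bounds by (auto intro: W_adapted)
  have "(\<lambda>\<omega>. \<lfloor>2 ^ j * (W (grid j) \<omega> - W 0 \<omega>)\<rfloor>) \<in> measurable (F (grid j)) (count_space UNIV)" by measurable
  then show ?thesis
    unfolding direction_def[abs_def] by (rule measurable_compose) simp
qed

lemma walk_adapted: "strongly_measurable (F (grid j)) (walk j)"
proof (induction j)
  case 0
  then show ?case by (simp add: walk.simps(1)[abs_def] strongly_measurable_const)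
next
  case (Suc j)
  have id: "(\<lambda>\<omega>. \<omega>) \<in> measurable (F (grid (Suc j))) (F (grid j))"
    using grid_bounds[of j] by (intro id_measurable_F_mono) auto
  have "strongly_measurable (F (grid (Suc j))) (\<lambda>\<omega>. walk j \<omega>)"
    by (rule strongly_measurable_compose[OF id Suc])
  moreover have "strongly_measurable (F (grid (Suc j))) (\<lambda>\<omega>. e (direction j \<omega>))"
    by (rule strongly_measurable_compose[OF id strongly_measurable_countable_valued[OF direction_adapted]])
  ultimately show ?case
    unfolding walk.simps(2)[abs_def]
    by (intro strongly_measurable_add strongly_measurable_scaleR noise_adapted borel_measurable_const) auto
qed

lemma integrand_adapted: "strongly_measurable (F (grid j)) (integrand j)"
  unfolding integrand_def[abs_def]
  by (intro strongly_measurable_add strongly_measurable_scaleR borel_measurable_const walk_adapted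
      strongly_measurable_countable_valued direction_adapted)

lemma walk_inner_measurable: "(\<lambda>\<omega>. walk j \<omega> \<bullet> x) \<in> borel_measurable M"
  using measurable_F_imp[OF grid_bounds(2) strongly_measurable_inner[OF walk_adapted]] .

lemma integrand_inner_measurable: "(\<lambda>\<omega>. integrand j \<omega> \<bullet> x) \<in> borel_measurable M"
  using measurable_F_imp[OF grid_bounds(2) strongly_measurable_inner[OF integrand_adapted]] .

lemma direction_inner_adapted: "(\<lambda>\<omega>. e (direction j \<omega>) \<bullet> x) \<in> borel_measurable (F (grid j))"
  by (rule strongly_measurable_inner[OF strongly_measurable_countable_valued[OF direction_adapted]])

text \<open>Up to step \<open>j\<close> the walk is a combination of vectors whose encoded first
  component is below \<open>j\<close>.\<close>

lemma walk_orthogonal_later_direction: "i \<ge> j \<Longrightarrow> walk j \<omega> \<bullet> e (prod_encode (i, k)) = 0"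
proof (induction j)
  case (Suc j)
  then show ?case by (simp add: inner_add_left orthonormal direction_def)
qed simp

text \<open>The damped walk has no component along the fresh direction, so this coordinate is
  exactly 1 on every path. It yields the infinite norm and, later, reads off the noise from a single
  coordinate.\<close>

lemma integrand_inner_direction: "integrand j \<omega> \<bullet> e (direction j \<omega>) = 1"
proof -
  have "walk j \<omega> \<bullet> e (direction j \<omega>) = 0" unfolding direction_def by (rule walk_orthogonal_later_direction) simp
  then show ?thesis unfolding integrand_def by (simp add: inner_add_left orthonormal)
qed

lemma norm_integrand_ge: "1 \<le> norm (integrand j \<omega>)"
proof -
  have "norm (e (direction j \<omega>)) = 1" by (simp add: norm_eq_1 orthonormal)
  then show ?thesis
    using Cauchy_Schwarz_ineq2[of "integrand j \<omega>" "e (direction j \<omega>)"] by (simp add: integrand_inner_direction)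
qed

section \<open>Law of the noise, and size of a coordinate of the random direction\<close>

lemma noise_indep:
  assumes "f \<in> borel_measurable (F (grid j))"
  shows "indep_var borel f borel (noise j)"
proof -
  have "indep_var borel ((\<lambda>x. x) \<circ> f) borel ((\<lambda>x. scale j * x) \<circ> (\<lambda>\<omega>. W (grid (Suc j)) \<omega> - W (grid j) \<omega>))"
    by (rule indep_var_compose[OF indep_increment[OF grid_bounds(2,4) assms]]) measurable
  then show ?thesis by (simp add: comp_def noise_def[abs_def])
qed

lemma noise_distributed: "distributed M lborel (noise j) std_normal_density"
proof -
  have pos: "0 < sqrt (grid (Suc j) - grid j)" using grid_bounds(4)[of j] by simp
  have sc: "scale j = 1 / sqrt (grid (Suc j) - grid j)" by (simp add: grid_diff scale_def real_sqrt_divide)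
  have "(\<lambda>\<omega>. (W (grid (Suc j)) \<omega> - W (grid j) \<omega> - 0) / sqrt (grid (Suc j) - grid j)) = noise j"
    unfolding noise_def[abs_def] sc by simp
  then show ?thesis
    using increment_distributed[OF grid_bounds(2,4), of j, unfolded normal_standard_normal_convert[OF pos]]
    by (simp only:)
qed

lemma nn_integral_noise:
  assumes "h \<in> borel_measurable borel"
  shows "(\<integral>\<^sup>+\<omega>. h (noise j \<omega>) \<partial>M) = (\<integral>\<^sup>+z. ennreal (std_normal_density z) * h z \<partial>lborel)"
  using distributed_nn_integral[OF noise_distributed, of h] assms by simp

lemma nn_integral_noise_quadratic:
  "(\<integral>\<^sup>+\<omega>. ennreal (1 + (b + c * noise j \<omega>)\<^sup>2) \<partial>M) = ennreal (1 + b\<^sup>2 + c\<^sup>2)"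
proof -
  have "has_bochner_integral lborel (\<lambda>z. (1 + b\<^sup>2) * (std_normal_density z * z ^ 0) +
      (2 * b * c) * (std_normal_density z * z ^ 1) + c\<^sup>2 * (std_normal_density z * z ^ 2))
      ((1 + b\<^sup>2) * 1 + (2 * b * c) * 0 + c\<^sup>2 * 1)"
    by (intro has_bochner_integral_add has_bochner_integral_mult_right std_normal_moments)
  also have "(\<lambda>z. (1 + b\<^sup>2) * (std_normal_density z * z ^ 0) +
      (2 * b * c) * (std_normal_density z * z ^ 1) + c\<^sup>2 * (std_normal_density z * z ^ 2)) =
      (\<lambda>z. std_normal_density z * (1 + (b + c * z)\<^sup>2))"
    by (simp add: fun_eq_iff algebra_simps power2_eq_square)
  finally have q: "has_bochner_integral lborel (\<lambda>z. std_normal_density z * (1 + (b + c * z)\<^sup>2)) (1 + b\<^sup>2 + c\<^sup>2)"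
    by simp
  have "(\<integral>\<^sup>+\<omega>. ennreal (1 + (b + c * noise j \<omega>)\<^sup>2) \<partial>M) =
      (\<integral>\<^sup>+z. ennreal (std_normal_density z) * ennreal (1 + (b + c * z)\<^sup>2) \<partial>lborel)"
    by (rule nn_integral_noise) measurable
  also have "\<dots> = (\<integral>\<^sup>+z. ennreal (std_normal_density z * (1 + (b + c * z)\<^sup>2)) \<partial>lborel)"
    by (intro nn_integral_cong ennreal_mult'[symmetric]) simp
  also have "\<dots> = ennreal (1 + b\<^sup>2 + c\<^sup>2)"
    using q by (simp add: nn_integral_eq_integral has_bochner_integral_iff add_nonneg_nonneg)
  finally show ?thesis .
qed

text \<open>
  The random index has atoms of mass at most \<open>2\<^sup>-\<^sup>j\<close>, because the density of \<open>W (grid j) - W 0\<close> is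
  bounded by one; hence a fixed vector is almost orthogonal to the random direction.
\<close>

lemma direction_second_moment:
  "(\<integral>\<^sup>+\<omega>. ennreal ((e (direction j \<omega>) \<bullet> x)\<^sup>2) \<partial>M) \<le> ennreal ((norm x)\<^sup>2 / 2 ^ j)"
proof -
  let ?U = "\<lambda>\<omega>. W (grid j) \<omega> - W 0 \<omega>"
  let ?c = "\<lambda>k. ennreal ((e (prod_encode (j, k)) \<bullet> x)\<^sup>2)"
  let ?A = "\<lambda>k. {\<omega>\<in>space M. int_encode \<lfloor>2 ^ j * ?U \<omega>\<rfloor> = k}"
  have pos: "0 < grid j" "0 < sqrt (grid j - 0)" using grid_bounds(1)[of j] by auto
  have dist: "distributed M lborel ?U (normal_density 0 (sqrt (grid j - 0)))"
    by (rule increment_distributed) (use pos in auto)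
  have [measurable]: "?U \<in> borel_measurable M" using distributed_measurable[OF dist] by simp
  \<comment> \<open>This is where the grid starting at 1/2 enters: 2 pi grid j >= 1 bounds the peak
    of the density.\<close>
  have density_le: "normal_density 0 (sqrt (grid j - 0)) u \<le> 1" for u
  proof -
    have "1 \<le> 2 * pi * grid j"
    proof -
      have "1 \<le> 2 * 1 * (1/2::real)" by simp
      also have "\<dots> \<le> 2 * pi * grid j" using grid_bounds(1)[of j] pi_ge_two by (intro mult_mono) auto
      finally show ?thesis .
    qed
    then have "1 / sqrt (2 * pi * grid j) \<le> 1" by simp
    moreover have "exp (- (u\<^sup>2 / (2 * grid j))) \<le> 1" using pos by simp
    ultimately have "1 / sqrt (2 * pi * grid j) * exp (- (u\<^sup>2 / (2 * grid j))) \<le> 1 * 1"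
      by (intro mult_mono) auto
    then show ?thesis using pos by (simp add: normal_density_def)
  qed
  \<comment> \<open>Prescribing the index prescribes the floor, which places the increment in a
    half-open interval of length 2^(-j).\<close>
  have mass: "emeasure M (?A k) \<le> ennreal (1 / 2 ^ j)" for k
  proof -
    define m where "m = int_decode k"
    let ?I = "{real_of_int m / 2 ^ j ..< (real_of_int m + 1) / 2 ^ j}"
    have iff: "int_encode \<lfloor>2 ^ j * u\<rfloor> = k \<longleftrightarrow> u \<in> ?I" for u :: real
    proof -
      have "int_encode \<lfloor>2 ^ j * u\<rfloor> = k \<longleftrightarrow> \<lfloor>2 ^ j * u\<rfloor> = m" unfolding m_def by (metis int_decode_inverse int_encode_inverse)
      also have "\<dots> \<longleftrightarrow> real_of_int m \<le> 2 ^ j * u \<and> 2 ^ j * u < real_of_int m + 1" by (rule floor_eq_iff)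
      also have "\<dots> \<longleftrightarrow> u \<in> ?I" by (simp add: field_simps)
      finally show ?thesis .
    qed
    have "emeasure M (?A k) = (\<integral>\<^sup>+\<omega>. indicator (?A k) \<omega> \<partial>M)"
      by (rule nn_integral_indicator[symmetric]) measurable
    also have "\<dots> = (\<integral>\<^sup>+\<omega>. indicator ?I (?U \<omega>) \<partial>M)"
      using iff by (intro nn_integral_cong) (simp add: indicator_def of_bool_def)
    also have "\<dots> = (\<integral>\<^sup>+u. ennreal (normal_density 0 (sqrt (grid j - 0)) u) * indicator ?I u \<partial>lborel)"
      by (rule distributed_nn_integral[OF dist, symmetric]) simp
    also have "\<dots> \<le> (\<integral>\<^sup>+u. indicator ?I u \<partial>lborel)"
      using density_le by (intro nn_integral_mono) (auto simp: indicator_def ennreal_le_1 simp del: diff_0_right)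
    also have "\<dots> = ennreal (1 / 2 ^ j)" by (simp add: divide_right_mono diff_divide_distrib[symmetric])
    finally show ?thesis .
  qed
  have "ennreal ((e (direction j \<omega>) \<bullet> x)\<^sup>2) = (\<Sum>k. ?c k * indicator (?A k) \<omega>)" if "\<omega> \<in> space M" for \<omega>
  proof -
    let ?k = "int_encode \<lfloor>2 ^ j * ?U \<omega>\<rfloor>"
    have "(\<Sum>k. ?c k * indicator (?A k) \<omega>) = (\<Sum>k\<in>{?k}. ?c k * indicator (?A k) \<omega>)"
      by (rule suminf_finite) (auto simp: indicator_def)
    then show ?thesis using that by (simp add: direction_def)
  qed
  then have "(\<integral>\<^sup>+\<omega>. ennreal ((e (direction j \<omega>) \<bullet> x)\<^sup>2) \<partial>M) = (\<integral>\<^sup>+\<omega>. (\<Sum>k. ?c k * indicator (?A k) \<omega>) \<partial>M)"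
    by (intro nn_integral_cong) auto
  also have "\<dots> = (\<Sum>k. \<integral>\<^sup>+\<omega>. ?c k * indicator (?A k) \<omega> \<partial>M)"
    by (rule nn_integral_suminf) measurable
  also have "\<dots> = (\<Sum>k. ?c k * emeasure M (?A k))"
    by (intro suminf_cong nn_integral_cmult_indicator) measurable
  also have "\<dots> \<le> (\<Sum>k. ?c k * ennreal (1 / 2 ^ j))"
    by (intro suminf_le mult_left_mono mass) auto
  also have "\<dots> = (\<Sum>k. ?c k) * ennreal (1 / 2 ^ j)" by simp
  \<comment> \<open>For fixed \<open>j\<close> the vectors indexed by \<open>k\<close> form a
    subfamily of the orthonormal sequence, by injectivity of \<open>prod_encode\<close>.\<close>
  also have "(\<Sum>k. ?c k) \<le> ennreal ((norm x)\<^sup>2)"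
    by (rule bessel_ennreal) (auto simp: orthonormal)
  also have "ennreal ((norm x)\<^sup>2) * ennreal (1 / 2 ^ j) = ennreal ((norm x)\<^sup>2 / 2 ^ j)"
    by (simp add: ennreal_mult[symmetric])
  finally show ?thesis by (simp add: mult_right_mono)
qed

end

section \<open>Comparison of sequence norms\<close>

lemma sum_powr_le:
  fixes f :: "nat \<Rightarrow> real"
  assumes "0 < q" "q \<le> 1" "\<And>i. 0 \<le> f i"
  shows "(\<Sum>i<n. f i) powr q \<le> (\<Sum>i<n. f i powr q)"
proof (induction n)
  case (Suc n)
  have "(\<Sum>i<Suc n. f i) powr q \<le> (\<Sum>i<n. f i) powr q + f n powr q"
    using abs_add_powr_le[OF assms(1,2), of "\<Sum>i<n. f i" "f n"] assms(3) by (simp add: sum_nonneg)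
  then show ?case using Suc by simp
qed simp

text \<open>Subadditivity of the power p/2 <= 1 bounds the l^2 norm by the l^p quasinorm. Finiteness
  is a separate claim because \<open>enn2real\<close> sends infinity to 0, so the second claim could
  not detect divergence.\<close>

lemma suminf_square_le:
  fixes a :: "nat \<Rightarrow> real"
  assumes p: "0 < p" "p \<le> 2"
  shows "(\<Sum>j. ennreal (\<bar>a j\<bar> powr p)) < \<infinity> \<Longrightarrow> (\<Sum>j. ennreal ((a j)\<^sup>2)) < \<infinity>"
    and "ennreal (enn2real (\<Sum>j. ennreal ((a j)\<^sup>2)) powr (p / 2)) \<le> (\<Sum>j. ennreal (\<bar>a j\<bar> powr p))"
proof -
  let ?R = "\<Sum>j. ennreal (\<bar>a j\<bar> powr p)"
  have main: "(\<Sum>j. ennreal ((a j)\<^sup>2)) \<le> ennreal (enn2real ?R powr (2 / p))" if fin: "?R < \<infinity>"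
  proof (rule suminf_le_const)
    fix n
    have "ennreal (\<Sum>j<n. \<bar>a j\<bar> powr p) = (\<Sum>j<n. ennreal (\<bar>a j\<bar> powr p))"
      by (rule sum_ennreal[symmetric]) simp
    also have "\<dots> \<le> ?R" by (rule sum_le_suminf) auto
    also have "?R = ennreal (enn2real ?R)" using fin by simp
    finally have le: "(\<Sum>j<n. \<bar>a j\<bar> powr p) \<le> enn2real ?R"
      by (subst (asm) ennreal_le_iff) auto
    have eq: "(a j)\<^sup>2 powr (p / 2) = \<bar>a j\<bar> powr p" for j
    proof (cases "a j = 0")
      case False
      then have "(a j)\<^sup>2 powr (p / 2) = (\<bar>a j\<bar> powr 2) powr (p / 2)" by simp
      also have "\<dots> = \<bar>a j\<bar> powr (2 * (p / 2))" by (rule powr_powr)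
      finally show ?thesis by simp
    qed simp
    have "(\<Sum>j<n. (a j)\<^sup>2) powr (p / 2) \<le> (\<Sum>j<n. (a j)\<^sup>2 powr (p / 2))"
      using p by (intro sum_powr_le) auto
    also have "\<dots> \<le> enn2real ?R" using le unfolding eq .
    finally have "((\<Sum>j<n. (a j)\<^sup>2) powr (p / 2)) powr (2 / p) \<le> enn2real ?R powr (2 / p)"
      using p by (intro powr_mono2) auto
    then have "(\<Sum>j<n. (a j)\<^sup>2) \<le> enn2real ?R powr (2 / p)"
      using p by (simp add: powr_powr sum_nonneg)
    then show "(\<Sum>j<n. ennreal ((a j)\<^sup>2)) \<le> ennreal (enn2real ?R powr (2 / p))"
      by (subst sum_ennreal) (auto intro: ennreal_leI)
  qed simp
  show "(\<Sum>j. ennreal ((a j)\<^sup>2)) < \<infinity>" if "?R < \<infinity>"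
    using main[OF that] by (rule order_le_less_trans) simp
  show "ennreal (enn2real (\<Sum>j. ennreal ((a j)\<^sup>2)) powr (p / 2)) \<le> ?R"
  proof (cases "?R < \<infinity>")
    case True
    have "enn2real (\<Sum>j. ennreal ((a j)\<^sup>2)) \<le> enn2real (ennreal (enn2real ?R powr (2 / p)))"
      by (rule enn2real_mono[OF main[OF True]]) simp
    then have "enn2real (\<Sum>j. ennreal ((a j)\<^sup>2)) powr (p / 2) \<le> (enn2real ?R powr (2 / p)) powr (p / 2)"
      using p by (intro powr_mono2) auto
    also have "\<dots> = enn2real ?R" using p by (simp add: powr_powr)
    finally have "ennreal (enn2real (\<Sum>j. ennreal ((a j)\<^sup>2)) powr (p / 2)) \<le> ennreal (enn2real ?R)" by (rule ennreal_leI)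
    also have "\<dots> = ?R" by (rule ennreal_enn2real) (use True in \<open>simp only: infinity_ennreal_def\<close>)
    finally show ?thesis .
  next
    case False
    then have "?R = top" unfolding infinity_ennreal_def less_top[symmetric] by blast
    then show ?thesis by (simp only: top_greatest)
  qed
qed

section \<open>Moments of order below one of the walk and the integrand\<close>

context weak_example
begin

text \<open>\<open>abs_powr_le_scaled_square\<close> at s^2 = 2^(-j), the size of the second moment
  up to the norm of \<open>x\<close>, makes both resulting terms multiples of 2^(-jp/2).\<close>

lemma direction_moment:
  assumes p: "0 < p" "p \<le> 1"
  shows "(\<integral>\<^sup>+\<omega>. ennreal (\<bar>e (direction j \<omega>) \<bullet> x\<bar> powr p) \<partial>M) \<le>
     ennreal ((1 + (norm x)\<^sup>2) * ((1/2) powr (p / 2)) ^ j)"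
proof -
  let ?b = "\<lambda>\<omega>. e (direction j \<omega>) \<bullet> x"
  let ?r = "(1/2) powr (p / 2) :: real"
  define s where "s = sqrt ((1/2) ^ j :: real)"
  have s: "s > 0" "s\<^sup>2 = 1 / 2 ^ j" unfolding s_def by (auto simp: power_divide)
  have "s powr p = ((1/2) ^ j) powr (p / 2)" unfolding s_def by (simp add: powr_half_sqrt[symmetric] powr_powr)
  also have "\<dots> = ?r ^ j" by (simp add: powr_realpow[symmetric] powr_powr mult.commute)
  finally have sp: "s powr p = ?r ^ j" .
  have [measurable]: "?b \<in> borel_measurable M"
    using measurable_F_imp[OF grid_bounds(2) direction_inner_adapted] .
  have "(\<integral>\<^sup>+\<omega>. ennreal (\<bar>?b \<omega>\<bar> powr p) \<partial>M) \<le>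
      (\<integral>\<^sup>+\<omega>. ennreal (?r ^ j) + ennreal (?r ^ j * 2 ^ j) * ennreal ((?b \<omega>)\<^sup>2) \<partial>M)"
  proof (rule nn_integral_mono)
    fix \<omega>
    have "\<bar>?b \<omega>\<bar> powr p \<le> ?r ^ j * (1 + (?b \<omega>)\<^sup>2 / s\<^sup>2)"
      using abs_powr_le_scaled_square[OF p s(1), of "?b \<omega>"] unfolding sp .
    also have "\<dots> = ?r ^ j + (?r ^ j * 2 ^ j) * (?b \<omega>)\<^sup>2" unfolding s(2) by (simp add: algebra_simps)
    finally have "ennreal (\<bar>?b \<omega>\<bar> powr p) \<le> ennreal (?r ^ j + (?r ^ j * 2 ^ j) * (?b \<omega>)\<^sup>2)" by (rule ennreal_leI)
    also have "\<dots> = ennreal (?r ^ j) + ennreal ((?r ^ j * 2 ^ j) * (?b \<omega>)\<^sup>2)" by (rule ennreal_plus) auto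
    also have "ennreal ((?r ^ j * 2 ^ j) * (?b \<omega>)\<^sup>2) = ennreal (?r ^ j * 2 ^ j) * ennreal ((?b \<omega>)\<^sup>2)"
      by (rule ennreal_mult) auto
    finally show "ennreal (\<bar>?b \<omega>\<bar> powr p) \<le> ennreal (?r ^ j) + ennreal (?r ^ j * 2 ^ j) * ennreal ((?b \<omega>)\<^sup>2)" .
  qed
  also have "\<dots> = ennreal (?r ^ j) + ennreal (?r ^ j * 2 ^ j) * (\<integral>\<^sup>+\<omega>. ennreal ((?b \<omega>)\<^sup>2) \<partial>M)"
    by (simp add: nn_integral_add nn_integral_cmult emeasure_space_1)
  also have "\<dots> \<le> ennreal (?r ^ j) + ennreal (?r ^ j * 2 ^ j) * ennreal ((norm x)\<^sup>2 / 2 ^ j)"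
    by (intro add_left_mono mult_left_mono direction_second_moment) auto
  also have "ennreal (?r ^ j * 2 ^ j) * ennreal ((norm x)\<^sup>2 / 2 ^ j) = ennreal (?r ^ j * 2 ^ j * ((norm x)\<^sup>2 / 2 ^ j))"
    by (rule ennreal_mult[symmetric]) auto
  also have "ennreal (?r ^ j) + \<dots> = ennreal (?r ^ j + ?r ^ j * 2 ^ j * ((norm x)\<^sup>2 / 2 ^ j))"
    by (rule ennreal_plus[symmetric]) auto
  also have "?r ^ j + ?r ^ j * 2 ^ j * ((norm x)\<^sup>2 / 2 ^ j) = (1 + (norm x)\<^sup>2) * ?r ^ j" by (simp add: algebra_simps)
  finally show ?thesis .
qed

definition multiplier_moment :: "real \<Rightarrow> nat \<Rightarrow> ennreal" where
  "multiplier_moment p j = (\<integral>\<^sup>+\<omega>. ennreal (\<bar>1 + damping j * noise j \<omega>\<bar> powr p) \<partial>M)"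

text \<open>A crude bound valid for all \<open>j\<close>, needed to know that the moments are finite
  before the contraction sets in.\<close>

lemma multiplier_moment_le_3:
  assumes p: "0 < p" "p \<le> 1"
  shows "multiplier_moment p j \<le> 3"
proof -
  have "multiplier_moment p j \<le> (\<integral>\<^sup>+\<omega>. ennreal (1 + (1 + damping j * noise j \<omega>)\<^sup>2) \<partial>M)"
    unfolding multiplier_moment_def by (intro nn_integral_mono ennreal_leI abs_powr_le_1_plus_square p)
  also have "\<dots> = ennreal (1 + 1\<^sup>2 + (damping j)\<^sup>2)" by (rule nn_integral_noise_quadratic)
  also have "\<dots> \<le> ennreal 3"
    using damping_bounds[of j] by (intro ennreal_leI) (simp add: power_le_one)
  finally show ?thesis by simp
qed

text \<open>Since the damping tends to zero, it eventually falls below the threshold that belongs to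
  \<open>p\<close>. Only \<kappa> and the starting index depend on \<open>p\<close>, so one
  construction serves all p < 1.\<close>

lemma multiplier_moment_contracts:
  assumes p: "0 < p" "p < 1"
  shows "\<exists>\<kappa>>0. \<forall>\<^sub>F j in sequentially. multiplier_moment p j \<le> ennreal (1 - \<kappa> / sqrt (real j + 1))"
proof -
  obtain \<kappa> s0 where \<kappa>: "\<kappa> > 0" "s0 > 0"
    and le: "\<And>s. 0 \<le> s \<Longrightarrow> s \<le> s0 \<Longrightarrow>
     (\<integral>\<^sup>+z. ennreal (std_normal_density z) * ennreal (\<bar>1 + s * z\<bar> powr p) \<partial>lborel) \<le> ennreal (1 - \<kappa> * s\<^sup>2)"
    using gaussian_abs_powr_contraction[OF p] by blast
  have "\<forall>\<^sub>F j in sequentially. damping j < s0"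
    using damping_tendsto \<kappa>(2) by (rule order_tendstoD)
  then have "\<forall>\<^sub>F j in sequentially. multiplier_moment p j \<le> ennreal (1 - \<kappa> / sqrt (real j + 1))"
  proof (rule eventually_mono)
    fix j assume j: "damping j < s0"
    have "multiplier_moment p j =
        (\<integral>\<^sup>+z. ennreal (std_normal_density z) * ennreal (\<bar>1 + damping j * z\<bar> powr p) \<partial>lborel)"
      unfolding multiplier_moment_def by (rule nn_integral_noise) measurable
    also have "\<dots> \<le> ennreal (1 - \<kappa> * (damping j)\<^sup>2)"
      using damping_bounds[of j] j by (intro le) auto
    finally show "multiplier_moment p j \<le> ennreal (1 - \<kappa> / sqrt (real j + 1))"
      by (simp add: damping_square)
  qed
  then show ?thesis using \<kappa> by blast
qed

abbreviation walk_moment :: "real \<Rightarrow> 'e \<Rightarrow> nat \<Rightarrow> ennreal" where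
  "walk_moment p x j \<equiv> \<integral>\<^sup>+\<omega>. ennreal (\<bar>walk j \<omega> \<bullet> x\<bar> powr p) \<partial>M"

text \<open>In each coordinate the next value is the old one times
  \<open>1 + damping j * noise j\<close> plus the fresh coordinate times the noise. Powers of order
  at most one are subadditive, and the noise is independent of the old value and of the fresh
  coordinate, so the expectations factor. The 2 is the mean of 1 + noise^2.\<close>

lemma walk_moment_step:
  assumes p: "0 < p" "p \<le> 1"
  shows "walk_moment p x (Suc j) \<le>
     multiplier_moment p j * walk_moment p x j
       + ennreal (2 * (1 + (norm x)\<^sup>2) * ((1/2) powr (p / 2)) ^ j)"
proof -
  let ?b = "\<lambda>\<omega>. e (direction j \<omega>) \<bullet> x"
  let ?Y = "\<lambda>\<omega>. walk j \<omega> \<bullet> x"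
  let ?r = "(1/2) powr (p / 2) :: real"
  have bF: "?b \<in> borel_measurable (F (grid j))" by (rule direction_inner_adapted)
  have YF: "?Y \<in> borel_measurable (F (grid j))" by (rule strongly_measurable_inner[OF walk_adapted])
  note [measurable] = measurable_F_imp[OF grid_bounds(2) bF] measurable_F_imp[OF grid_bounds(2) YF] noise_measurable
  have "walk_moment p x (Suc j) \<le>
     (\<integral>\<^sup>+\<omega>. ennreal (\<bar>?Y \<omega>\<bar> powr p) * ennreal (\<bar>1 + damping j * noise j \<omega>\<bar> powr p)
         + ennreal (\<bar>?b \<omega>\<bar> powr p) * ennreal (\<bar>noise j \<omega>\<bar> powr p) \<partial>M)"
  proof (rule nn_integral_mono)
    fix \<omega>
    have "walk (Suc j) \<omega> \<bullet> x = ?Y \<omega> * (1 + damping j * noise j \<omega>) + ?b \<omega> * noise j \<omega>"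
      by (simp add: inner_add_left algebra_simps)
    then have "\<bar>walk (Suc j) \<omega> \<bullet> x\<bar> powr p \<le>
        \<bar>?Y \<omega>\<bar> powr p * \<bar>1 + damping j * noise j \<omega>\<bar> powr p + \<bar>?b \<omega>\<bar> powr p * \<bar>noise j \<omega>\<bar> powr p"
      using abs_add_powr_le[OF p, of "?Y \<omega> * (1 + damping j * noise j \<omega>)" "?b \<omega> * noise j \<omega>"]
      by (simp add: abs_mult powr_mult)
    then show "ennreal (\<bar>walk (Suc j) \<omega> \<bullet> x\<bar> powr p) \<le>
        ennreal (\<bar>?Y \<omega>\<bar> powr p) * ennreal (\<bar>1 + damping j * noise j \<omega>\<bar> powr p)
         + ennreal (\<bar>?b \<omega>\<bar> powr p) * ennreal (\<bar>noise j \<omega>\<bar> powr p)"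
      by (simp only: ennreal_mult[symmetric] ennreal_plus[symmetric] powr_ge_zero mult_nonneg_nonneg ennreal_leI)
  qed
  also have "\<dots> = (\<integral>\<^sup>+\<omega>. ennreal (\<bar>?Y \<omega>\<bar> powr p) * ennreal (\<bar>1 + damping j * noise j \<omega>\<bar> powr p) \<partial>M)
         + (\<integral>\<^sup>+\<omega>. ennreal (\<bar>?b \<omega>\<bar> powr p) * ennreal (\<bar>noise j \<omega>\<bar> powr p) \<partial>M)"
    by (rule nn_integral_add) measurable
  also have "(\<integral>\<^sup>+\<omega>. ennreal (\<bar>?Y \<omega>\<bar> powr p) * ennreal (\<bar>1 + damping j * noise j \<omega>\<bar> powr p) \<partial>M) =
      (\<integral>\<^sup>+\<omega>. ennreal (\<bar>?Y \<omega>\<bar> powr p) \<partial>M) * multiplier_moment p j"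
    unfolding multiplier_moment_def
    by (rule nn_integral_indep_mult[OF noise_indep[OF YF], of "\<lambda>y. ennreal (\<bar>y\<bar> powr p)" "\<lambda>z. ennreal (\<bar>1 + damping j * z\<bar> powr p)"]) measurable
  also have "(\<integral>\<^sup>+\<omega>. ennreal (\<bar>?b \<omega>\<bar> powr p) * ennreal (\<bar>noise j \<omega>\<bar> powr p) \<partial>M) =
      (\<integral>\<^sup>+\<omega>. ennreal (\<bar>?b \<omega>\<bar> powr p) \<partial>M) * (\<integral>\<^sup>+\<omega>. ennreal (\<bar>noise j \<omega>\<bar> powr p) \<partial>M)"
    by (rule nn_integral_indep_mult[OF noise_indep[OF bF], of "\<lambda>y. ennreal (\<bar>y\<bar> powr p)" "\<lambda>z. ennreal (\<bar>z\<bar> powr p)"]) measurable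
  also have "\<dots> \<le> ennreal ((1 + (norm x)\<^sup>2) * ?r ^ j) * ennreal 2"
  proof (intro mult_mono direction_moment p)
    have "(\<integral>\<^sup>+\<omega>. ennreal (\<bar>noise j \<omega>\<bar> powr p) \<partial>M) \<le> (\<integral>\<^sup>+\<omega>. ennreal (1 + (0 + 1 * noise j \<omega>)\<^sup>2) \<partial>M)"
      using abs_powr_le_1_plus_square[OF p] by (intro nn_integral_mono ennreal_leI) simp
    also have "\<dots> = ennreal 2" by (subst nn_integral_noise_quadratic) simp
    finally show "(\<integral>\<^sup>+\<omega>. ennreal (\<bar>noise j \<omega>\<bar> powr p) \<partial>M) \<le> ennreal 2" .
  qed auto
  also have "ennreal ((1 + (norm x)\<^sup>2) * ?r ^ j) * ennreal 2 = ennreal (2 * (1 + (norm x)\<^sup>2) * ?r ^ j)"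
    by (subst ennreal_mult[symmetric]) (auto simp: mult_ac)
  finally show ?thesis by (simp add: mult.commute)
qed

lemma walk_moment_bound:
  assumes p: "0 < p" "p < 1"
  shows "\<exists>B. \<forall>j. walk_moment p x j \<le> ennreal (B / (real j + 1)\<^sup>2)"
proof -
  let ?y = "\<lambda>j. walk_moment p x j"
  let ?r = "(1/2) powr (p / 2) :: real"
  let ?C = "2 * (1 + (norm x)\<^sup>2)"
  have p': "p \<le> 1" using p by simp
  have \<rho>fin: "multiplier_moment p j < \<infinity>" for j
    using multiplier_moment_le_3[OF p(1) p', of j] by (rule order_le_less_trans) simp
  \<comment> \<open>Each moment must be known to be finite before \<open>enn2real\<close> can carry
    the recursion to the reals.\<close>
  have yfin: "?y j < \<infinity>" for j
  proof (induction j)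
    case (Suc j)
    have "?y (Suc j) \<le> multiplier_moment p j * ?y j + ennreal (?C * ?r ^ j)" by (rule walk_moment_step[OF p(1) p'])
    also have "\<dots> < \<infinity>" using Suc \<rho>fin[of j] by (simp add: ennreal_mult_less_top)
    finally show ?case .
  qed simp
  obtain \<kappa> where \<kappa>: "\<kappa> > 0" "\<forall>\<^sub>F j in sequentially. multiplier_moment p j \<le> ennreal (1 - \<kappa> / sqrt (real j + 1))"
    using multiplier_moment_contracts[OF p] by blast
  \<comment> \<open>\<open>ennreal\<close> truncates negative numbers at 0, so the bound on the
    multiplier is carried to the reals only where its right side is nonnegative.\<close>
  have "\<forall>\<^sub>F j in sequentially. \<kappa> / sqrt (real j + 1) \<le> 1" by real_asymp
  with \<kappa>(2) have \<rho>: "\<forall>\<^sub>F j in sequentially. enn2real (multiplier_moment p j) \<le> 1 - \<kappa> / sqrt (real j + 1)"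
  proof (rule eventually_elim2)
    fix j assume "multiplier_moment p j \<le> ennreal (1 - \<kappa> / sqrt (real j + 1))" and le: "\<kappa> / sqrt (real j + 1) \<le> 1"
    then have "enn2real (multiplier_moment p j) \<le> enn2real (ennreal (1 - \<kappa> / sqrt (real j + 1)))"
      by (intro enn2real_mono) auto
    then show "enn2real (multiplier_moment p j) \<le> 1 - \<kappa> / sqrt (real j + 1)" using le by simp
  qed
  have rec: "enn2real (?y (Suc j)) \<le> enn2real (multiplier_moment p j) * enn2real (?y j) + ?C * ?r ^ j" for j
  proof -
    have "enn2real (?y (Suc j)) \<le> enn2real (multiplier_moment p j * ?y j + ennreal (?C * ?r ^ j))"
      using yfin[of j] \<rho>fin[of j] by (intro enn2real_mono walk_moment_step[OF p(1) p']) (simp add: ennreal_mult_less_top)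
    also have "\<dots> = enn2real (multiplier_moment p j) * enn2real (?y j) + ?C * ?r ^ j"
      using yfin[of j] \<rho>fin[of j] by (subst enn2real_plus) (auto simp: ennreal_mult_less_top enn2real_mult)
    finally show ?thesis .
  qed
  have "\<exists>B. \<forall>j. enn2real (?y j) \<le> B / (real j + 1)\<^sup>2"
  proof (rule contracting_recursion_bound[OF _ rec \<rho> \<kappa>(1)])
    show "?r < 1" using p powr_less_mono2[of "p / 2" "1 / 2" 1] by simp
  qed auto
  then obtain B where B: "\<And>j. enn2real (?y j) \<le> B / (real j + 1)\<^sup>2" by blast
  have "?y j \<le> ennreal (B / (real j + 1)\<^sup>2)" for j
    using ennreal_leI[OF B[of j]] yfin[of j] by simp
  then show ?thesis by blast
qed

lemma summable_walk_moments:
  assumes p: "0 < p" "p < 1"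
  shows "(\<Sum>j. walk_moment p x j) < \<infinity>"
proof -
  obtain B where B: "\<And>j. walk_moment p x j \<le> ennreal (B / (real j + 1)\<^sup>2)"
    using walk_moment_bound[OF p] by blast
  have "summable (\<lambda>j. 1 / (real j + 1)\<^sup>2)"
    using summable_Suc_iff[of "\<lambda>n. inverse (real n ^ 2)"] inverse_power_summable[of 2, where 'a=real]
    by (simp add: inverse_eq_divide add.commute)
  then have s: "summable (\<lambda>j. \<bar>B\<bar> / (real j + 1)\<^sup>2)" using summable_mult[of _ "\<bar>B\<bar>"] by fastforce
  have "(\<Sum>j. walk_moment p x j) \<le> (\<Sum>j. ennreal (\<bar>B\<bar> / (real j + 1)\<^sup>2))"
    by (intro suminf_le order_trans[OF B] ennreal_leI divide_right_mono) auto
  also have "\<dots> = ennreal (\<Sum>j. \<bar>B\<bar> / (real j + 1)\<^sup>2)" by (rule suminf_ennreal2[OF _ s]) simp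
  finally show ?thesis by (rule order_le_less_trans) simp
qed

text \<open>The source of both weak integrability statements: integrability of order
  \<open>p\<close> through the comparison of sequence norms, and almost sure square summability from
  the case p = 1/2.\<close>

lemma integrand_moment:
  assumes p: "0 < p" "p < 1"
  shows "(\<integral>\<^sup>+\<omega>. (\<Sum>j. ennreal (\<bar>integrand j \<omega> \<bullet> x\<bar> powr p)) \<partial>M) < \<infinity>"
proof -
  let ?r = "(1/2) powr (p / 2) :: real"
  have p': "p \<le> 1" using p by simp
  have [measurable]: "(\<lambda>\<omega>. e (direction j \<omega>) \<bullet> x) \<in> borel_measurable M" for j
    using measurable_F_imp[OF grid_bounds(2) direction_inner_adapted] .
  note [measurable] = walk_inner_measurable integrand_inner_measurable
  have r: "?r < 1" "0 \<le> ?r" using p powr_less_mono2[of "p / 2" "1 / 2" 1] by simp_all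
  have "(\<integral>\<^sup>+\<omega>. (\<Sum>j. ennreal (\<bar>integrand j \<omega> \<bullet> x\<bar> powr p)) \<partial>M) = (\<Sum>j. \<integral>\<^sup>+\<omega>. ennreal (\<bar>integrand j \<omega> \<bullet> x\<bar> powr p) \<partial>M)"
    by (rule nn_integral_suminf) measurable
  also have "\<dots> \<le> (\<Sum>j. walk_moment p x j + ennreal ((1 + (norm x)\<^sup>2) * ?r ^ j))"
  proof (intro suminf_le)
    fix j
    have "(\<integral>\<^sup>+\<omega>. ennreal (\<bar>integrand j \<omega> \<bullet> x\<bar> powr p) \<partial>M) \<le>
        (\<integral>\<^sup>+\<omega>. ennreal (\<bar>walk j \<omega> \<bullet> x\<bar> powr p) + ennreal (\<bar>e (direction j \<omega>) \<bullet> x\<bar> powr p) \<partial>M)"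
    proof (rule nn_integral_mono)
      fix \<omega>
      have "\<bar>integrand j \<omega> \<bullet> x\<bar> powr p \<le> \<bar>damping j * (walk j \<omega> \<bullet> x)\<bar> powr p + \<bar>e (direction j \<omega>) \<bullet> x\<bar> powr p"
        unfolding integrand_def inner_add_left inner_scaleR_left by (rule abs_add_powr_le[OF p(1) p'])
      also have "\<bar>damping j * (walk j \<omega> \<bullet> x)\<bar> powr p \<le> \<bar>walk j \<omega> \<bullet> x\<bar> powr p"
        using p damping_bounds[of j] by (intro powr_mono2) (auto simp: abs_mult mult_left_le_one_le)
      finally show "ennreal (\<bar>integrand j \<omega> \<bullet> x\<bar> powr p) \<le>
          ennreal (\<bar>walk j \<omega> \<bullet> x\<bar> powr p) + ennreal (\<bar>e (direction j \<omega>) \<bullet> x\<bar> powr p)"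
        by (simp only: ennreal_plus[symmetric] powr_ge_zero) (rule ennreal_leI, simp)
    qed
    also have "\<dots> = walk_moment p x j + (\<integral>\<^sup>+\<omega>. ennreal (\<bar>e (direction j \<omega>) \<bullet> x\<bar> powr p) \<partial>M)"
      by (rule nn_integral_add) measurable
    also have "\<dots> \<le> walk_moment p x j + ennreal ((1 + (norm x)\<^sup>2) * ?r ^ j)"
      by (intro add_left_mono direction_moment p(1) p')
    finally show "(\<integral>\<^sup>+\<omega>. ennreal (\<bar>integrand j \<omega> \<bullet> x\<bar> powr p) \<partial>M) \<le>
      walk_moment p x j + ennreal ((1 + (norm x)\<^sup>2) * ?r ^ j)" .
  qed auto
  also have "\<dots> = (\<Sum>j. walk_moment p x j) + (\<Sum>j. ennreal ((1 + (norm x)\<^sup>2) * ?r ^ j))"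
    by (rule suminf_add[symmetric]) auto
  also have "(\<Sum>j. ennreal ((1 + (norm x)\<^sup>2) * ?r ^ j)) = ennreal (\<Sum>j. (1 + (norm x)\<^sup>2) * ?r ^ j)"
    using r by (intro suminf_ennreal2 summable_mult summable_geometric) auto
  also have "(\<Sum>j. walk_moment p x j) + ennreal (\<Sum>j. (1 + (norm x)\<^sup>2) * ?r ^ j) < \<infinity>"
    using summable_walk_moments[OF p, of x] by simp
  finally show ?thesis .
qed

text \<open>The order 1/2 is chosen because squaring undoes it. Summable moments make the series of
  powers finite almost surely, so its terms tend to zero.\<close>

lemma AE_walk_tendsto: "AE \<omega> in M. (\<lambda>j. walk j \<omega> \<bullet> x) \<longlonglongrightarrow> 0"
proof -
  note [measurable] = walk_inner_measurable
  have "(\<integral>\<^sup>+\<omega>. (\<Sum>j. ennreal (\<bar>walk j \<omega> \<bullet> x\<bar> powr (1/2))) \<partial>M) = (\<Sum>j. walk_moment (1/2) x j)"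
    by (rule nn_integral_suminf) measurable
  then have "(\<integral>\<^sup>+\<omega>. (\<Sum>j. ennreal (\<bar>walk j \<omega> \<bullet> x\<bar> powr (1/2))) \<partial>M) \<noteq> \<infinity>"
    using summable_walk_moments[of "1/2" x] by simp
  then have "AE \<omega> in M. (\<Sum>j. ennreal (\<bar>walk j \<omega> \<bullet> x\<bar> powr (1/2))) \<noteq> \<infinity>"
    by (intro nn_integral_PInf_AE) auto
  then show ?thesis
  proof (rule AE_mp, intro AE_I2 impI)
    fix \<omega> assume "(\<Sum>j. ennreal (\<bar>walk j \<omega> \<bullet> x\<bar> powr (1/2))) \<noteq> \<infinity>"
    then have "summable (\<lambda>j. \<bar>walk j \<omega> \<bullet> x\<bar> powr (1/2))" by (intro summable_suminf_not_top) auto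
    then have "(\<lambda>j. \<bar>walk j \<omega> \<bullet> x\<bar> powr (1/2)) \<longlonglongrightarrow> 0" by (rule summable_LIMSEQ_zero)
    then have "(\<lambda>j. (\<bar>walk j \<omega> \<bullet> x\<bar> powr (1/2))\<^sup>2) \<longlonglongrightarrow> 0\<^sup>2" by (rule tendsto_power)
    then have "(\<lambda>j. \<bar>walk j \<omega> \<bullet> x\<bar>) \<longlonglongrightarrow> 0" by (simp add: powr_half_sqrt)
    then show "(\<lambda>j. walk j \<omega> \<bullet> x) \<longlonglongrightarrow> 0" by (rule tendsto_rabs_zero_cancel)
  qed
qed

abbreviation square_sum :: "'e \<Rightarrow> 'w \<Rightarrow> ennreal" where
  "square_sum x \<omega> \<equiv> \<Sum>j. ennreal ((integrand j \<omega> \<bullet> x)\<^sup>2)"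

lemma AE_integrand_square_summable: "AE \<omega> in M. square_sum x \<omega> < \<infinity>"
proof -
  note [measurable] = integrand_inner_measurable
  have "AE \<omega> in M. (\<Sum>j. ennreal (\<bar>integrand j \<omega> \<bullet> x\<bar> powr (1/2))) \<noteq> \<infinity>"
  proof (rule nn_integral_PInf_AE)
    show "(\<lambda>\<omega>. \<Sum>j. ennreal (\<bar>integrand j \<omega> \<bullet> x\<bar> powr (1/2))) \<in> borel_measurable M" by measurable
    show "(\<integral>\<^sup>+\<omega>. (\<Sum>j. ennreal (\<bar>integrand j \<omega> \<bullet> x\<bar> powr (1/2))) \<partial>M) \<noteq> \<infinity>"
      by (rule less_imp_neq, rule integrand_moment) auto
  qed
  then show ?thesis
  proof (rule AE_mp, intro AE_I2 impI)
    fix \<omega> assume "(\<Sum>j. ennreal (\<bar>integrand j \<omega> \<bullet> x\<bar> powr (1/2))) \<noteq> \<infinity>"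
    then have "(\<Sum>j. ennreal (\<bar>integrand j \<omega> \<bullet> x\<bar> powr (1/2))) < \<infinity>"
      unfolding infinity_ennreal_def less_top .
    then show "square_sum x \<omega> < \<infinity>" by (rule suminf_square_le(1)[rotated 2]) auto
  qed
qed


lemma prob_decseq_tendsto_0:
  assumes A: "\<And>n. A n \<in> events" "decseq A" and null: "AE \<omega> in M. \<exists>n. \<omega> \<notin> A n"
  shows "(\<lambda>n. prob (A n)) \<longlonglongrightarrow> 0"
proof -
  have "prob (\<Inter>n. A n) = prob {}"
  proof (rule finite_measure_eq_AE)
    show "AE \<omega> in M. (\<omega> \<in> (\<Inter>n. A n)) = (\<omega> \<in> {})" using null by (rule AE_mp) auto
  qed (use A in auto)
  then show ?thesis
    using finite_Lim_measure_decseq[of A] A by (auto simp: image_subset_iff)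
qed

section \<open>Consequences of progressive measurability\<close>

lemma progressive_imp_adapted:
  assumes "strongly_progressively_measurable F \<phi>"
  shows "strongly_adapted F \<phi>"
  unfolding strongly_adapted_def
proof
  fix t :: real assume t: "t \<in> {0..1}"
  have "Pair t \<in> measurable (F t) (restrict_space borel {0..t} \<Otimes>\<^sub>M F t)"
    using t by (intro measurable_Pair1') (simp add: space_restrict_space)
  from strongly_measurable_compose[OF this] assms t show "strongly_measurable (F t) (\<phi> t)"
    unfolding strongly_progressively_measurable_def by fastforce
qed

lemma progressive_imp_measurable_process:
  assumes "strongly_progressively_measurable F \<phi>"
  shows "strongly_measurable_process M \<phi>"
proof -
  have "(\<lambda>p. (fst p, snd p)) \<in> measurable (restrict_space borel {0..1} \<Otimes>\<^sub>M M) (restrict_space borel {0..1} \<Otimes>\<^sub>M F 1)"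
    by (intro measurable_Pair measurable_fst measurable_compose[OF measurable_snd id_measurable_F]) simp
  moreover have "strongly_measurable (restrict_space borel {0..1} \<Otimes>\<^sub>M F 1) (\<lambda>(s, \<omega>). \<phi> s \<omega>)"
    using assms unfolding strongly_progressively_measurable_def by (rule bspec) simp
  ultimately have "strongly_measurable (restrict_space borel {0..1} \<Otimes>\<^sub>M M)
      (\<lambda>p. (\<lambda>(s, \<omega>). \<phi> s \<omega>) (fst p, snd p))" by (rule strongly_measurable_compose)
  then show ?thesis unfolding strongly_measurable_process_def by simp
qed


section \<open>The process in continuous time\<close>

definition cell :: "real \<Rightarrow> nat" where "cell t = (LEAST j. t \<le> grid (Suc j))"

text \<open>For t >= 1 no index satisfies the condition in \<open>cell\<close>, whose value is then
  unspecified, hence the guard t < 1. Up to time 1/2 the process is idle while randomness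
  accumulates.\<close>

definition process :: "real \<Rightarrow> 'w \<Rightarrow> 'e" where
  "process t \<omega> = (if 1 / 2 < t \<and> t < 1 then scale (cell t) *\<^sub>R integrand (cell t) \<omega> else 0)"

lemma exists_grid_ge:
  assumes "t < 1" shows "\<exists>n. t < grid n"
  using order_tendstoD(1)[OF grid_tendsto assms] by (auto simp: eventually_sequentially)

lemma exists_cell:
  assumes "1 / 2 < t" "t < 1"
  shows "\<exists>j. t \<in> {grid j<..grid (Suc j)}"
proof -
  obtain n where n: "t \<le> grid n" using exists_grid_ge[OF assms(2)] by (auto intro: less_imp_le)
  define m where "m = (LEAST n. t \<le> grid n)"
  have m: "t \<le> grid m" unfolding m_def by (rule LeastI[of _ n]) (rule n)
  have "m \<noteq> 0" using m assms(1) by (auto simp: grid_def intro!: gr0I)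
  then obtain j where j: "m = Suc j" by (cases m) auto
  have "\<not> t \<le> grid j" using not_less_Least[of j "\<lambda>n. t \<le> grid n"] j unfolding m_def by simp
  then show ?thesis using m j by (intro exI[of _ j]) auto
qed

lemma cell_eq:
  assumes "t \<in> {grid j<..grid (Suc j)}"
  shows "cell t = j"
  unfolding cell_def
proof (rule Least_equality)
  show "t \<le> grid (Suc j)" using assms by simp
  show "j \<le> i" if "t \<le> grid (Suc i)" for i
    using that assms grid_mono[of "Suc i" j] by (cases "Suc i \<le> j") auto
qed

lemma process_on_cell:
  assumes "t \<in> {grid j<..grid (Suc j)}"
  shows "process t \<omega> = scale j *\<^sub>R integrand j \<omega>"
  using assms cell_eq[OF assms] grid_bounds(1)[of j] grid_bounds(3)[of "Suc j"] by (simp add: process_def)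

lemma process_off_cells: "t \<le> 1 / 2 \<or> 1 \<le> t \<Longrightarrow> process t \<omega> = 0"
  by (auto simp: process_def)

text \<open>The half-open cells tile the open interval from 1/2 to 1, so time integrals of cellwise
  constant functions become series.\<close>

lemma nn_integral_cells:
  assumes on: "\<And>j t. t \<in> {grid j<..grid (Suc j)} \<Longrightarrow> q t = c j"
    and off: "\<And>t. t \<le> 1 / 2 \<or> 1 \<le> t \<Longrightarrow> q t = 0"
  shows "(\<integral>\<^sup>+t\<in>{0..1}. q t \<partial>lborel) = (\<Sum>j. c j * ennreal (grid (Suc j) - grid j))"
proof -
  have "q t * indicator {0..1} t = (\<Sum>j. c j * indicator {grid j<..grid (Suc j)} t)" for t
  proof (cases "1 / 2 < t \<and> t < 1")
    case True
    then obtain j where j: "t \<in> {grid j<..grid (Suc j)}" using exists_cell by blast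
    have "(\<Sum>i. c i * indicator {grid i<..grid (Suc i)} t) = (\<Sum>i\<in>{j}. c i * indicator {grid i<..grid (Suc i)} t)"
    proof (rule suminf_finite)
      fix i assume "i \<notin> {j}"
      then have "t \<notin> {grid i<..grid (Suc i)}" using cell_eq[of t i] cell_eq[OF j] by auto
      then show "c i * indicator {grid i<..grid (Suc i)} t = 0" by (simp del: greaterThanAtMost_iff)
    qed simp
    then show ?thesis using True j on[OF j] by (simp del: greaterThanAtMost_iff add: indicator_def)
  next
    case False
    have "t \<notin> {grid i<..grid (Suc i)}" for i
      using False grid_bounds(1)[of i] grid_bounds(3)[of "Suc i"] by auto
    moreover have "q t = 0" by (rule off) (use False in linarith)
    ultimately show ?thesis by (simp del: greaterThanAtMost_iff)
  qed
  then have "(\<integral>\<^sup>+t\<in>{0..1}. q t \<partial>lborel) = (\<integral>\<^sup>+t. (\<Sum>j. c j * indicator {grid j<..grid (Suc j)} t) \<partial>lborel)" by simp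
  also have "\<dots> = (\<Sum>j. \<integral>\<^sup>+t. c j * indicator {grid j<..grid (Suc j)} t \<partial>lborel)"
    by (rule nn_integral_suminf) simp
  also have "\<dots> = (\<Sum>j. c j * ennreal (grid (Suc j) - grid j))"
    using grid_bounds(4) by (intro suminf_cong) (simp add: nn_integral_cmult less_imp_le)
  finally show ?thesis .
qed

lemma scaled_square:
  "ennreal (\<bar>scale j * b\<bar>\<^sup>2) * ennreal (grid (Suc j) - grid j) = ennreal (b\<^sup>2)"
proof -
  have "ennreal (\<bar>scale j * b\<bar>\<^sup>2) * ennreal (grid (Suc j) - grid j) =
      ennreal (b\<^sup>2 * ((scale j)\<^sup>2 * (grid (Suc j) - grid j)))"
    using grid_bounds(4)[of j] by (subst ennreal_mult[symmetric]) (auto simp: power_mult_distrib algebra_simps)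
  then show ?thesis by (simp add: scale_square)
qed

lemma process_square_integral:
  "(\<integral>\<^sup>+t\<in>{0..1}. ennreal (\<bar>process t \<omega> \<bullet> x\<bar>\<^sup>2) \<partial>lborel) = square_sum x \<omega>"
proof -
  have "(\<integral>\<^sup>+t\<in>{0..1}. ennreal (\<bar>process t \<omega> \<bullet> x\<bar>\<^sup>2) \<partial>lborel) =
     (\<Sum>j. ennreal (\<bar>scale j * (integrand j \<omega> \<bullet> x)\<bar>\<^sup>2) * ennreal (grid (Suc j) - grid j))"
    by (rule nn_integral_cells) (auto simp: process_on_cell process_off_cells)
  then show ?thesis by (simp only: scaled_square)
qed

lemma process_norm_square_integral:
  "(\<integral>\<^sup>+t\<in>{0..1}. ennreal ((norm (process t \<omega>))\<^sup>2) \<partial>lborel) = \<infinity>"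
proof -
  have "(\<integral>\<^sup>+t\<in>{0..1}. ennreal ((norm (process t \<omega>))\<^sup>2) \<partial>lborel) =
     (\<Sum>j. ennreal (\<bar>scale j * norm (integrand j \<omega>)\<bar>\<^sup>2) * ennreal (grid (Suc j) - grid j))"
    by (rule nn_integral_cells) (auto simp: process_on_cell process_off_cells power_mult_distrib)
  also have "\<dots> = (\<Sum>j. ennreal ((norm (integrand j \<omega>))\<^sup>2))" by (simp only: scaled_square)
  also have "\<dots> = \<infinity>"
  proof (rule ccontr)
    assume "(\<Sum>j. ennreal ((norm (integrand j \<omega>))\<^sup>2)) \<noteq> \<infinity>"
    then have "summable (\<lambda>j. (norm (integrand j \<omega>))\<^sup>2)" by (intro summable_suminf_not_top) auto
    then have lim: "(\<lambda>j. (norm (integrand j \<omega>))\<^sup>2) \<longlonglongrightarrow> 0" by (rule summable_LIMSEQ_zero)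
    have "1 \<le> (norm (integrand j \<omega>))\<^sup>2" for j using norm_integrand_ge[of j \<omega>] by simp
    then have "1 \<le> (0::real)" using LIMSEQ_le_const[OF lim] by blast
    then show False by simp
  qed
  finally show ?thesis .
qed

lemma process_progressive: "strongly_progressively_measurable F process"
  unfolding strongly_progressively_measurable_def
proof
  fix T :: real assume T: "T \<in> {0..1}"
  let ?N = "restrict_space borel {0..T} \<Otimes>\<^sub>M F T"
  define A where "A k = (case k of 0 \<Rightarrow> fst -` (- {1/2<..<1}) \<inter> space ?N
      | Suc j \<Rightarrow> fst -` {grid j<..grid (Suc j)} \<inter> space ?N)" for k
  \<comment> \<open>Piece 0 collects the times off the cells. Up to time \<open>T\<close> cell
    \<open>j\<close> is reached only if grid j < T, and then \<open>integrand j\<close> is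
    measurable for \<open>F T\<close>; otherwise the piece is empty and 0 is a placeholder.\<close>
  define G where "G k p = (case k of 0 \<Rightarrow> 0
      | Suc j \<Rightarrow> (if grid j < T then scale j *\<^sub>R integrand j (snd p) else 0))" for k and p :: "real \<times> 'w"
  have id: "(\<lambda>t. t) \<in> measurable (restrict_space borel {0..T}) borel"
    by (rule measurable_restrict_space1) simp
  have fst: "fst \<in> measurable ?N borel" by (rule measurable_compose[OF measurable_fst id])
  have space: "space ?N = {0..T} \<times> space M" using T by (simp add: space_pair_measure space_restrict_space space_F)
  show "strongly_measurable ?N (\<lambda>(s, \<omega>). process s \<omega>)"
  proof (rule strongly_measurable_piecewise)
    show "A k \<in> sets ?N" for k unfolding A_def using measurable_sets[OF fst] by (cases k) auto
    show "disjoint_family A"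
      unfolding disjoint_family_on_def
    proof safe
      fix k l p assume kl: "k \<noteq> l" and p: "p \<in> A k" "p \<in> A l"
      have c: "k = (if fst p \<in> - {1/2<..<1} then 0 else Suc (cell (fst p)))" if "p \<in> A k" for k
      proof (cases k)
        case 0
        then show ?thesis using that by (simp add: A_def)
      next
        case (Suc j)
        then have j: "fst p \<in> {grid j<..grid (Suc j)}" using that by (simp add: A_def)
        then have "fst p \<in> {1/2<..<1}" using grid_bounds(1)[of j] grid_bounds(3)[of "Suc j"] by simp
        then show ?thesis using Suc cell_eq[OF j] by simp
      qed
      show "p \<in> {}" using c[OF p(1)] c[OF p(2)] kl by simp
    qed
    show "space ?N \<subseteq> (\<Union>k. A k)"
    proof
      fix p assume p: "p \<in> space ?N"
      show "p \<in> (\<Union>k. A k)"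
      proof (cases "1/2 < fst p \<and> fst p < 1")
        case True
        then obtain j where "fst p \<in> {grid j<..grid (Suc j)}" using exists_cell by blast
        then have "p \<in> A (Suc j)" using p by (simp add: A_def)
        then show ?thesis by blast
      next
        case False
        then have "p \<in> A 0" using p by (auto simp: A_def)
        then show ?thesis by blast
      qed
    qed
    show "strongly_measurable ?N (G k)" for k
    proof (cases k)
      case 0
      then show ?thesis by (simp add: G_def[abs_def] strongly_measurable_const)
    next
      case (Suc j)
      show ?thesis
      proof (cases "grid j < T")
        case True
        have "snd \<in> measurable ?N (F (grid j))"
          using measurable_compose[OF measurable_snd id_measurable_F_mono[of "grid j" T]] True grid_bounds(2) by simp
        from strongly_measurable_compose[OF this integrand_adapted]
        have "strongly_measurable ?N (\<lambda>p. scale j *\<^sub>R integrand j (snd p))"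
          by (intro strongly_measurable_scaleR borel_measurable_const)
        then show ?thesis using Suc True by (simp add: G_def[abs_def])
      next
        case False
        then show ?thesis using Suc by (simp add: G_def[abs_def] strongly_measurable_const)
      qed
    qed
    show "(case p of (s, \<omega>) \<Rightarrow> process s \<omega>) = G k p" if "p \<in> A k" "p \<in> space ?N" for k p
    proof (cases k)
      case 0
      then have "fst p \<le> 1/2 \<or> 1 \<le> fst p" using that(1) by (auto simp: A_def)
      then show ?thesis using 0 by (simp add: split_def process_off_cells G_def)
    next
      case (Suc j)
      then have j: "fst p \<in> {grid j<..grid (Suc j)}" using that(1) by (simp add: A_def)
      have "fst p \<le> T" using that(2) unfolding space by auto
      then have "grid j < T" using j by auto
      then show ?thesis using Suc process_on_cell[OF j] by (simp add: split_def G_def)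
    qed
  qed
qed

lemma process_weakly_in_Lp:
  assumes p: "0 \<le> p" "p < 1"
  shows "weakly_in_Lp M p process"
  unfolding weakly_in_Lp_def process_square_integral
proof (intro allI conjI impI)
  fix x
  show "AE \<omega> in M. square_sum x \<omega> < \<infinity>" by (rule AE_integrand_square_summable)
  assume p0: "0 < p"
  have "(\<integral>\<^sup>+\<omega>. ennreal (enn2real (square_sum x \<omega>) powr (p / 2)) \<partial>M) \<le>
      (\<integral>\<^sup>+\<omega>. (\<Sum>j. ennreal (\<bar>integrand j \<omega> \<bullet> x\<bar> powr p)) \<partial>M)"
    using p0 p by (intro nn_integral_mono suminf_square_le(2)) auto
  also have "\<dots> < \<infinity>" using p0 p(2) by (rule integrand_moment)
  finally show "(\<integral>\<^sup>+\<omega>. ennreal (enn2real (square_sum x \<omega>) powr (p / 2)) \<partial>M) < \<infinity>" .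
qed

section \<open>Approximating step processes of a coordinate\<close>

definition approx :: "'e \<Rightarrow> nat \<Rightarrow> nat \<Rightarrow> ('w, real) step" where
  "approx x m n = map (\<lambda>j. (grid j, grid (Suc j), \<lambda>\<omega>. scale j * (integrand j \<omega> \<bullet> x))) [m..<n]"

definition partial_integral :: "'e \<Rightarrow> nat \<Rightarrow> real \<Rightarrow> 'w \<Rightarrow> real" where
  "partial_integral x n t \<omega> = (\<Sum>j<n. (W (min (grid (Suc j)) t) \<omega> - W (min (grid j) t) \<omega>) * (scale j * (integrand j \<omega> \<bullet> x)))"

lemma adapted_approx: "adapted_step F (approx x m n)"
  unfolding adapted_step_def approx_def
  using grid_bounds grid_bounds(3)[THEN less_imp_le]
  by (auto simp: strongly_measurable_real intro!: borel_measurable_times strongly_measurable_inner integrand_adapted)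

text \<open>The two indices of \<open>approx\<close> serve two roles: \<open>approx x 0 n\<close> is
  the approximating sequence, and \<open>approx x n (n + k)\<close> is a difference of two of its
  members, to which the maximal inequality applies.\<close>

lemma step_integral_approx:
  assumes "m \<le> n"
  shows "step_integral W (approx x m n) t \<omega> = partial_integral x n t \<omega> - partial_integral x m t \<omega>"
  using assms
proof (induction n rule: dec_induct)
  case base
  then show ?case by (simp add: approx_def step_integral_Nil)
next
  case (step n)
  then show ?case
    by (simp add: approx_def step_integral_append step_integral_Cons step_integral_Nil partial_integral_def)
qed

lemma step_process_approx_on_cell:
  assumes t: "t \<in> {grid j<..grid (Suc j)}"
  shows "step_process (approx x m n) t \<omega> = (if m \<le> j \<and> j < n then scale j * (integrand j \<omega> \<bullet> x) else 0)"
proof (induction n)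
  case (Suc n)
  have "t \<in> {grid n<..grid (Suc n)} \<longleftrightarrow> n = j" using t cell_eq[of t n] cell_eq[OF t] by auto
  then have "indicat_real {grid n<..grid (Suc n)} t = (if n = j then 1 else 0)" by (simp only: indicator_def of_bool_def)
  then show ?case
    using Suc by (cases "n = j") (auto simp: approx_def step_process_append step_process_Cons step_process_Nil)
qed (simp add: approx_def step_process_Nil)

lemma step_process_approx_off_cells:
  assumes "t \<le> 1 / 2 \<or> 1 \<le> t"
  shows "step_process (approx x m n) t \<omega> = 0"
proof (induction n)
  case (Suc n)
  have "t \<notin> {grid n<..grid (Suc n)}" using assms grid_bounds(1)[of n] grid_bounds(3)[of "Suc n"] by auto
  then have "indicat_real {grid n<..grid (Suc n)} t = 0" by (simp only: indicator_def of_bool_def if_False)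
  then show ?case
    using Suc by (auto simp: approx_def step_process_append step_process_Cons step_process_Nil)
qed (simp add: approx_def step_process_Nil)

text \<open>The initial terms are set to zero rather than shifted away, so that monotonicity in
  \<open>n\<close> and comparison with sums over cells are termwise.\<close>

definition tail :: "'e \<Rightarrow> nat \<Rightarrow> 'w \<Rightarrow> ennreal" where
  "tail x n \<omega> = (\<Sum>j. if j < n then 0 else ennreal ((integrand j \<omega> \<bullet> x)\<^sup>2))"

lemma tail_measurable: "tail x n \<in> borel_measurable M"
proof -
  note [measurable] = integrand_inner_measurable
  show ?thesis unfolding tail_def[abs_def] by measurable
qed

lemma energy_approx_le: "energy (step_process (approx x m n)) \<omega> \<le> tail x m \<omega>"
proof -
  have "energy (step_process (approx x m n)) \<omega> =
     (\<Sum>j. ennreal (\<bar>if m \<le> j \<and> j < n then scale j * (integrand j \<omega> \<bullet> x) else 0\<bar>\<^sup>2) * ennreal (grid (Suc j) - grid j))"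
    unfolding energy_def
    by (rule nn_integral_cells) (auto simp: step_process_approx_on_cell step_process_approx_off_cells)
  also have "\<dots> \<le> tail x m \<omega>"
    unfolding tail_def
  proof (intro suminf_le)
    fix j
    show "ennreal (\<bar>if m \<le> j \<and> j < n then scale j * (integrand j \<omega> \<bullet> x) else 0\<bar>\<^sup>2) * ennreal (grid (Suc j) - grid j)
       \<le> (if j < m then 0 else ennreal ((integrand j \<omega> \<bullet> x)\<^sup>2))"
      using scaled_square[of j "integrand j \<omega> \<bullet> x"] by (cases "m \<le> j \<and> j < n") auto
  qed auto
  finally show ?thesis .
qed

text \<open>The approximation is exact on the first \<open>n\<close> cells and zero on the later
  ones, so its error is precisely a tail of the square sum.\<close>

lemma approx_error:
  "(\<integral>\<^sup>+t\<in>{0..1}. ennreal (\<bar>step_process (approx x 0 n) t \<omega> \<bullet> y - (process t \<omega> \<bullet> x) \<bullet> y\<bar>\<^sup>2) \<partial>lborel) = tail (y *\<^sub>R x) n \<omega>"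
proof -
  have "(\<integral>\<^sup>+t\<in>{0..1}. ennreal (\<bar>step_process (approx x 0 n) t \<omega> \<bullet> y - (process t \<omega> \<bullet> x) \<bullet> y\<bar>\<^sup>2) \<partial>lborel) =
     (\<Sum>j. ennreal (\<bar>scale j * (if j < n then 0 else integrand j \<omega> \<bullet> (y *\<^sub>R x))\<bar>\<^sup>2) * ennreal (grid (Suc j) - grid j))"
    by (rule nn_integral_cells)
      (auto simp: step_process_approx_on_cell step_process_approx_off_cells process_on_cell process_off_cells mult_ac)
  also have "\<dots> = (\<Sum>j. ennreal ((if j < n then 0 else integrand j \<omega> \<bullet> (y *\<^sub>R x))\<^sup>2))" by (simp only: scaled_square)
  also have "\<dots> = tail (y *\<^sub>R x) n \<omega>" unfolding tail_def by (intro suminf_cong) auto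
  finally show ?thesis .
qed

lemma tail_tendsto:
  assumes "square_sum x \<omega> < \<infinity>"
  shows "(\<lambda>n. tail x n \<omega>) \<longlonglongrightarrow> 0"
proof -
  let ?a = "\<lambda>j. (integrand j \<omega> \<bullet> x)\<^sup>2"
  have s: "summable ?a" using assms by (intro summable_suminf_not_top) (auto simp: less_top)
  have eq: "tail x n \<omega> = ennreal (\<Sum>j. ?a (j + n))" for n
  proof -
    have "tail x n \<omega> = (\<Sum>j. ennreal (if j < n then 0 else ?a j))"
      unfolding tail_def by (intro suminf_cong) simp
    also have "\<dots> = ennreal (\<Sum>j. if j < n then 0 else ?a j)"
    proof (rule suminf_ennreal2)
      show "summable (\<lambda>j. if j < n then 0 else ?a j)"
        by (rule summable_comparison_test'[OF s, of 0]) simp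
    qed simp
    also have "(\<Sum>j. if j < n then 0 else ?a j) = (\<Sum>j. ?a (j + n))"
      by (subst suminf_split_initial_segment[where k=n])
        (auto intro!: summable_comparison_test'[OF s, of 0])
    finally show ?thesis .
  qed
  have "(\<lambda>n. \<Sum>j. ?a (j + n)) \<longlonglongrightarrow> 0"
    using suminf_exist_split2[OF s] .
  then show ?thesis unfolding eq using tendsto_ennrealI by fastforce
qed

lemma tail_null: "null_in_probability M (tail x)"
  unfolding null_in_probability_def
proof (intro allI impI)
  fix \<epsilon> :: real assume \<epsilon>: "\<epsilon> > 0"
  show "(\<lambda>n. prob {\<omega>\<in>space M. ennreal \<epsilon> < tail x n \<omega>}) \<longlonglongrightarrow> 0"
  proof (rule prob_decseq_tendsto_0)
    show "{\<omega>\<in>space M. ennreal \<epsilon> < tail x n \<omega>} \<in> events" for n using tail_measurable[of x n] by measurable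
    have "tail x n \<omega> \<le> tail x m \<omega>" if "m \<le> n" for m n \<omega>
      unfolding tail_def using that by (intro suminf_le) auto
    then show "decseq (\<lambda>n. {\<omega>\<in>space M. ennreal \<epsilon> < tail x n \<omega>})"
      unfolding decseq_def by (auto intro: less_le_trans)
    show "AE \<omega> in M. \<exists>n. \<omega> \<notin> {\<omega>\<in>space M. ennreal \<epsilon> < tail x n \<omega>}"
      using AE_integrand_square_summable[of x]
    proof (rule AE_mp, intro AE_I2 impI)
      fix \<omega> assume "square_sum x \<omega> < \<infinity>"
      from order_tendstoD(2)[OF tail_tendsto[OF this], of "ennreal \<epsilon>"] \<epsilon>
      obtain n where "tail x n \<omega> < ennreal \<epsilon>" by (auto simp: eventually_sequentially)
      then show "\<exists>n. \<omega> \<notin> {\<omega>\<in>space M. ennreal \<epsilon> < tail x n \<omega>}" by (intro exI[of _ n]) auto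
    qed
  qed
qed


section \<open>The integral process before time one\<close>

lemma partial_integral_Suc:
  "partial_integral x (Suc n) t \<omega> = partial_integral x n t \<omega> +
     (W (min (grid (Suc n)) t) \<omega> - W (min (grid n) t) \<omega>) * (scale n * (integrand n \<omega> \<bullet> x))"
  by (simp add: partial_integral_def)

lemma partial_integral_eq_step_integral: "partial_integral x n t \<omega> = step_integral W (approx x 0 n) t \<omega>"
  by (simp add: step_integral_approx) (simp add: partial_integral_def)

lemma partial_integral_stable:
  assumes "t \<le> grid m" "m \<le> n"
  shows "partial_integral x n t \<omega> = partial_integral x m t \<omega>"
  using assms(2)
proof (induction n rule: dec_induct)
  case (step n)
  have "t \<le> grid n" "t \<le> grid (Suc n)"
    using assms(1) grid_mono[of m n] grid_mono[of m "Suc n"] step.hyps by simp_all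
  then show ?case using step by (simp add: partial_integral_Suc)
qed simp

text \<open>\<open>scale j\<close> times the increment of \<open>W\<close> is
  \<open>noise j\<close>; once the first \<open>n\<close> cells are completed, the integral is the
  walk in this coordinate.\<close>

lemma partial_integral_late:
  assumes "grid n \<le> t"
  shows "partial_integral x n t \<omega> = walk n \<omega> \<bullet> x"
  using assms
proof (induction n)
  case (Suc n)
  have "grid n \<le> t" using Suc.prems grid_bounds(4)[of n] by simp
  then show ?case
    using Suc by (simp add: partial_integral_Suc walk_Suc noise_def inner_add_left del: walk.simps)
qed (simp add: partial_integral_def)

lemma partial_integral_continuous: "\<omega> \<in> space M \<Longrightarrow> continuous_on {0..} (\<lambda>t. partial_integral x n t \<omega>)"
  unfolding partial_integral_eq_step_integral by (rule step_integral_continuous[OF adapted_approx])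

lemma partial_integral_measurable: "0 \<le> t \<Longrightarrow> partial_integral x n t \<in> borel_measurable M"
  unfolding partial_integral_eq_step_integral[abs_def] strongly_measurable_real[symmetric]
  by (rule step_integral_strongly_measurable[OF adapted_approx])

text \<open>For t < 1 the partial integrals are eventually constant in the number of cells, and
  \<open>Suc (cell t)\<close> is an index from which this holds.\<close>

definition limit_integral :: "'e \<Rightarrow> real \<Rightarrow> 'w \<Rightarrow> real" where
  "limit_integral x t \<omega> = partial_integral x (Suc (cell t)) t \<omega>"

lemma limit_integral_eq:
  assumes "t \<le> grid n"
  shows "limit_integral x t \<omega> = partial_integral x n t \<omega>"
proof -
  have "t \<le> grid (Suc n)" using assms grid_bounds(4)[of n] by simp
  then have "t \<le> grid (Suc (cell t))" unfolding cell_def by (rule LeastI)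
  then show ?thesis
    unfolding limit_integral_def
    using partial_integral_stable[OF assms] partial_integral_stable[of t "Suc (cell t)"]
    by (metis nat_le_linear)
qed

section \<open>Uniform control of the later contributions\<close>

definition tail_exceeds :: "'e \<Rightarrow> real \<Rightarrow> nat \<Rightarrow> 'w set" where
  "tail_exceeds x \<epsilon> n = (\<Union>k. {\<omega>\<in>space M. \<exists>t\<in>{0..1}. \<epsilon> < \<bar>step_integral W (approx x n (n + k)) t \<omega>\<bar>})"

lemma tail_exceeds_event: "tail_exceeds x \<epsilon> n \<in> events"
  unfolding tail_exceeds_def using step_exceedance_measurable[OF adapted_approx] by blast

text \<open>The events in the union over \<open>k\<close> increase, and the maximal inequality
  bounds each of them by the same number, because every energy is below the same tail. One event
  thus controls all later stages at once.\<close>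

lemma tail_exceeds_prob_le:
  assumes \<epsilon>: "0 < \<epsilon>" and \<delta>: "0 \<le> \<delta>"
  shows "prob (tail_exceeds x \<epsilon> n) \<le> \<delta> / \<epsilon>\<^sup>2 + prob {\<omega>\<in>space M. ennreal \<delta> < tail x n \<omega>}"
proof -
  let ?C = "\<lambda>k. {\<omega>\<in>space M. \<exists>t\<in>{0..1}. \<epsilon> < \<bar>step_integral W (approx x n (n + k)) t \<omega>\<bar>}"
  have C: "range ?C \<subseteq> events" using step_exceedance_measurable[OF adapted_approx] by blast
  have inc: "incseq ?C"
  proof (rule incseq_SucI, safe)
    fix k \<omega> t assume t: "t \<in> {0..1::real}" and less: "\<epsilon> < \<bar>step_integral W (approx x n (n + k)) t \<omega>\<bar>"
    \<comment> \<open>Stopping at \<open>grid (n + k)\<close> hides the additional cell, so an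
      exceedance at stage \<open>k\<close> is still visible at stage \<open>Suc k\<close>.\<close>
    let ?u = "min t (grid (n + k))"
    have u: "?u \<in> {0..1}" using t grid_bounds(2,3)[of "n + k"] by (auto simp: min_def)
    have "step_integral W (approx x n (n + k)) t \<omega> = step_integral W (approx x n (n + Suc k)) ?u \<omega>"
    proof (cases "t \<le> grid (n + k)")
      case True
      then show ?thesis
        using partial_integral_stable[of t "n + k" "n + Suc k" x \<omega>] by (simp add: step_integral_approx min_def)
    next
      case False
      have "grid n \<le> grid (n + k)" by (rule grid_mono) simp
      then show ?thesis
        using False partial_integral_stable[of "grid (n + k)" "n + k" "n + Suc k" x \<omega>]
        by (simp add: step_integral_approx min_def partial_integral_late)
    qed
    then show "\<exists>t\<in>{0..1}. \<epsilon> < \<bar>step_integral W (approx x n (n + Suc k)) t \<omega>\<bar>" using less u by auto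
  qed
  have "(\<lambda>k. prob (?C k)) \<longlonglongrightarrow> prob (tail_exceeds x \<epsilon> n)"
    unfolding tail_exceeds_def by (rule finite_Lim_measure_incseq[OF C inc])
  moreover have "prob (?C k) \<le> \<delta> / \<epsilon>\<^sup>2 + prob {\<omega>\<in>space M. ennreal \<delta> < tail x n \<omega>}" for k
  proof -
    have "prob (?C k) \<le> \<delta> / \<epsilon>\<^sup>2 + prob {\<omega>\<in>space M. ennreal \<delta> < energy (step_process (approx x n (n + k))) \<omega>}"
      by (rule maximal_inequality[OF adapted_approx \<epsilon> \<delta>])
    also have "prob {\<omega>\<in>space M. ennreal \<delta> < energy (step_process (approx x n (n + k))) \<omega>} \<le>
        prob {\<omega>\<in>space M. ennreal \<delta> < tail x n \<omega>}"
    proof (rule finite_measure_mono)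
      show "{\<omega>\<in>space M. ennreal \<delta> < tail x n \<omega>} \<in> events" using tail_measurable[of x n] by measurable
      show "{\<omega>\<in>space M. ennreal \<delta> < energy (step_process (approx x n (n + k))) \<omega>} \<subseteq>
          {\<omega>\<in>space M. ennreal \<delta> < tail x n \<omega>}"
        using less_le_trans[OF _ energy_approx_le] by blast
    qed
    finally show ?thesis by simp
  qed
  ultimately show ?thesis using LIMSEQ_le_const2 by blast
qed

lemma tail_exceeds_tendsto:
  assumes \<epsilon>: "0 < \<epsilon>"
  shows "(\<lambda>n. prob (tail_exceeds x \<epsilon> n)) \<longlonglongrightarrow> 0"
proof (rule LIMSEQ_I)
  fix r :: real assume r: "r > 0"
  define \<delta> where "\<delta> = \<epsilon>\<^sup>2 * (r / 2)"
  have \<delta>: "\<delta> > 0" "\<delta> / \<epsilon>\<^sup>2 = r / 2" using \<epsilon> r by (simp_all add: \<delta>_def)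
  have "(\<lambda>n. prob {\<omega>\<in>space M. ennreal \<delta> < tail x n \<omega>}) \<longlonglongrightarrow> 0"
    using tail_null[of x] \<delta>(1) unfolding null_in_probability_def by blast
  then have "\<forall>\<^sub>F n in sequentially. prob {\<omega>\<in>space M. ennreal \<delta> < tail x n \<omega>} < r / 2"
    using r by (intro order_tendstoD(2)) auto
  then obtain N where N: "\<And>n. n \<ge> N \<Longrightarrow> prob {\<omega>\<in>space M. ennreal \<delta> < tail x n \<omega>} < r / 2"
    by (auto simp: eventually_sequentially)
  show "\<exists>no. \<forall>n\<ge>no. norm (prob (tail_exceeds x \<epsilon> n) - 0) < r"
  proof (intro exI[of _ N] allI impI)
    fix n assume n: "n \<ge> N"
    have "prob (tail_exceeds x \<epsilon> n) \<le> r / 2 + prob {\<omega>\<in>space M. ennreal \<delta> < tail x n \<omega>}"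
      using tail_exceeds_prob_le[OF \<epsilon> less_imp_le[OF \<delta>(1)], of x n] unfolding \<delta>(2) .
    also have "\<dots> < r" using N[OF n] by simp
    finally show "norm (prob (tail_exceeds x \<epsilon> n) - 0) < r" by simp
  qed
qed

lemma not_tail_exceeds_bound:
  assumes \<omega>: "\<omega> \<in> space M" "\<omega> \<notin> tail_exceeds x \<epsilon> n" and t: "0 \<le> t" "t < 1"
  shows "\<bar>limit_integral x t \<omega> - partial_integral x n t \<omega>\<bar> \<le> \<epsilon>"
proof -
  obtain m where m: "t < grid m" using exists_grid_ge[OF t(2)] by blast
  have "grid m \<le> grid (n + m)" by (rule grid_mono) simp
  then have "t \<le> grid (n + m)" using m by simp
  then have "limit_integral x t \<omega> - partial_integral x n t \<omega> = step_integral W (approx x n (n + m)) t \<omega>"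
    by (simp add: limit_integral_eq step_integral_approx)
  then show ?thesis using \<omega> t unfolding tail_exceeds_def by (auto simp: not_less)
qed

text \<open>Off \<open>tail_exceeds\<close> the walk stays within \<epsilon> of its value at step
  \<open>n\<close>; letting the later index tend to infinity compares this value with the limit 0.
  This is the estimate at time 1.\<close>

lemma not_tail_exceeds_walk_bound:
  assumes \<omega>: "\<omega> \<in> space M" "\<omega> \<notin> tail_exceeds x \<epsilon> n" and lim: "(\<lambda>j. walk j \<omega> \<bullet> x) \<longlonglongrightarrow> 0"
  shows "\<bar>walk n \<omega> \<bullet> x\<bar> \<le> \<epsilon>"
proof -
  have "\<bar>walk m \<omega> \<bullet> x - walk n \<omega> \<bullet> x\<bar> \<le> \<epsilon>" if "m \<ge> n" for m
    using not_tail_exceeds_bound[OF \<omega> grid_bounds(2,3), of m] grid_mono[OF that]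
    by (simp add: limit_integral_eq[of _ m] partial_integral_late)
  moreover have "(\<lambda>m. \<bar>walk m \<omega> \<bullet> x - walk n \<omega> \<bullet> x\<bar>) \<longlonglongrightarrow> \<bar>0 - walk n \<omega> \<bullet> x\<bar>"
    by (intro tendsto_rabs tendsto_diff lim tendsto_const)
  ultimately have "\<bar>0 - walk n \<omega> \<bullet> x\<bar> \<le> \<epsilon>" by (intro LIMSEQ_le_const2) blast+
  then show ?thesis by simp
qed

section \<open>Extension to time one and existence of the weak integrals\<close>

definition regular :: "'e \<Rightarrow> 'w \<Rightarrow> bool" where
  "regular x \<omega> \<longleftrightarrow> (\<lambda>j. walk j \<omega> \<bullet> x) \<longlonglongrightarrow> 0 \<and> (\<forall>k. \<exists>n. \<omega> \<notin> tail_exceeds x (1 / real (Suc k)) n)"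

text \<open>The levels 1/(k + 1) suffice for continuity at time 1 and keep the number of exceptional
  sets countable; each of these lies in events whose probabilities tend to zero.\<close>

lemma AE_regular: "AE \<omega> in M. regular x \<omega>"
proof -
  have "AE \<omega> in M. \<exists>n. \<omega> \<notin> tail_exceeds x (1 / real (Suc k)) n" for k
  proof -
    let ?A = "tail_exceeds x (1 / real (Suc k))"
    have lim: "(\<lambda>n. prob (?A n)) \<longlonglongrightarrow> 0" by (rule tail_exceeds_tendsto) simp
    have ev: "(\<Inter>n. ?A n) \<in> events" using tail_exceeds_event by auto
    have "prob (\<Inter>n. ?A n) \<le> prob (?A n)" for n
      using tail_exceeds_event by (intro finite_measure_mono) auto
    then have "prob (\<Inter>n. ?A n) \<le> 0" using LIMSEQ_le_const[OF lim] by blast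
    then have "prob (\<Inter>n. ?A n) = 0" using measure_nonneg[of M "\<Inter>n. ?A n"] by linarith
    then have "(\<Inter>n. ?A n) \<in> null_sets M" using ev by (intro null_setsI) (simp_all add: emeasure_eq_measure)
    then show ?thesis by (rule AE_I') auto
  qed
  then have "AE \<omega> in M. \<forall>k. \<exists>n. \<omega> \<notin> tail_exceeds x (1 / real (Suc k)) n" by (simp add: AE_all_countable)
  with AE_walk_tendsto[of x] show ?thesis unfolding regular_def by eventually_elim simp
qed

lemma limit_integral_tendsto:
  assumes \<omega>: "\<omega> \<in> space M" "regular x \<omega>" and r: "0 < r"
  shows "\<exists>s<1. \<forall>t. 0 \<le> t \<longrightarrow> s \<le> t \<longrightarrow> t < 1 \<longrightarrow> \<bar>limit_integral x t \<omega>\<bar> < r"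
proof -
  obtain k where k: "1 / real (Suc k) < r / 2" using reals_Archimedean[of "r / 2"] r by (auto simp: inverse_eq_divide)
  obtain n where n: "\<omega> \<notin> tail_exceeds x (1 / real (Suc k)) n" using \<omega>(2) unfolding regular_def by blast
  have w: "\<bar>walk n \<omega> \<bullet> x\<bar> \<le> 1 / real (Suc k)"
    using not_tail_exceeds_walk_bound[OF \<omega>(1) n] \<omega>(2) unfolding regular_def by blast
  have "\<bar>limit_integral x t \<omega>\<bar> < r" if "0 \<le> t" "grid n \<le> t" "t < 1" for t
    using not_tail_exceeds_bound[OF \<omega>(1) n that(1,3)] w k unfolding partial_integral_late[OF that(2)] by linarith
  then show ?thesis using grid_bounds(3)[of n] by blast
qed

text \<open>Outside a null set the integral before time 1 extends continuously by the value 0,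
  because the walk tends to zero in this coordinate. The trace on the grid is recorded for the
  comparison with a hypothetical vector-valued integral.\<close>

lemma exists_stochastic_integral:
  "\<exists>X. has_stochastic_integral M F W (\<lambda>t \<omega>. process t \<omega> \<bullet> x) X \<and>
     (\<forall>\<omega>. X 1 \<omega> = 0) \<and> (AE \<omega> in M. \<forall>j. X (grid j) \<omega> = walk j \<omega> \<bullet> x)"
proof -
  obtain N where N: "{\<omega>\<in>space M. \<not> regular x \<omega>} \<subseteq> N" "N \<in> null_sets M"
    using AE_E[OF AE_regular[of x]] by (metis null_setsI)
  then have N_ev: "N \<in> events" by auto
  \<comment> \<open>Putting 0 on a measurable null set \<open>N\<close> around the irregular points
    makes every path continuous and keeps the marginals measurable; the value 0 at time 1 is the
    limit of the walk.\<close>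
  define X where "X t \<omega> = (if \<omega> \<in> N \<or> 1 \<le> t then 0 else limit_integral x t \<omega>)" for t \<omega>
  have reg: "regular x \<omega>" if "\<omega> \<in> space M" "\<omega> \<notin> N" for \<omega> using N that by blast
  have cont: "continuous_on {0..1} (\<lambda>t. X t \<omega>)" if \<omega>: "\<omega> \<in> space M" for \<omega>
  proof (cases "\<omega> \<in> N")
    case True
    then show ?thesis by (simp add: X_def)
  next
    case False
    show ?thesis
      unfolding continuous_on_eq_continuous_within
    proof
      fix t :: real assume t: "t \<in> {0..1}"
      show "continuous (at t within {0..1}) (\<lambda>t. X t \<omega>)"
      proof (cases "t < 1")
        case True
        \<comment> \<open>Near a time below 1 a single partial integral represents
          \<open>X\<close>.\<close>
        obtain n where n: "t < grid n" using exists_grid_ge[OF True] by blast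
        have "continuous_on {0..1} (\<lambda>t. partial_integral x n t \<omega>)"
          using partial_integral_continuous[OF \<omega>] by (rule continuous_on_subset) auto
        then have c: "continuous (at t within {0..1}) (\<lambda>t. partial_integral x n t \<omega>)"
          using t unfolding continuous_on_eq_continuous_within by blast
        show ?thesis
        proof (rule continuous_transform_within[OF c, of "grid n - t"])
          show "0 < grid n - t" using n by simp
          show "partial_integral x n t' \<omega> = X t' \<omega>" if "t' \<in> {0..1}" "dist t' t < grid n - t" for t'
          proof -
            have "t' < grid n" using that(2) by (auto simp: dist_real_def)
            then show ?thesis using False grid_bounds(3)[of n] limit_integral_eq[of t' n] by (simp add: X_def)
          qed
        qed (use t in auto)
      next
        case False
        then have t1: "t = 1" using t by simp
        show ?thesis
          unfolding continuous_within_eps_delta t1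
        proof (intro allI impI)
          fix r :: real assume r: "0 < r"
          obtain s where s: "s < 1" "\<And>t. 0 \<le> t \<Longrightarrow> s \<le> t \<Longrightarrow> t < 1 \<Longrightarrow> \<bar>limit_integral x t \<omega>\<bar> < r"
            using limit_integral_tendsto[OF \<omega> reg[OF \<omega> \<open>\<omega> \<notin> N\<close>] r] by blast
          show "\<exists>d>0. \<forall>t'\<in>{0..1}. dist t' 1 < d \<longrightarrow> dist (X t' \<omega>) (X 1 \<omega>) < r"
          proof (intro exI[of _ "1 - s"] conjI ballI impI)
            fix t' :: real assume "t' \<in> {0..1}" "dist t' 1 < 1 - s"
            then have "0 \<le> t'" "s \<le> t'" by (auto simp: dist_real_def)
            then show "dist (X t' \<omega>) (X 1 \<omega>) < r"
              using s(2)[of t'] r by (simp add: X_def)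
          qed (use s in simp)
        qed
      qed
    qed
  qed
  have "X t \<in> borel_measurable M" if "t \<in> {0..1}" for t
  proof (cases "t < 1")
    case True
    have [measurable]: "N \<in> events" "limit_integral x t \<in> borel_measurable M"
      using N_ev partial_integral_measurable[of t] that unfolding limit_integral_def[abs_def] by auto
    have "X t = (\<lambda>\<omega>. if \<omega> \<in> N then 0 else limit_integral x t \<omega>)" using True by (auto simp: X_def fun_eq_iff)
    then show ?thesis by simp
  next
    case False
    then have "X t = (\<lambda>_. 0)" by (auto simp: X_def fun_eq_iff)
    then show ?thesis by simp
  qed
  then have cp: "continuous_process M X"
    unfolding continuous_process_def strongly_measurable_real using cont by blast
  have ad: "strongly_adapted F (\<lambda>t \<omega>. process t \<omega> \<bullet> x)"
    using progressive_imp_adapted[OF process_progressive] strongly_measurable_inner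
    unfolding strongly_adapted_def strongly_measurable_real by blast
  have mp: "strongly_measurable_process M (\<lambda>t \<omega>. process t \<omega> \<bullet> x)"
    by (rule strongly_measurable_process_inner[OF progressive_imp_measurable_process[OF process_progressive]])
  have wk: "weakly_in_Lp M 0 (\<lambda>t \<omega>. process t \<omega> \<bullet> x)"
    unfolding weakly_in_Lp_def
  proof (intro allI conjI)
    fix y :: real
    have "AE \<omega> in M. (\<integral>\<^sup>+t\<in>{0..1}. ennreal (\<bar>process t \<omega> \<bullet> (y *\<^sub>R x)\<bar>\<^sup>2) \<partial>lborel) < \<infinity>"
      unfolding process_square_integral by (rule AE_integrand_square_summable)
    then show "AE \<omega> in M. (\<integral>\<^sup>+t\<in>{0..1}. ennreal (\<bar>(process t \<omega> \<bullet> x) \<bullet> y\<bar>\<^sup>2) \<partial>lborel) < \<infinity>"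
      by (simp add: mult.commute)
  qed simp
  let ?D = "\<lambda>n t \<omega>. norm (step_integral W (approx x 0 n) t \<omega> - X t \<omega>)"
  have sup: "null_in_probability M (\<lambda>n \<omega>. SUP t\<in>{0..1}. ennreal (?D n t \<omega>))"
    unfolding null_in_probability_def
  proof (intro allI impI)
    fix \<epsilon> :: real assume \<epsilon>: "0 < \<epsilon>"
    show "(\<lambda>n. prob {\<omega>\<in>space M. ennreal \<epsilon> < (SUP t\<in>{0..1}. ennreal (?D n t \<omega>))}) \<longlonglongrightarrow> 0"
    proof (rule prob_tendsto_0_mono)
      \<comment> \<open>Off this set, times below 1 are handled by
        \<open>not_tail_exceeds_bound\<close>; at time 1 the error is the absolute value of
        \<open>walk n \<omega> \<bullet> x\<close>, as \<open>X\<close> vanishes there.\<close>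
      show "tail_exceeds x \<epsilon> n \<union> N \<in> events" for n using tail_exceeds_event N_ev by blast
      have "prob (tail_exceeds x \<epsilon> n \<union> N) = prob (tail_exceeds x \<epsilon> n)" for n
        using tail_exceeds_event N by (intro measure_Un_null_set) auto
      then show "(\<lambda>n. prob (tail_exceeds x \<epsilon> n \<union> N)) \<longlonglongrightarrow> 0" using tail_exceeds_tendsto[OF \<epsilon>] by simp
      show "{\<omega>\<in>space M. ennreal \<epsilon> < (SUP t\<in>{0..1}. ennreal (?D n t \<omega>))}
          \<subseteq> tail_exceeds x \<epsilon> n \<union> N" for n
      proof (rule subsetI, rule ccontr)
        fix \<omega> assume "\<omega> \<in> {\<omega>\<in>space M. ennreal \<epsilon> < (SUP t\<in>{0..1}. ennreal (?D n t \<omega>))}"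
          and nin: "\<omega> \<notin> tail_exceeds x \<epsilon> n \<union> N"
        then obtain t where \<omega>: "\<omega> \<in> space M" and t: "t \<in> {0..1}" "\<epsilon> < \<bar>partial_integral x n t \<omega> - X t \<omega>\<bar>"
          using \<epsilon> by (auto simp: less_SUP_ennreal_iff partial_integral_eq_step_integral)
        have \<omega>': "\<omega> \<notin> tail_exceeds x \<epsilon> n" "\<omega> \<notin> N" using nin by auto
        show False
        proof (cases "t < 1")
          case True
          then have "\<bar>X t \<omega> - partial_integral x n t \<omega>\<bar> \<le> \<epsilon>"
            using not_tail_exceeds_bound[OF \<omega> \<omega>'(1), of t] t(1) \<omega>'(2) by (simp add: X_def)
          then show False using t(2) by linarith
        next
          case False
          then have "t = 1" using t(1) by simp
          moreover have "\<bar>walk n \<omega> \<bullet> x\<bar> \<le> \<epsilon>"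
            using not_tail_exceeds_walk_bound[OF \<omega> \<omega>'(1)] reg[OF \<omega> \<omega>'(2)] unfolding regular_def by blast
          ultimately show False
            using t(2) partial_integral_late[of n 1 x \<omega>] grid_bounds(3)[of n] by (simp add: X_def)
        qed
      qed
    qed
  qed
  have "has_stochastic_integral M F W (\<lambda>t \<omega>. process t \<omega> \<bullet> x) X"
    unfolding has_stochastic_integral_def
  proof (intro conjI exI[of _ "approx x 0"] allI)
    show "adapted_step F (approx x 0 n)" for n by (rule adapted_approx)
    show "null_in_probability M (\<lambda>n \<omega>. \<integral>\<^sup>+t\<in>{0..1}.
        ennreal (\<bar>step_process (approx x 0 n) t \<omega> \<bullet> y - (process t \<omega> \<bullet> x) \<bullet> y\<bar>\<^sup>2) \<partial>lborel)" for y
      unfolding approx_error by (rule tail_null)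
  qed (rule mp ad wk cp sup)+
  moreover have "AE \<omega> in M. \<forall>j. X (grid j) \<omega> = walk j \<omega> \<bullet> x"
    using AE_not_in[OF N(2)]
  proof (rule AE_mp, intro AE_I2 impI allI)
    fix \<omega> j assume "\<omega> \<notin> N"
    then show "X (grid j) \<omega> = walk j \<omega> \<bullet> x"
      using grid_bounds(3)[of j] by (simp add: X_def limit_integral_eq[of _ j] partial_integral_late)
  qed
  ultimately show ?thesis by (intro exI[of _ X]) (simp add: X_def)
qed

text \<open>The choice operator returns an unknown representative; uniqueness transfers the terminal
  value 0 of the explicit one to it.\<close>

lemma weak_stochastic_integral_eq_0:
  shows "stochastically_integrable M F W (\<lambda>t \<omega>. process t \<omega> \<bullet> x)"
    and "AE \<omega> in M. stochastic_integral M F W (\<lambda>t \<omega>. process t \<omega> \<bullet> x) 1 \<omega> = 0"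
proof -
  obtain X where X: "has_stochastic_integral M F W (\<lambda>t \<omega>. process t \<omega> \<bullet> x) X" "\<And>\<omega>. X 1 \<omega> = 0"
    using exists_stochastic_integral[of x] by blast
  then show "stochastically_integrable M F W (\<lambda>t \<omega>. process t \<omega> \<bullet> x)"
    unfolding stochastically_integrable_def by blast
  have "has_stochastic_integral M F W (\<lambda>t \<omega>. process t \<omega> \<bullet> x) (stochastic_integral M F W (\<lambda>t \<omega>. process t \<omega> \<bullet> x))"
    unfolding stochastic_integral_def by (rule someI[of "has_stochastic_integral M F W (\<lambda>t \<omega>. process t \<omega> \<bullet> x)", OF X(1)])
  from stochastic_integral_unique[OF this X(1), of 1]
  show "AE \<omega> in M. stochastic_integral M F W (\<lambda>t \<omega>. process t \<omega> \<bullet> x) 1 \<omega> = 0" using X(2) by simp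
qed

section \<open>Failure of stochastic integrability\<close>

lemma noise_not_tendsto_0: "\<not> (AE \<omega> in M. (\<lambda>j. noise j \<omega>) \<longlonglongrightarrow> 0)"
proof
  assume lim: "AE \<omega> in M. (\<lambda>j. noise j \<omega>) \<longlonglongrightarrow> 0"
  \<comment> \<open>If the noises tended to zero, dominated convergence would send the means of this
    bounded function to zero. All noises have the same law, so these means are equal and would
    vanish; \<open>noise 0\<close> would be zero almost surely, against its second moment 1.\<close>
  let ?h = "\<lambda>z::real. ennreal (min 1 (z\<^sup>2))"
  note [measurable] = noise_measurable
  have "(\<lambda>j. \<integral>\<^sup>+\<omega>. ?h (noise j \<omega>) \<partial>M) \<longlonglongrightarrow> (\<integral>\<^sup>+\<omega>. 0 \<partial>M)"
  proof (rule nn_integral_dominated_convergence[where w="\<lambda>_. 1"])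
    show "AE \<omega> in M. ?h (noise j \<omega>) \<le> 1" for j by (intro AE_I2) (simp add: ennreal_le_1)
    show "AE \<omega> in M. (\<lambda>j. ?h (noise j \<omega>)) \<longlonglongrightarrow> 0"
      using lim
    proof (rule AE_mp, intro AE_I2 impI)
      fix \<omega> assume "(\<lambda>j. noise j \<omega>) \<longlonglongrightarrow> 0"
      then have "(\<lambda>j. min 1 ((noise j \<omega>)\<^sup>2)) \<longlonglongrightarrow> min 1 (0\<^sup>2)"
        by (intro tendsto_min tendsto_const tendsto_power)
      then have "(\<lambda>j. ?h (noise j \<omega>)) \<longlonglongrightarrow> ennreal (min 1 (0\<^sup>2))" by (rule tendsto_ennrealI)
      then show "(\<lambda>j. ?h (noise j \<omega>)) \<longlonglongrightarrow> 0" by simp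
    qed
  qed (auto simp: emeasure_space_1)
  moreover have const: "(\<integral>\<^sup>+\<omega>. ?h (noise j \<omega>) \<partial>M) = (\<integral>\<^sup>+z. ennreal (std_normal_density z) * ?h z \<partial>lborel)" for j
    by (rule nn_integral_noise) measurable
  ultimately have "(\<integral>\<^sup>+z. ennreal (std_normal_density z) * ?h z \<partial>lborel) = (\<integral>\<^sup>+\<omega>. 0 \<partial>M)"
    by (simp only: LIMSEQ_const_iff)
  then have "(\<integral>\<^sup>+\<omega>. ?h (noise 0 \<omega>) \<partial>M) = 0" unfolding const by simp
  then have "AE \<omega> in M. ?h (noise 0 \<omega>) = 0" by (subst (asm) nn_integral_0_iff_AE) auto
  then have "AE \<omega> in M. noise 0 \<omega> = 0"
    by (rule AE_mp) (auto intro!: AE_I2 simp: ennreal_eq_0_iff min_le_iff_disj)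
  then have "(\<integral>\<^sup>+\<omega>. ennreal (1 + (0 + 1 * noise 0 \<omega>)\<^sup>2) \<partial>M) = (\<integral>\<^sup>+\<omega>. 1 \<partial>M)"
    by (intro nn_integral_cong_AE) auto
  then show False unfolding nn_integral_noise_quadratic by (simp add: emeasure_space_1)
qed

text \<open>Only countably many vectors \<open>e k\<close> and grid times are tested, so one null
  set suffices and agreement with the walk may be used pathwise along the random direction. There
  the increment of the walk is exactly the noise, so continuity of \<open>X\<close> at time 1 would
  force the noise to zero.\<close>

lemma process_not_stochastically_integrable: "\<not> stochastically_integrable M F W process"
proof
  assume "stochastically_integrable M F W process"
  then obtain X where X: "has_stochastic_integral M F W process X" unfolding stochastically_integrable_def by blast
  have "AE \<omega> in M. \<forall>j. X (grid j) \<omega> \<bullet> e k = walk j \<omega> \<bullet> e k" for k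
  proof -
    obtain Y where Y: "has_stochastic_integral M F W (\<lambda>t \<omega>. process t \<omega> \<bullet> e k) Y"
      "AE \<omega> in M. \<forall>j. Y (grid j) \<omega> = walk j \<omega> \<bullet> e k" using exists_stochastic_integral[of "e k"] by blast
    have "AE \<omega> in M. X (grid j) \<omega> \<bullet> e k = Y (grid j) \<omega>" for j
      by (rule stochastic_integral_unique[OF has_stochastic_integral_inner[OF X] Y(1)])
        (use grid_bounds[of j] in auto)
    then have "AE \<omega> in M. \<forall>j. X (grid j) \<omega> \<bullet> e k = Y (grid j) \<omega>" by (simp add: AE_all_countable)
    with Y(2) show ?thesis by eventually_elim simp
  qed
  then have "AE \<omega> in M. \<forall>k j. X (grid j) \<omega> \<bullet> e k = walk j \<omega> \<bullet> e k" by (simp add: AE_all_countable)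
  then have "AE \<omega> in M. (\<lambda>j. noise j \<omega>) \<longlonglongrightarrow> 0"
  proof (rule AE_mp, intro AE_I2 impI)
    fix \<omega> assume \<omega>: "\<omega> \<in> space M" and eq: "\<forall>k j. X (grid j) \<omega> \<bullet> e k = walk j \<omega> \<bullet> e k"
    have le: "\<bar>noise j \<omega>\<bar> \<le> norm (X (grid (Suc j)) \<omega> - X (grid j) \<omega>)" for j
    proof -
      let ?d = "e (direction j \<omega>)"
      have "(X (grid (Suc j)) \<omega> - X (grid j) \<omega>) \<bullet> ?d = noise j \<omega>"
        using eq by (simp add: inner_diff_left walk_Suc inner_add_left integrand_inner_direction del: walk.simps)
      moreover have "norm ?d = 1" by (simp add: norm_eq_1 orthonormal)
      ultimately show ?thesis
        using Cauchy_Schwarz_ineq2[of "X (grid (Suc j)) \<omega> - X (grid j) \<omega>" ?d] by simp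
    qed
    have "continuous_on {0..1} (\<lambda>t. X t \<omega>)"
      using X \<omega> unfolding has_stochastic_integral_def continuous_process_def by blast
    then have lim: "(\<lambda>j. X (grid j) \<omega>) \<longlonglongrightarrow> X 1 \<omega>"
      by (rule continuous_on_tendsto_compose[OF _ grid_tendsto])
        (auto intro!: always_eventually simp: grid_bounds grid_bounds(3)[THEN less_imp_le])
    have "(\<lambda>j. norm (X (grid (Suc j)) \<omega> - X (grid j) \<omega>)) \<longlonglongrightarrow> norm (X 1 \<omega> - X 1 \<omega>)"
      by (rule tendsto_norm[OF tendsto_diff[OF LIMSEQ_Suc[OF lim] lim]])
    then have "(\<lambda>j. norm (X (grid (Suc j)) \<omega> - X (grid j) \<omega>)) \<longlonglongrightarrow> 0" by simp
    then show "(\<lambda>j. noise j \<omega>) \<longlonglongrightarrow> 0"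
      by (rule Lim_null_comparison[rotated]) (intro always_eventually allI, simp only: real_norm_def le)
  qed
  then show False using noise_not_tendsto_0 by contradiction
qed

end

theorem theorem2p2:
  fixes M :: "'w measure"
    and F :: "real \<Rightarrow> 'w measure"
    and W :: "real \<Rightarrow> 'w \<Rightarrow> real"
  assumes "prob_space M"
    and "complete_filtration M F"
    and "brownian_motion M F W"
    and infinite_dimensional: "\<nexists>B :: ('e :: {real_inner, banach}) set. finite B \<and> span B = UNIV"
  shows "\<exists>\<phi> :: real \<Rightarrow> 'w \<Rightarrow> 'e.
           strongly_progressively_measurable F \<phi> \<and>
           (\<forall>p. 0 \<le> p \<and> p < 1 \<longrightarrow> weakly_in_Lp M p \<phi>) \<and>
           (\<forall>x. stochastically_integrable M F W (\<lambda>t \<omega>. \<phi> t \<omega> \<bullet> x) \<and>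
                (AE \<omega> in M. stochastic_integral M F W (\<lambda>t \<omega>. \<phi> t \<omega> \<bullet> x) 1 \<omega> = 0)) \<and>
           (AE \<omega> in M. (\<integral>\<^sup>+t\<in>{0..1}. ennreal ((norm (\<phi> t \<omega>))\<^sup>2) \<partial>lborel) = \<infinity>) \<and>
           \<not> stochastically_integrable M F W \<phi>"
proof -
  obtain e :: "nat \<Rightarrow> 'e" where e: "\<And>i j. e i \<bullet> e j = (if i = j then 1 else 0)"
    using exists_orthonormal_sequence[OF infinite_dimensional] by blast
  interpret prob_space M by fact
  interpret weak_example M F W e
    by unfold_locales (use assms(2,3) e in auto)
  have "AE \<omega> in M. (\<integral>\<^sup>+t\<in>{0..1}. ennreal ((norm (process t \<omega>))\<^sup>2) \<partial>lborel) = \<infinity>"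
    by (simp add: process_norm_square_integral)
  then show ?thesis
    using process_progressive process_weakly_in_Lp weak_stochastic_integral_eq_0
      process_not_stochastically_integrable
    by (intro exI[of _ process] conjI allI impI) auto
qed

end
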